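(* For every $N\ge2$, the function $D_N(s)=\sum_{n=N}^\infty A(n,N)n^{-s}$ is holomorphic at all points of the line $\mathrm{Re}(s)=N$ except at $s=N$. Moreover, in a neighbourhood of $s=N$ and for $\mathrm{Re}(s)>N$, one has $$D_N(s)\sim\frac1{(N-1)!}\log\Bigl(\frac1{s-N}\Bigr),\qquad s\to N.$$ By analytic continuation, $D_N(s)$ extends to the universal cover of the punctured half-plane $$\{s\in\mathbb C:\mathrm{Re}(s)>\bar\sigma+N-2\}\setminus Z_N,$$ where $$Z_N=\Bigl\{\,s=\frac{\rho}{k}+N-1\ \Big|\ \rho\text{ a zero or pole of the Riemann zeta function }\zeta(s),\ k\text{ a squarefree positive integer}\Bigr\}.$$
   Context: For $m\ge2$, $p_1(m)$ is the smallest prime divisor of $m$. For $2\le N\le n$, $A(n,N)$ (a Cyrillic "el" in the paper) is the number of compositions $(\lambda_1,\dots,\lambda_N)\in\mathbb Z_{>0}^N$ with $\lambda_1+\dots+\lambda_N=n$ and $\min\{\lambda_1,\lambda_2\}<p_1(\lambda_1+\lambda_2)$; it is the number of partial flag varieties $F_{\boldsymbol\lambda}$ of $N$-step flags in $\mathbb C^n$ whose first semiclassical spectrum is not exceeding (one gets the same number using $(\lambda_i,\lambda_{i+1})$ for any fixed $i\le N-1$). The Dirichlet series $D_N(s)$ converges absolutely for $\mathrm{Re}(s)>N$. The number $\bar\sigma$ is $$\bar\sigma=\limsup_{n\to\infty}\frac1{\log n}\log\Bigl(\sum_{k\le n,\ k\text{ composite}}A(k,2)\Bigr),$$ which is known to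 satisfy $1\le\bar\sigma\le\frac32$. *)

theory Defs
  imports
    "HOL-Complex_Analysis.Complex_Analysis"
    "HOL-Computational_Algebra.Squarefree"
    "HOL-Library.Landau_Symbols"
begin

definition p1 :: "nat \<Rightarrow> nat" where
  "p1 m = (LEAST p. prime p \<and> p dvd m)"

(* For 2 <= N <= n: the number of varieties of N-step partial flags in complex n-space whose first
   semiclassical spectrum is not exceeding; l lists the composition of n (the step sizes). *)
definition flag_count :: "nat \<Rightarrow> nat \<Rightarrow> nat" where
  "flag_count n N =
     card {l :: nat list. length l = N \<and> (\<forall>x\<in>set l. 0 < x) \<and> sum_list l = n \<and>
                          min (l ! 0) (l ! 1) < p1 (l ! 0 + l ! 1)}"

(* The unordered sum is meaningful (converges absolutely) for Re s > N; elsewhere its value is junk. *)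
definition dirichlet_flag :: "nat \<Rightarrow> complex \<Rightarrow> complex" where
  "dirichlet_flag N s = (\<Sum>\<^sub>\<infinity>n\<in>{N..}. of_nat (flag_count n N) * of_nat n powr (- s))"

(* An extended real, so that finiteness of the limsup is not presupposed. *)
definition sigma_bar :: ereal where
  "sigma_bar = limsup (\<lambda>n. ereal
     (1 / ln (real n) * ln (real (\<Sum>k | k \<le> n \<and> 1 < k \<and> \<not> prime k. flag_count k 2))))"

(* The analytic continuation of the zeta series to the plane punctured at 1; it exists and is
   unique there by the identity theorem. Its value at the point 1 is left unspecified. *)
definition riemann_zeta :: "complex \<Rightarrow> complex" where
  "riemann_zeta = (SOME f. f holomorphic_on - {1} \<and>
     (\<forall>s. 1 < Re s \<longrightarrow> f s = (\<Sum>n. 1 / of_nat (Suc n) powr s)))"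

definition branch_points :: "nat \<Rightarrow> complex set" where
  "branch_points N = {\<rho> / of_nat k + of_nat N - 1 | \<rho> k.
            ((\<rho> \<noteq> 1 \<and> riemann_zeta \<rho> = 0) \<or> is_pole riemann_zeta \<rho>) \<and>
            0 < k \<and> squarefree (k :: nat)}"

definition punctured_half_plane :: "nat \<Rightarrow> complex set" where
  "punctured_half_plane N = {s. sigma_bar + ereal (real N - 2) < ereal (Re s)} - branch_points N"

(* f, given on H, continues holomorphically to a neighbourhood of z. *)
definition extends_holomorphically_at ::
    "(complex \<Rightarrow> complex) \<Rightarrow> complex set \<Rightarrow> complex \<Rightarrow> bool" where
  "extends_holomorphically_at f H z \<longleftrightarrow>
     (\<exists>U g. open U \<and> z \<in> U \<and> g holomorphic_on U \<and> (\<forall>s\<in>U \<inter> H. g s = f s))"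

(* The universal cover of a connected open set X with base point b, in its standard model:
   homotopy classes, with endpoints fixed, of the paths in X that start at b. The covering
   projection sends the class of g to pathfinish g. *)
definition path_class :: "complex set \<Rightarrow> (real \<Rightarrow> complex) \<Rightarrow> (real \<Rightarrow> complex) set" where
  "path_class X g = {h. homotopic_paths X g h}"

definition paths_from :: "complex set \<Rightarrow> complex \<Rightarrow> (real \<Rightarrow> complex) set" where
  "paths_from X b = {g. path g \<and> path_image g \<subseteq> X \<and> pathstart g = b}"

definition universal_cover :: "complex set \<Rightarrow> complex \<Rightarrow> (real \<Rightarrow> complex) set set" where
  "universal_cover X b = path_class X ` paths_from X b"

(* The sheet through the class of g over a disc in X centred at pathfinish g: the local inverse
   of the covering projection on that disc. These maps are the inverse charts that define the
   complex structure of the universal cover. *)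
definition sheet :: "complex set \<Rightarrow> (real \<Rightarrow> complex) \<Rightarrow> complex \<Rightarrow> (real \<Rightarrow> complex) set" where
  "sheet X g z = path_class X (g +++ linepath (pathfinish g) z)"

definition holomorphic_on_universal_cover ::
    "((real \<Rightarrow> complex) set \<Rightarrow> complex) \<Rightarrow> complex set \<Rightarrow> complex \<Rightarrow> bool" where
  "holomorphic_on_universal_cover F X b \<longleftrightarrow>
     (\<forall>g r. path_class X g \<in> universal_cover X b \<and> ball (pathfinish g) r \<subseteq> X \<longrightarrow>
        (\<lambda>z. F (sheet X g z)) holomorphic_on ball (pathfinish g) r)"

(* f, given on a convex subset H of X, extends to the universal cover of X: for a base point b
   in H, the points of the cover represented by segments from b inside H form a copy of H, and
   some holomorphic function on the cover restricts to f on this copy. *)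
definition extends_to_universal_cover ::
    "(complex \<Rightarrow> complex) \<Rightarrow> complex set \<Rightarrow> complex set \<Rightarrow> bool" where
  "extends_to_universal_cover f H X \<longleftrightarrow> H \<subseteq> X \<and>
     (\<forall>b\<in>H. \<exists>F. holomorphic_on_universal_cover F X b \<and>
        (\<forall>s\<in>H. F (path_class X (linepath b s)) = f s))"

end

theory Submission
  imports
    Defs
    "HOL-Number_Theory.Prime_Powers"
    "HOL-Real_Asymp.Real_Asymp"
begin

text \<open>
Write \<open>A(n,N)\<close> for \<open>flag_count n N\<close>, \<open>D\<^sub>N\<close> for \<open>dirichlet_flag N\<close> and \<open>P(w)\<close> for the prime zeta
function, the sum of \<open>p\<close> to the power \<open>-w\<close> over the primes \<open>p\<close>. The theorem says that, up to a
holomorphic factor and a holomorphic summand, \<open>D\<^sub>N(s)\<close> is \<open>P(s - N + 1)\<close>, and that \<open>P\<close> has only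
logarithmic singularities, at the points \<open>\<rho>/k\<close>.

Reduction to \<open>P\<close>. A prime \<open>n\<close> contributes \<open>A(n,2) = n - 1\<close>, whereas \<open>A(n,2) \<le> 2\<surd>n\<close> for composite
\<open>n\<close>, because the least prime divisor of \<open>n\<close> is at most \<open>\<surd>n\<close>. Hence
\<open>D\<^sub>2(s) = P(s - 1) - P(s) + E(s)\<close>, where \<open>E\<close> is the Dirichlet series of the composite part;
\<open>sigma_bar\<close> is made to measure for the convergence of \<open>E\<close> to the right of it
(\<open>abs_conv_beyond_partial_sums\<close>). Dropping the last part of a composition gives
\<open>A(n + 1, N + 1) = A(0,N) + ... + A(n,N)\<close>. Summation by parts turns \<open>D\<^sub>N(s - 1)\<close> into a series with
the coefficients \<open>A(n + 1, N + 1)\<close> and the kernel \<open>n^(1-s) - (n+1)^(1-s)\<close>, which is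
\<open>(s - 1)(n+1)^(-s)\<close> up to an error that is smaller by a factor \<open>n\<close>. So
\<open>(s - 1) D\<^bsub>N+1\<^esub>(s) = D\<^sub>N(s - 1) - R(s)\<close>, with \<open>R\<close> holomorphic one unit further to the left
(\<open>flag_series_recursion\<close>). Iterating from \<open>N = 2\<close> gives \<open>D\<^sub>N(s) = c(s) P(s - N + 1) + h(s)\<close> with
\<open>c(N) = 1/(N-1)!\<close> and with \<open>c\<close>, \<open>h\<close> holomorphic for \<open>Re s > sigma_bar + N - 2\<close>
(\<open>flag_series_decomposition\<close>).

The function \<open>P\<close>. Since \<open>-\<zeta>'/\<zeta>(s)\<close> is the sum over \<open>j \<ge> 1\<close> and over the primes of \<open>ln p\<close> times \<open>p\<close>
to the power \<open>-js\<close>, Moebius inversion gives \<open>P'(w) = \<Sum>\<^sub>k \<mu>(k) \<zeta>'(kw)/\<zeta>(kw)\<close> (\<open>prime_zeta_deriv_eq\<close>).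
All but finitely many terms of this series are small near a given \<open>w\<close> with \<open>Re w > 0\<close>, and
\<open>\<mu>(k) = 0\<close> unless \<open>k\<close> is squarefree, so \<open>P'\<close> is single-valued and holomorphic on \<open>Re w > 0\<close> away
from the points \<open>\<rho>/k\<close>. Integrating it along paths continues \<open>P\<close> to the universal cover, because by
the theorem of Cauchy the integral depends only on the homotopy class
(\<open>extends_to_universal_coverI\<close>). As \<open>\<zeta>\<close> has no zero on the line \<open>Re w = 1\<close> (\<open>riemann_zeta_nonzero\<close>),
\<open>P\<close> continues across this line except at \<open>w = 1\<close>, where the simple pole of \<open>\<zeta>\<close> gives
\<open>P(w) = -ln (w - 1)\<close> plus a holomorphic function (\<open>prime_zeta_near_1\<close>). This term is unbounded, so
\<open>N\<close> is a singularity of \<open>D\<^sub>N\<close>, with the asserted asymptotics.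

The facts about \<open>\<zeta>\<close> are derived from its Dirichlet series. Telescoping the Taylor expansions of
\<open>x^(1-s)\<close> between consecutive integers expresses \<open>(s - 1) \<zeta>(s)\<close> through its values at
\<open>s + 1, s + 2, ...\<close> and a series that converges further to the left, which continues it to the whole
plane (\<open>zeta_recursion\<close>).
\<close>

section \<open>Series of holomorphic functions and Dirichlet series\<close>

text \<open>
The theorem of Weierstrass for unordered sums: the M-test makes the finite partial sums converge
locally uniformly, and then their derivatives converge too.
\<close>
lemma holomorphic_infsum:
  fixes f :: "'i \<Rightarrow> complex \<Rightarrow> complex"
  assumes S: "open S" and f: "\<And>x. x \<in> A \<Longrightarrow> f x holomorphic_on S"
    and bd: "\<And>z. z \<in> S \<Longrightarrow> \<exists>d>0. \<exists>M. M summable_on A \<and>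
        (\<forall>x\<in>A. \<forall>w\<in>ball z d \<inter> S. norm (f x w) \<le> M x)"
  shows "(\<lambda>z. \<Sum>\<^sub>\<infinity>x\<in>A. f x z) holomorphic_on S"
    and "z \<in> S \<Longrightarrow> ((\<lambda>x. deriv (f x) z)
        has_sum deriv (\<lambda>z. \<Sum>\<^sub>\<infinity>x\<in>A. f x z) z) A"
proof -
  define F where "F = (\<lambda>z. \<Sum>\<^sub>\<infinity>x\<in>A. f x z)"
  have *: "\<exists>D. (F has_field_derivative D) (at z) \<and>
      ((\<lambda>x. deriv (f x) z) has_sum D) A" if z: "z \<in> S" for z
  proof -
    obtain d M where d: "d > 0" and M: "M summable_on A" "\<And>x w. x \<in> A \<Longrightarrow>
        w \<in> ball z d \<inter> S \<Longrightarrow> norm (f x w) \<le> M x"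
      using bd[OF z] by blast
    obtain e where e: "e > 0" "ball z e \<subseteq> S"
      using S z openE by blast
    define r where "r = min d e / 2"
    have r: "r > 0" "cball z r \<subseteq> ball z d \<inter> S"
      using d e by (auto simp: r_def)
    have rS: "w \<in> S" if "w \<in> cball z r" for w using r that by blast
    have unif: "uniform_limit (cball z r) (\<lambda>X y. \<Sum>x\<in>X. f x y) F (finite_subsets_at_top
        A)"
      unfolding F_def by (rule Weierstrass_m_test_general[OF _ M(1)]) (use M(2) r in blast)
    have ev: "eventually (\<lambda>X. continuous_on (cball z r) (\<lambda>y. \<Sum>x\<in>X. f x y)
        \<and>
               (\<forall>w \<in> ball z r. ((\<lambda>y. \<Sum>x\<in>X. f x y)
                   has_field_derivative (\<Sum>x\<in>X. deriv (f x) w)) (at w))) (finite_subsets_at_top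
                   A)"
    proof (rule eventually_finite_subsets_at_top_weakI, intro conjI ballI)
      fix X assume X: "finite X" "X \<subseteq> A"
      show "continuous_on (cball z r) (\<lambda>y. \<Sum>x\<in>X. f x y)"
        using X f rS by (intro continuous_on_sum holomorphic_on_imp_continuous_on)
           (meson holomorphic_on_subset subsetD subsetI)
      fix w assume w: "w \<in> ball z r"
      then have "w \<in> S" using rS by force
      then show "((\<lambda>y. \<Sum>x\<in>X. f x y) has_field_derivative (\<Sum>x\<in>X. deriv (f x)
          w)) (at w)"
        using X f S by (intro DERIV_sum) (meson holomorphic_derivI subsetD)
    qed
    obtain g' where g': "\<And>w. w \<in> ball z r \<Longrightarrow>
        (F has_field_derivative (g' w)) (at w) \<and>
         ((\<lambda>X. \<Sum>x\<in>X. deriv (f x) w) \<longlongrightarrow> g' w) (finite_subsets_at_top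
             A)"
      by (rule has_complex_derivative_uniform_limit[OF ev unif]) (use r in auto)
    from g'[of z] r show ?thesis by (auto simp: has_sum_def)
  qed
  show "F holomorphic_on S"
    using * S by (auto simp: holomorphic_on_open)
  show "((\<lambda>x. deriv (f x) z) has_sum deriv F z) A" if "z \<in> S"
    using *[OF that] DERIV_imp_deriv by blast
qed

lemma norm_of_nat_powr: "norm (of_nat n powr (s :: complex)) = real n powr Re s"
  by (simp add: norm_powr_real_powr)

text \<open>
A bound for the abscissa of absolute convergence, phrased with real exponents so that bounds for the
coefficients can be compared directly.
\<close>
definition abs_conv_beyond :: "(nat \<Rightarrow> complex) \<Rightarrow> real \<Rightarrow> bool" where
  "abs_conv_beyond a c \<longleftrightarrow> (\<forall>\<sigma>>c. (\<lambda>n. norm (a n)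
      * real n powr (-\<sigma>)) summable_on UNIV)"

text \<open>
The term \<open>n = 0\<close> vanishes because \<open>0 powr z = 0\<close>, so summing over all natural numbers is the usual
Dirichlet series.
\<close>
definition dseries :: "(nat \<Rightarrow> complex) \<Rightarrow> complex \<Rightarrow> complex" where
  "dseries a s = (\<Sum>\<^sub>\<infinity>n. a n * of_nat n powr (- s))"

lemma powr_neg_mono:
  assumes "\<sigma> \<le> \<tau>" shows "real n powr (-\<tau>) \<le> real n powr (-\<sigma>)"
  using assms by (cases "n = 0") (auto intro!: powr_mono)

lemma abs_conv_beyond_mono:
  assumes "abs_conv_beyond a c" "c \<le> d" "\<And>n. norm (b n) \<le> norm (a n)"
  shows "abs_conv_beyond b d"
  unfolding abs_conv_beyond_def
proof (intro allI impI)
  fix \<sigma> assume "\<sigma> > d"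
  then have "(\<lambda>n. norm (a n) * real n powr (-\<sigma>)) summable_on UNIV"
    using assms by (auto simp: abs_conv_beyond_def)
  then show "(\<lambda>n. norm (b n) * real n powr (-\<sigma>)) summable_on UNIV"
    by (rule summable_on_comparison_test) (auto intro!: mult_right_mono assms)
qed

lemma abs_conv_beyondD:
  assumes "abs_conv_beyond a c" "c < Re s"
  shows "(\<lambda>n. norm (a n * of_nat n powr (-s))) summable_on UNIV"
        "(\<lambda>n. a n * of_nat n powr (-s)) summable_on UNIV"
proof -
  show "(\<lambda>n. norm (a n * of_nat n powr (-s))) summable_on UNIV"
    using assms unfolding abs_conv_beyond_def norm_mult norm_of_nat_powr by auto
  then show "(\<lambda>n. a n * of_nat n powr (-s)) summable_on UNIV"
    by (rule abs_summable_summable)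
qed

lemma dseries_has_sum:
  assumes "abs_conv_beyond a c" "c < Re s"
  shows "((\<lambda>n. a n * of_nat n powr (- s)) has_sum dseries a s) UNIV"
  unfolding dseries_def by (rule has_sum_infsum, rule abs_conv_beyondD(2)[OF assms])

text \<open>
The common form of all series below. The kernel \<open>u n s\<close> is either the power \<open>n^(-s)\<close> or a Taylor
remainder; locally uniformly in \<open>s\<close> it is no larger than that power, and then the half-plane of
convergence is that of the coefficients.
\<close>
lemma kernel_series_holomorphic:
  assumes a: "abs_conv_beyond a c" and u: "\<And>n. u n holomorphic_on {s. c < Re s}"
    and bd: "\<And>R. \<exists>C. \<forall>n s. c < Re s \<longrightarrow> norm s
        \<le> R \<longrightarrow> norm (u n s) \<le> C * real n powr (- Re s)"
  shows "(\<lambda>s. \<Sum>\<^sub>\<infinity>n. a n * u n s) holomorphic_on {s. c < Re s}"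
    and "c < Re s \<Longrightarrow> (\<lambda>n. norm (a n * u n s)) summable_on UNIV"
    and "c < Re s \<Longrightarrow> ((\<lambda>n. deriv (\<lambda>s. a n * u n s) s)
        has_sum deriv (\<lambda>s. \<Sum>\<^sub>\<infinity>n. a n * u n s) s) UNIV"
proof -
  have op: "open {s. c < Re s}" by (simp add: open_halfspace_Re_gt)
  have bound: "\<exists>d>0. \<exists>M. M summable_on UNIV \<and>
      (\<forall>n\<in>UNIV. \<forall>w\<in>ball z d \<inter> {s. c < Re s}. norm (a n * u n w)
      \<le> M n)"
    if z: "z \<in> {s. c < Re s}" for z
  proof -
    define d where "d = (Re z - c) / 2"
    define \<sigma> where "\<sigma> = (Re z + c) / 2"
    have d: "d > 0" "\<sigma> > c" using z by (auto simp: d_def \<sigma>_def field_simps)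
    obtain C where C: "\<And>n s. c < Re s \<Longrightarrow> norm s \<le> norm z + d \<Longrightarrow>
        norm (u n s) \<le> C * real n powr (- Re s)"
      using bd by blast
    have "norm (a n * u n w) \<le> \<bar>C\<bar> * (norm (a n)
        * real n powr (-\<sigma>))" if w: "w \<in> ball z d" "c < Re w" for n w
    proof -
      have "norm w \<le> norm z + d"
        using w norm_triangle_ineq2[of w z] by (simp add: dist_norm norm_minus_commute)
      then have "norm (u n w) \<le> C * real n powr (- Re w)"
        using C w by auto
      also have "\<dots> \<le> \<bar>C\<bar> * real n powr (- \<sigma>)"
      proof (intro mult_mono powr_neg_mono)
        have "\<bar>Re (z - w)\<bar> < d"
          using w abs_Re_le_cmod[of "z - w"] by (simp add: dist_norm)
        then show "\<sigma> \<le> Re w" by (auto simp: d_def \<sigma>_def field_simps abs_if split: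
            if_splits)
      qed auto
      finally have "norm (a n) * norm (u n w) \<le> norm (a n) * (\<bar>C\<bar>
          * real n powr (- \<sigma>))"
        by (intro mult_left_mono) auto
      then show ?thesis
        by (simp add: norm_mult mult.left_commute)
    qed
    moreover have "(\<lambda>n. \<bar>C\<bar> * (norm (a n)
        * real n powr (-\<sigma>))) summable_on UNIV"
      using a d by (intro summable_on_cmult_right) (auto simp: abs_conv_beyond_def)
    ultimately show ?thesis
      using d by (intro exI[of _ d] conjI exI[of _ "\<lambda>n. \<bar>C\<bar> * (norm (a n)
          * real n powr (-\<sigma>))"]) auto
  qed
  have hol: "(\<lambda>s. a n * u n s) holomorphic_on {s. c < Re s}" for n
    by (intro holomorphic_intros u)
  show "(\<lambda>s. \<Sum>\<^sub>\<infinity>n. a n * u n s) holomorphic_on {s. c < Re s}"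
    using holomorphic_infsum(1)[OF op hol bound] .
  show "((\<lambda>n. deriv (\<lambda>s. a n * u n s) s) has_sum deriv (\<lambda>s.
      \<Sum>\<^sub>\<infinity>n. a n * u n s) s) UNIV" if "c < Re s"
    using holomorphic_infsum(2)[OF op hol bound] that by simp
  show "(\<lambda>n. norm (a n * u n s)) summable_on UNIV" if "c < Re s"
  proof -
    obtain d M where M: "d > 0" "M summable_on UNIV" "\<forall>n\<in>UNIV. \<forall>w\<in>ball s d
        \<inter> {s. c < Re s}. norm (a n * u n w) \<le> M n"
      using bound[of s] \<open>c < Re s\<close> by auto
    from M(2) show ?thesis
      by (rule Infinite_Sum.abs_summable_on_comparison_test') (use M \<open>c < Re s\<close> in auto)
  qed
qed

text \<open>
Termwise differentiation multiplies the coefficients by \<open>-ln n\<close>.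
\<close>
lemma dseries_holomorphic_and_deriv:
  assumes a: "abs_conv_beyond a c"
  shows dseries_holomorphic: "dseries a holomorphic_on {s. c < Re s}"
    and dseries_deriv: "c < Re s \<Longrightarrow> (dseries a
        has_field_derivative - dseries (\<lambda>n. of_real (ln (real n)) * a n) s) (at s)"
proof -
  have hol: "(\<lambda>s. of_nat n powr (- s)) holomorphic_on {s :: complex. c < Re s}" for n
    by (cases "n = 0") (auto intro!: holomorphic_intros)
  note * = kernel_series_holomorphic[OF a hol] 
  have bd: "\<exists>C. \<forall>n (s::complex). c < Re s \<longrightarrow> norm s
      \<le> R \<longrightarrow> norm (of_nat n powr (- s)) \<le> C * real n powr (- Re s)" for R
    by (intro exI[of _ 1]) (auto simp: norm_of_nat_powr)
  show h: "dseries a holomorphic_on {s. c < Re s}"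
    using *(1)[OF bd] unfolding dseries_def by (simp add: fun_eq_iff)
  show "(dseries a has_field_derivative - dseries (\<lambda>n. of_real (ln (real n)) * a n) s) (at s)"
      if "c < Re s"
  proof -
    have "deriv (\<lambda>s. a n * of_nat n powr (- s)) s =
        - (of_real (ln (real n)) * a n * of_nat n powr (-s))" for n
    proof (cases "n = 0")
      case False
      then have "((\<lambda>s. a n * of_nat n powr (- s)) has_field_derivative
          - (of_real (ln (real n)) * a n * of_nat n powr (-s))) (at s)"
        unfolding powr_def by (auto intro!: derivative_eq_intros simp: Ln_of_nat)
      then show ?thesis by (rule DERIV_imp_deriv)
    qed auto
    then have "((\<lambda>n. - (of_real (ln (real n)) * a n * of_nat n powr (-s)))
        has_sum deriv (dseries a) s) UNIV"
      using *(3)[OF bd that] unfolding dseries_def[abs_def] by simp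
    then have "deriv (dseries a) s = - dseries (\<lambda>n. of_real (ln (real n)) * a n) s"
      unfolding dseries_def by (simp add: has_sum_uminus infsumI flip: has_sum_infsum)
    then show ?thesis
      using h holomorphic_derivI[OF h open_halfspace_Re_gt] that by fastforce
  qed
qed

text \<open>
The logarithm grows more slowly than any power, so half of the gap between \<open>\<sigma>\<close> and \<open>c\<close> absorbs it.
\<close>
lemma abs_conv_beyond_ln:
  assumes "abs_conv_beyond a c"
  shows "abs_conv_beyond (\<lambda>n. of_real (ln (real n)) * a n) c"
  unfolding abs_conv_beyond_def
proof (intro allI impI)
  fix \<sigma> assume \<sigma>: "\<sigma> > c"
  define e where "e = (\<sigma> - c) / 2"
  have e: "e > 0" "\<sigma> - e > c" using \<sigma> by (auto simp: e_def field_simps)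
  have "(\<lambda>n. (1/e) * (norm (a n) * real n powr (-(\<sigma>-e)))) summable_on UNIV"
    using assms e unfolding abs_conv_beyond_def by (intro summable_on_cmult_right) auto
  then show "(\<lambda>n. norm (of_real (ln (real n)) * a n)
      * real n powr (-\<sigma>)) summable_on UNIV"
  proof (rule summable_on_comparison_test)
    fix n :: nat
    show "norm (of_real (ln (real n)) * a n) * real n powr (-\<sigma>)
        \<le> (1/e) * (norm (a n) * real n powr (-(\<sigma>-e)))"
    proof (cases "n = 0")
      case False
      then have "ln (real n) \<le> real n powr e / e"
        using e by (intro ln_powr_bound) auto
      then have "ln (real n) * (norm (a n) * real n powr (-\<sigma>))
          \<le> real n powr e / e * (norm (a n) * real n powr (-\<sigma>))"
        by (intro mult_right_mono) auto
      also have "\<dots> = (1/e) * (norm (a n) * (real n powr e * real n powr (-\<sigma>)))" by simp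
      also have "real n powr e * real n powr (-\<sigma>) = real n powr (-(\<sigma>-e))"
        by (simp add: powr_add [symmetric])
      finally show ?thesis using False by (simp add: norm_mult mult.assoc)
    qed auto
  qed auto
qed

lemma summable_on_powr: "\<sigma> > 1 \<Longrightarrow> (\<lambda>n. real n powr (-\<sigma>))
    summable_on UNIV"
  using summable_real_powr_iff[of "-\<sigma>"] by (subst summable_on_UNIV_nonneg_real_iff) auto

lemma abs_conv_beyond_poly:
  assumes "\<And>n. n > 0 \<Longrightarrow> norm (a n) \<le> C * real n powr k"
  shows "abs_conv_beyond a (k + 1)"
  unfolding abs_conv_beyond_def
proof (intro allI impI)
  fix \<sigma> assume \<sigma>: "\<sigma> > k + 1"
  have "(\<lambda>n. C * real n powr (-(\<sigma>-k))) summable_on UNIV"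
    using \<sigma> by (intro summable_on_cmult_right summable_on_powr) auto
  then show "(\<lambda>n. norm (a n) * real n powr (-\<sigma>)) summable_on UNIV"
  proof (rule summable_on_comparison_test)
    fix n :: nat
    show "norm (a n) * real n powr (-\<sigma>) \<le> C * real n powr (-(\<sigma>-k))"
    proof (cases "n = 0")
      case False
      then have "norm (a n) * real n powr (-\<sigma>) \<le> C * real n powr k * real n powr (-\<sigma>)"
        using assms by (intro mult_right_mono) auto
      then show ?thesis using False by (simp add: powr_add [symmetric] mult.assoc)
    qed auto
  qed auto
qed

lemma abs_conv_beyond_1: "abs_conv_beyond (\<lambda>_. 1) 1"
  using abs_conv_beyond_poly[of "\<lambda>_. 1" 1 0] by simp

text \<open>
Dirichlet convolution: the pairs \<open>(d,e)\<close> of the product series are grouped by \<open>n = d * e\<close>.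
\<close>
lemma dseries_mult:
  assumes a: "(\<lambda>n. norm (a n * of_nat n powr (-s))) summable_on UNIV"
    and b: "(\<lambda>n. norm (b n * of_nat n powr (-s))) summable_on UNIV"
  shows "dseries a s * dseries b s = dseries (\<lambda>n. \<Sum>d | d dvd n. a d * b (n div d)) s"
proof -
  define f where "f = (\<lambda>n. a n * of_nat n powr (-s))"
  define g where "g = (\<lambda>n. b n * of_nat n powr (-s))"
  define P where "P = {1::nat..}"
  have "(\<lambda>x. norm ((\<lambda>(d,e). f d * g e) x)) summable_on UNIV \<times> UNIV"
  proof (intro Infinite_Sum.abs_summable_on_Sigma_iff[THEN iffD2] conjI ballI)
    have f: "(\<lambda>n. norm (f n)) summable_on UNIV" and g:
        "(\<lambda>n. norm (g n)) summable_on UNIV"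
      using a b by (simp_all only: f_def g_def)
    show "(\<lambda>y. norm (case (x, y) of (d, e) \<Rightarrow> f d * g e)) summable_on UNIV" for x
      using summable_on_cmult_right[OF g, of "norm (f x)"] by (simp add: norm_mult)
    show "(\<lambda>x. norm (\<Sum>\<^sub>\<infinity>y. norm (case (x, y) of (d, e) \<Rightarrow> f d
        * g e))) summable_on UNIV"
      using summable_on_cmult_left[OF f, of "\<Sum>\<^sub>\<infinity>y. norm (g y)"]
      by (simp add: norm_mult infsum_cmult_right' abs_mult infsum_nonneg)
  qed
  then have sm: "(\<lambda>(d,e). f d * g e) summable_on UNIV \<times> UNIV"
    by (rule abs_summable_summable)
  have "((\<lambda>(d,e). f d * g e) has_sum (dseries a s * dseries b s)) (UNIV \<times> UNIV)"
  proof (rule has_sum_SigmaI[OF _ _ sm])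
    fix d show "((\<lambda>e. (case (d, e) of (d, e) \<Rightarrow> f d * g e))
        has_sum f d * dseries b s) UNIV"
      unfolding dseries_def g_def using abs_summable_summable[OF b]
      by (simp add: has_sum_cmult_right)
    show "((\<lambda>d. f d * dseries b s) has_sum dseries a s * dseries b s) UNIV"
      unfolding dseries_def[of a] f_def using abs_summable_summable[OF a]
      by (intro has_sum_cmult_left) simp
  qed
  also have "?this \<longleftrightarrow> ((\<lambda>(d,e). f d * g e)
      has_sum (dseries a s * dseries b s)) (P \<times> P)"
  proof (rule has_sum_cong_neutral)
    fix x :: "nat \<times> nat" assume "x \<in> UNIV \<times> UNIV - P \<times> P"
    then have "fst x = 0 \<or> snd x = 0" by (cases x) (auto simp: P_def)
    then show "(case x of (d, e) \<Rightarrow> f d * g e) = 0"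
        by (auto simp: f_def g_def split: prod.splits)
  qed auto
  also have "\<dots> \<longleftrightarrow> ((\<lambda>(n,d). f d * g (n div d))
      has_sum (dseries a s * dseries b s)) (SIGMA n:P. {d. d dvd n})"
    by (rule has_sum_reindex_bij_witness[where j = "\<lambda>(d,e). (d*e, d)" and i
        = "\<lambda>(n,d). (d, n div d)"])
       (auto simp: P_def div_greater_zero_iff Suc_le_eq dest: dvd_imp_le intro: Nat.gr0I)
  finally have "((\<lambda>n. \<Sum>d | d dvd n. f d * g (n div d))
      has_sum (dseries a s * dseries b s)) P"
  proof (rule has_sum_SigmaD)
    fix n assume n: "n \<in> P"
    have "((\<lambda>d. f d * g (n div d)) has_sum (\<Sum>d | d dvd n. f d * g (n div d))) {d. d dvd n}"
      using n by (intro has_sum_finite) (auto simp: P_def)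
    then show "((\<lambda>d. case (n, d) of (n, d) \<Rightarrow> f d * g (n div d))
        has_sum (\<Sum>d | d dvd n. f d * g (n div d))) {d. d dvd n}"
      by simp
  qed
  also have "?this \<longleftrightarrow> ((\<lambda>n. (\<Sum>d | d dvd n. a d * b (n div d))
      * of_nat n powr (-s)) has_sum (dseries a s * dseries b s)) UNIV"
  proof (rule has_sum_cong_neutral)
    fix n assume "n \<in> P \<inter> UNIV"
    then have n: "n > 0" by (auto simp: P_def)
    show "(\<Sum>d | d dvd n. f d * g (n div d)) = (\<Sum>d | d dvd n. a d * b (n div d))
        * of_nat n powr (-s)"
      unfolding sum_distrib_right
    proof (rule sum.cong)
      fix d assume "d \<in> {d. d dvd n}"
      then obtain e where e: "n = d * e" by auto
      then have "of_nat n powr (-s) = of_nat d powr (-s) * of_nat e powr (-s)"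
        using powr_times_real[of "of_nat d" "of_nat e" "-s"] by simp
      then show "f d * g (n div d) = a d * b (n div d) * of_nat n powr (-s)"
        using e n by (simp add: f_def g_def)
    qed auto
  qed (auto simp: P_def)
  finally show ?thesis unfolding dseries_def[of "\<lambda>n. \<Sum>d | d dvd n. a d * b (n div d)"]
    by (simp add: infsumI)
qed

section \<open>Continuation of the zeta function to the punctured plane\<close>

text \<open>
The Taylor polynomial of degree \<open>K\<close> of \<open>x powr (1 - s)\<close> at \<open>x = n\<close>, evaluated at \<open>n + 1\<close>, minus the
true value there. For \<open>K = 0\<close> this is the telescoping difference itself.
\<close>
definition powr_taylor_rest :: "nat \<Rightarrow> nat \<Rightarrow> complex \<Rightarrow> complex" where
  "powr_taylor_rest K n s =
     of_nat n powr (1 - s) - of_nat (Suc n) powr (1 - s)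
       + (\<Sum>j=1..K. ((1 - s) gchoose j) * of_nat n powr (1 - s - of_nat j))"

lemma gchoose_holomorphic [holomorphic_intros]:
  assumes "f holomorphic_on S"
  shows "(\<lambda>s. (f s :: complex) gchoose j) holomorphic_on S"
  using assms unfolding gbinomial_prod_rev by (intro holomorphic_intros) auto

lemma powr_taylor_rest_holomorphic:
  "n > 0 \<Longrightarrow> powr_taylor_rest K n holomorphic_on S"
  unfolding powr_taylor_rest_def[abs_def] by (intro holomorphic_intros) auto

text \<open>
Taylor's theorem on the segment from \<open>n\<close> to \<open>n + 1\<close>: derivative number \<open>K + 1\<close> of \<open>x powr (1 - s)\<close>
is a polynomial in \<open>s\<close> times \<open>x powr (- s - K)\<close>, and this power is largest at the left end of the
segment.
\<close>
lemma powr_taylor_rest_bound: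
  "\<exists>C. \<forall>n s. n > 0 \<longrightarrow> - real K < Re s \<longrightarrow> norm s
      \<le> R \<longrightarrow>
      norm (powr_taylor_rest K n s) \<le> C * real n powr (- Re s - real K)"
proof -
  have "continuous_on (cball 0 R) (\<lambda>s::complex. (1 - s) gchoose Suc K)"
    by (intro holomorphic_on_imp_continuous_on holomorphic_intros)
  then have "bounded ((\<lambda>s::complex. (1 - s) gchoose Suc K) ` cball 0 R)"
    using compact_cball compact_continuous_image compact_imp_bounded by blast
  then obtain B where "\<forall>s\<in>cball 0 R. norm ((1 - s :: complex) gchoose Suc K) \<le> B"
    by (auto simp: bounded_iff)
  then have B: "norm ((1 - s) gchoose Suc K) \<le> B" if "norm s \<le> R" for s :: complex
    using that by simp
  have "norm (powr_taylor_rest K n s) \<le> (fact (Suc K) * B / fact K) * real n powr (- Re s - real K)"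
    if n: "n > 0" and s: "- real K < Re s" "norm s \<le> R" for n s
  proof -
    define f where "f = (\<lambda>i x. fact i * ((1 - s) gchoose i)
        * x powr (1 - s - of_nat i) :: complex)"
    define S where "S = closed_segment (of_nat n) (of_nat (Suc n) :: complex)"
    have S: "\<exists>y. x = of_real y \<and> real n \<le> y" if x: "x \<in> S" for x :: complex
    proof -
      have "S = of_real ` {real n..real (Suc n)}"
        using closed_segment_of_real[of "real n" "real (Suc n)"]
        by (simp add: S_def closed_segment_eq_real_ivl)
      with x show ?thesis by auto
    qed
    have der: "(f i has_field_derivative f (Suc i) x) (at x within S)" if x: "x \<in> S" for i x
    proof -
      obtain y where y: "x = of_real y" "real n \<le> y" using S[OF x] by blast
      then have "x \<notin> \<real>\<^sub>\<le>\<^sub>0" using n by auto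
      then have "((\<lambda>x. fact i * ((1 - s) gchoose i)
          * x powr (1 - s - of_nat i)) has_field_derivative
          fact i * ((1 - s) gchoose i) * ((1 - s - of_nat i)
              * x powr (1 - s - of_nat i - 1))) (at x within S)"
        by (intro DERIV_cmult has_field_derivative_at_within[OF has_field_derivative_powr])
      also have "fact i * ((1 - s) gchoose i) * ((1 - s - of_nat i) * x powr (1 - s - of_nat i - 1))
          = f (Suc i) x"
      proof -
        have "fact i * ((1 - s) gchoose i) * ((1 - s - of_nat i) * X)
            = fact (Suc i) * ((1 - s) gchoose Suc i) * X" for X
        proof -
          have "fact i * ((1 - s) gchoose i) * ((1 - s - of_nat i) * X)
              = fact i * ((1 - s - of_nat i) * ((1 - s) gchoose i)) * X"
            by (simp only: mult_ac)
          also have "(1 - s - of_nat i) * ((1 - s) gchoose i)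
              = of_nat (Suc i) * ((1 - s) gchoose Suc i)"
            using gbinomial_mult_1[of "1 - s" i] by (simp add: algebra_simps)
          also have "fact i * (of_nat (Suc i) * ((1 - s) gchoose Suc i))
              = fact (Suc i) * ((1 - s) gchoose Suc i)"
            by (simp only: mult_ac fact_Suc)
          finally show ?thesis .
        qed
        moreover have "1 - s - of_nat i - 1 = 1 - s - of_nat (Suc i)" by simp
        ultimately show ?thesis unfolding f_def by (simp only:)
      qed
      finally show ?thesis unfolding f_def .
    qed
    have bnd: "norm (f (Suc K) x) \<le> fact (Suc K) * B * real n powr (- Re s - real K)" if x:
        "x \<in> S" for x
    proof -
      obtain y where y: "x = of_real y" "real n \<le> y" using S[OF x] by blast
      have "norm (x powr (1 - s - of_nat (Suc K))) = y powr (- Re s - real K)"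
        using y n by (subst norm_powr_real_powr) auto
      also have "\<dots> \<le> real n powr (- Re s - real K)"
        using y n s by (intro powr_mono2') auto
      finally show ?thesis unfolding f_def norm_mult using B[OF s(2)] order_trans[OF norm_ge_zero B[OF
          s(2)]]
        by (intro mult_mono) (auto simp del: fact_Suc)
    qed
    have "norm (f 0 (of_nat (Suc n)) - (\<Sum>i\<le>K. f i (of_nat n)
        * (of_nat (Suc n) - of_nat n) ^ i / fact i))
        \<le> (fact (Suc K) * B * real n powr (- Re s - real K))
            * norm (of_nat (Suc n) - of_nat n :: complex) ^ Suc K / fact K"
      by (rule complex_Taylor[of S]) (use der bnd in \<open>auto simp: S_def\<close>)
    also have "f 0 (of_nat (Suc n)) - (\<Sum>i\<le>K. f i (of_nat n)
        * (of_nat (Suc n) - of_nat n) ^ i / fact i)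
       = - powr_taylor_rest K n s"
    proof -
      have "(\<Sum>i\<le>K. f i (of_nat n) * (of_nat (Suc n) - of_nat n) ^ i / fact i)
          = (\<Sum>i\<le>K. ((1 - s) gchoose i) * of_nat n powr (1 - s - of_nat i))"
        by (simp add: f_def)
      also have "\<dots> = of_nat n powr (1 - s) + (\<Sum>j=1..K. ((1 - s) gchoose j)
          * of_nat n powr (1 - s - of_nat j))"
        by (simp add: atMost_atLeast0 sum.atLeast_Suc_atMost)
      finally show ?thesis by (simp add: powr_taylor_rest_def f_def)
    qed
    finally show ?thesis by simp
  qed
  then show ?thesis by blast
qed

text \<open>
The bound gains \<open>K\<close> powers of \<open>n\<close>, so the series behaves like the zeta series at \<open>s + K\<close>.
\<close>
lemma powr_taylor_rest_series:
  shows powr_taylor_rest_series_holomorphic: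
    "(\<lambda>s. \<Sum>\<^sub>\<infinity>n\<in>{1..}. powr_taylor_rest K n s) holomorphic_on {s. 1 -
        real K < Re s}"
    and powr_taylor_rest_summable:
    "1 - real K < Re s \<Longrightarrow> (\<lambda>n. powr_taylor_rest K n s) summable_on {1..}"
proof -
  \<comment> \<open>After the shift by \<open>K\<close> the remainder satisfies the kernel bound against the
     coefficients 1.\<close>
  define u where "u = (\<lambda>n s. if n = 0 then 0 else powr_taylor_rest K n (s - of_nat K))"
  have hol: "u n holomorphic_on {s. 1 < Re s}" for n
  proof (cases "n = 0")
    case False
    have "(powr_taylor_rest K n \<circ> (\<lambda>s. s - of_nat K)) holomorphic_on {s. 1 < Re s}"
      using False by (intro holomorphic_on_compose powr_taylor_rest_holomorphic holomorphic_intros) auto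
    with False show ?thesis by (simp add: u_def o_def)
  qed (simp add: u_def)
  have bd: "\<exists>C. \<forall>n s. 1 < Re s \<longrightarrow> norm s
      \<le> R \<longrightarrow> norm (u n s) \<le> C * real n powr (- Re s)" for R
  proof -
    obtain C where C: "\<And>n s. n > 0 \<Longrightarrow> - real K < Re s \<Longrightarrow>
        norm s \<le> R + real K \<Longrightarrow>
      norm (powr_taylor_rest K n s) \<le> C * real n powr (- Re s - real K)"
      using powr_taylor_rest_bound by blast
    have "norm (u n s) \<le> C * real n powr (- Re s)" if "1 < Re s" "norm s \<le> R" for n s
      using C[of n "s - of_nat K"] that norm_triangle_ineq4[of s "of_nat K"] by (auto simp: u_def)
    then show ?thesis by blast
  qed
  note * = kernel_series_holomorphic[OF abs_conv_beyond_1 hol bd]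
  have eq: "(\<Sum>\<^sub>\<infinity>n. 1 * u n (s + of_nat K))
      = (\<Sum>\<^sub>\<infinity>n\<in>{1..}. powr_taylor_rest K n s)" for s
    by (rule infsum_cong_neutral) (auto simp: u_def)
  have "((\<lambda>s. \<Sum>\<^sub>\<infinity>n. 1 * u n s) \<circ> (\<lambda>s. s
      + of_nat K)) holomorphic_on {s. 1 - real K < Re s}"
    by (intro holomorphic_on_compose holomorphic_intros holomorphic_on_subset[OF *(1)]) auto
  then show "(\<lambda>s. \<Sum>\<^sub>\<infinity>n\<in>{1..}. powr_taylor_rest K n s) holomorphic_on
      {s. 1 - real K < Re s}"
    unfolding o_def eq .
  assume "1 - real K < Re s"
  then have "1 < Re (s + of_nat K)" by simp
  from *(2)[OF this] have "(\<lambda>n. norm (u n (s + of_nat K))) summable_on UNIV"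
    by (simp only: mult_1_left)
  then have "(\<lambda>n. u n (s + of_nat K)) summable_on UNIV"
    by (rule abs_summable_summable)
  also have "?this \<longleftrightarrow> (\<lambda>n. powr_taylor_rest K n s) summable_on {1..}"
    by (rule summable_on_cong_neutral) (auto simp: u_def)
  finally show "(\<lambda>n. powr_taylor_rest K n s) summable_on {1..}" .
qed

lemma dseries_1_has_sum:
  assumes "Re s > 1"
  shows "((\<lambda>n. of_nat n powr (-s)) has_sum dseries (\<lambda>_. 1) s) {1..}"
proof -
  have "((\<lambda>n. 1 * of_nat n powr (-s)) has_sum dseries (\<lambda>_. 1) s) UNIV"
    by (rule dseries_has_sum[OF abs_conv_beyond_1 assms])
  also have "?this \<longleftrightarrow> ?thesis"
    by (rule has_sum_cong_neutral) auto
  finally show ?thesis .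
qed

lemma tendsto_neg_powr_complex_of_nat:
  assumes "Re s < 0" shows "(\<lambda>n. of_nat n powr s :: complex) \<longlonglongrightarrow> 0"
proof (rule tendsto_norm_zero_cancel)
  have "(\<lambda>n. real n powr Re s) \<longlonglongrightarrow> 0"
    using assms by real_asymp
  then show "(\<lambda>n. norm (of_nat n powr s :: complex)) \<longlonglongrightarrow> 0"
    by (simp add: norm_of_nat_powr)
qed

text \<open>
The differences of the powers telescope to the value 1 at \<open>n = 1\<close>; each Taylor term sums to a
shifted zeta series.
\<close>
lemma powr_taylor_rest_sum:
  assumes s: "Re s > 1"
  shows "((\<lambda>n. powr_taylor_rest K n s) has_sum
           1 + (\<Sum>j=1..K. ((1 - s) gchoose j) * dseries (\<lambda>_. 1) (s + of_nat j - 1))) {1..}"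
proof -
  define D where "D = (\<lambda>n. of_nat n powr (1 - s) - of_nat (Suc n) powr (1 - s))"
  have has_sum_sum: "((\<lambda>n. \<Sum>j\<in>J. f j n) has_sum (\<Sum>j\<in>J. S j)) A"
    if "finite J" "\<And>j. j \<in> J \<Longrightarrow> (f j
        has_sum S j) A" for J :: "nat set" and f :: "nat \<Rightarrow> nat \<Rightarrow> complex" and S
        A
    using that by (induction J rule: finite_induct) (auto intro!: has_sum_add)
  have Suc_range: "range Suc = {1..}"
    using greaterThan_0 atLeast_Suc_greaterThan[of 0] by simp
  have S: "((\<lambda>n. (\<Sum>j=1..K. ((1 - s) gchoose j) * of_nat n powr (1 - s - of_nat j))) has_sum
       (\<Sum>j=1..K. ((1 - s) gchoose j) * dseries (\<lambda>_. 1) (s + of_nat j - 1))) {1..}" for K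
  proof (rule has_sum_sum, simp)
    fix j assume "j \<in> {1..K}"
    then have "Re (s + of_nat j - 1) > 1" using s by auto
    from has_sum_cmult_right[OF dseries_1_has_sum[OF this], of "(1 - s) gchoose j"]
    show "((\<lambda>n. ((1 - s) gchoose j) * of_nat n powr (1 - s - of_nat j)) has_sum
          ((1 - s) gchoose j) * dseries (\<lambda>_. 1) (s + of_nat j - 1)) {1..}"
      by (simp add: algebra_simps)
  qed
  have "D summable_on {1..}"
  proof -
    have "(\<lambda>n. powr_taylor_rest 1 n s + - (\<Sum>j=1..1. ((1 - s) gchoose j)
        * of_nat n powr (1 - s - of_nat j))) summable_on {1..}"
      using s by (intro summable_on_add summable_on_uminus[THEN iffD2] powr_taylor_rest_summable
          has_sum_imp_summable[OF S]) simp_all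
    then show ?thesis by (simp add: powr_taylor_rest_def D_def)
  qed
  then have "(\<lambda>n. D (Suc n)) summable_on UNIV"
    using summable_on_reindex[of Suc UNIV D] unfolding o_def Suc_range by simp
  then have "((\<lambda>n. D (Suc n)) has_sum (\<Sum>\<^sub>\<infinity>n. D (Suc n))) UNIV" by simp
  moreover have "(\<lambda>n. D (Suc n)) sums 1"
  proof -
    have "(\<lambda>n. of_nat (Suc n) powr (1 - s) :: complex) \<longlonglongrightarrow> 0"
      using tendsto_neg_powr_complex_of_nat[of "1 - s"] s by (intro LIMSEQ_Suc) auto
    from telescope_sums'[OF this] show ?thesis by (simp add: D_def)
  qed
  ultimately have "((\<lambda>n. D (Suc n)) has_sum 1) UNIV"
    using has_sum_imp_sums sums_unique2 by metis
  then have "(D has_sum 1) {1..}"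
    using has_sum_reindex[of Suc UNIV D] unfolding o_def Suc_range by simp
  from has_sum_add[OF this S] show ?thesis
    unfolding powr_taylor_rest_def D_def .
qed

text \<open>
The previous identity, solved for the term \<open>j = 1\<close>, which is \<open>(1 - s) \<zeta>(s)\<close>. The coefficient of
\<open>\<zeta>(s + j)\<close> is \<open>(1 - s) gchoose (j + 1)\<close>; it contains the factor \<open>s + j - 1\<close>, and pairing this factor
with \<open>\<zeta>(s + j)\<close> means that the right-hand side involves only the numerator \<open>(s - 1) \<zeta>(s)\<close> at shifted
arguments. No poles arise.
\<close>
lemma zeta_recursion:
  assumes s: "Re s > 1"
  shows "(s - 1) * dseries (\<lambda>_. 1) s = 1 - (\<Sum>\<^sub>\<infinity>n\<in>{1..}.
      powr_taylor_rest (Suc K) n s)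
     - (\<Sum>j=1..K. ((1 - s) gchoose j) / of_nat (Suc j) * ((s
         + of_nat j - 1) * dseries (\<lambda>_. 1) (s + of_nat j)))"
proof -
  let ?Z = "dseries (\<lambda>_. 1)"
  have "(\<Sum>\<^sub>\<infinity>n\<in>{1..}. powr_taylor_rest (Suc K) n s) =
      1 + (\<Sum>j=1..Suc K. ((1 - s) gchoose j) * ?Z (s + of_nat j - 1))"
    by (rule infsumI[OF powr_taylor_rest_sum[OF s]])
  also have "(\<Sum>j=1..Suc K. ((1 - s) gchoose j) * ?Z (s + of_nat j - 1))
     = (\<Sum>j=0..K. ((1 - s) gchoose Suc j) * ?Z (s + of_nat j))"
    by (rule sum.reindex_bij_witness[of _ Suc "\<lambda>j. j - 1"]) (auto simp: algebra_simps
        of_nat_diff)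
  also have "\<dots> = (1 - s) * ?Z s + (\<Sum>j=1..K. ((1 - s) gchoose Suc j) * ?Z (s + of_nat j))"
    by (simp add: sum.atLeast_Suc_atMost)
  also have "(\<Sum>j=1..K. ((1 - s) gchoose Suc j) * ?Z (s + of_nat j)) = 
      - (\<Sum>j=1..K. ((1 - s) gchoose j) / of_nat (Suc j) * ((s + of_nat j - 1) * ?Z (s + of_nat j)))"
    unfolding sum_negf [symmetric]
  proof (rule sum.cong)
    fix j
    have "of_nat (Suc j) * ((1 - s) gchoose Suc j) = (1 - s - of_nat j) * ((1 - s) gchoose j)"
      using gbinomial_mult_1[of "1 - s" j] by (simp add: algebra_simps)
    then have "(1 - s) gchoose Suc j = (1 - s - of_nat j) * ((1 - s) gchoose j) / of_nat (Suc j)"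
      by (simp add: divide_simps mult.commute del: of_nat_Suc)
    also have "1 - s - of_nat j = - (s + of_nat j - 1)" by simp
    finally show "((1 - s) gchoose Suc j) * ?Z (s + of_nat j) =
       - (((1 - s) gchoose j) / of_nat (Suc j) * ((s + of_nat j - 1) * ?Z (s + of_nat j)))"
      by (simp only: mult_minus_left mult_minus_right times_divide_eq_left times_divide_eq_right
          minus_divide_left mult_ac)
  qed auto
  finally show ?thesis by (simp add: algebra_simps)
qed

lemma holomorphic_eq_on_half_plane:
  assumes "f holomorphic_on {s. c < Re s}" "g holomorphic_on {s. c < Re s}"
    and "\<And>s. d < Re s \<Longrightarrow> f s = g s" "c < Re s"
  shows "f s = g s"
proof (rule analytic_continuation_open[where s = "{s. max c d < Re s}" and s' = "{s. c < Re s}" and f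
    = f and g = g])
  have "of_real (max c d + 1) \<in> {s. max c d < Re s}" by (simp add: max_def)
  then show "{s. max c d < Re s} \<noteq> {}" by blast
  show "connected {s. c < Re s}"
    by (intro convex_connected convex_halfspace_Re_gt)
  show "open {s. max c d < Re s}" "open {s. c < Re s}"
    by (rule open_halfspace_Re_gt)+
  show "{s. max c d < Re s} \<subseteq> {s. c < Re s}" "s \<in> {s. c < Re s}"
    using assms(4) by auto
  show "f z = g z" if "z \<in> {s. max c d < Re s}" for z
    using that by (intro assms(3)) simp
qed (fact assms(1,2))+

text \<open>
Each application of the recursion moves the boundary of the half-plane one unit to the left. The
value 1 at \<open>s = 1\<close> is recorded along the way because it shows that the zeta function really has a
pole there.
\<close>
lemma zeta_numerator_on_half_plane:
  "\<exists>W. W holomorphic_on {s. 1 - real K < Re s} \<and> W 1 = 1 \<and>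
      (\<forall>s. 1 < Re s \<longrightarrow> W s = (s - 1) * dseries (\<lambda>_. 1) s)"
proof (induction K)
  case 0
  have "(\<lambda>s. if s = 1 then 1 else (s - 1) * dseries (\<lambda>_. 1) s) holomorphic_on {s. 1 < Re
      s}
     \<longleftrightarrow> (\<lambda>s. (s - 1) * dseries (\<lambda>_. 1) s) holomorphic_on {s. 1 < Re
         s}"
    by (rule holomorphic_cong) auto
  moreover have "(\<lambda>s. (s - 1) * dseries (\<lambda>_. 1) s) holomorphic_on {s. 1 < Re s}"
    by (intro holomorphic_intros dseries_holomorphic abs_conv_beyond_1)
  ultimately show ?case
    by (intro exI[of _ "\<lambda>s. if s = 1 then 1 else (s - 1) * dseries (\<lambda>_. 1) s"]) auto
next
  case (Suc K)
  then obtain W where W: "W holomorphic_on {s. 1 - real K < Re s}" "W 1 = 1"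
    "\<And>s. 1 < Re s \<Longrightarrow> W s = (s - 1) * dseries (\<lambda>_. 1) s" by blast
  define V where "V = (\<lambda>s. 1 - (\<Sum>\<^sub>\<infinity>n\<in>{1..}. powr_taylor_rest (Suc K) n
      s)
     - (\<Sum>j=1..K. ((1 - s) gchoose j) / of_nat (Suc j) * W (s + of_nat j)))"
  have "(\<lambda>s. W (s + of_nat j)) holomorphic_on {s. 1 - real (Suc K) < Re s}"
      if "j \<in> {1..K}" for j
  proof -
    have "(W \<circ> (\<lambda>s. s + of_nat j)) holomorphic_on {s. 1 - real (Suc K) < Re s}"
      using that by (intro holomorphic_on_compose holomorphic_intros holomorphic_on_subset[OF W(1)])
          auto
    then show ?thesis by (simp add: o_def)
  qed
  then have "V holomorphic_on {s. 1 - real (Suc K) < Re s}"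
    unfolding V_def by (intro holomorphic_intros powr_taylor_rest_series_holomorphic) auto
  moreover have "V 1 = 1"
  proof -
    have [simp]: "(0 :: complex) gchoose j = 0" if "j \<ge> 1" for j
      using that by (cases j) auto
    \<comment> \<open>At \<open>s = 1\<close> the function \<open>x powr (1 - s)\<close> is constant, so all remainders vanish.\<close>
    have "powr_taylor_rest (Suc K) n 1 = 0" if "n \<in> {1..}" for n
      using that of_nat_neq_0[of n, where ?'a = complex] by (auto simp: powr_taylor_rest_def)
    then have "(\<Sum>\<^sub>\<infinity>n\<in>{1..}. powr_taylor_rest (Suc K) n 1) = 0"
      by (intro infsum_0)
    then show ?thesis by (simp add: V_def)
  qed
  moreover have "V s = (s - 1) * dseries (\<lambda>_. 1) s" if "1 < Re s" for s
  proof -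
    have "W (s + of_nat j) = (s + of_nat j - 1) * dseries (\<lambda>_. 1) (s + of_nat j)" for j
      using that by (intro W(3)) auto
    then show ?thesis
      unfolding zeta_recursion[OF that, of K] V_def by (simp only:)
  qed
  ultimately show ?case by blast
qed

text \<open>
The continuations to the various half-planes agree by the identity theorem, so they glue to an
entire function.
\<close>
lemma ex_zeta_numerator:
  "\<exists>W. W holomorphic_on UNIV \<and> W 1 = 1 \<and>
      (\<forall>s. 1 < Re s \<longrightarrow> W s = (s - 1) * dseries (\<lambda>_. 1) s)"
proof -
  obtain V where V: "\<And>K. V K holomorphic_on {s. 1 - real K < Re s}" "\<And>K. V K 1 = 1"
     "\<And>K s. 1 < Re s \<Longrightarrow> V K s = (s - 1) * dseries (\<lambda>_. 1) s"
    using zeta_numerator_on_half_plane by metis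
  define k where "k = (\<lambda>s. nat \<lceil>1 - Re s\<rceil> + 1)"
  have k: "1 - real (k s) < Re s" for s
    unfolding k_def by (simp, linarith)
  define W where "W = (\<lambda>s. V (k s) s)"
  have WV: "W s = V K s" if "1 - real K < Re s" for s K
  proof -
    define c where "c = max (1 - real K) (1 - real (k s))"
    show ?thesis unfolding W_def
    proof (rule holomorphic_eq_on_half_plane[where c = c and d = 1 and f = "V (k s)" and g = "V K"])
      show "V (k s) holomorphic_on {s. c < Re s}" "V K holomorphic_on {s. c < Re s}"
        by (rule holomorphic_on_subset[OF V(1)]; force simp: c_def)+
    qed (use that k[of s] V(3) in \<open>auto simp: c_def\<close>)
  qed
  \<comment> \<open>The half-plane of index \<open>k z\<close> is a neighbourhood of \<open>z\<close> on which \<open>W\<close> is one of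
     the given continuations.\<close>
  have "W field_differentiable at z" for z
  proof -
    have "(W holomorphic_on {s. 1 - real (k z) < Re s}) = (V (k z) holomorphic_on {s. 1 - real (k z) <
        Re s})"
      by (rule holomorphic_cong) (auto intro: WV)
    then have "W holomorphic_on {s. 1 - real (k z) < Re s}" using V(1) by blast
    then show ?thesis
      using k[of z] by (intro holomorphic_on_imp_differentiable_at[OF _ open_halfspace_Re_gt]) auto
  qed
  then have "W holomorphic_on UNIV"
    by (simp add: holomorphic_on_def)
  moreover have "W 1 = 1" using V(2) by (simp add: W_def)
  moreover have "W s = (s - 1) * dseries (\<lambda>_. 1) s" if "1 < Re s" for s
    using V(3) that by (simp add: W_def)
  ultimately show ?thesis by blast
qed

text \<open>
The constant \<open>riemann_zeta\<close> is a choice; the entire numerator just constructed shows that the choice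
is from a nonempty set, and the identity theorem on the punctured plane determines it.
\<close>
lemma riemann_zeta_facts:
  shows riemann_zeta_holomorphic: "riemann_zeta holomorphic_on - {1}"
    and riemann_zeta_eq_dseries: "Re s > 1 \<Longrightarrow> riemann_zeta s = dseries (\<lambda>_. 1) s"
    and riemann_zeta_numerator: "\<exists>W. W holomorphic_on UNIV \<and> W 1 = 1 \<and>
        (\<forall>s. s \<noteq> 1 \<longrightarrow> riemann_zeta s = W s / (s - 1))"
proof -
  have ser: "(\<Sum>n. 1 / of_nat (Suc n) powr s) = dseries (\<lambda>_. 1) s" if "Re s > 1" for s
  proof -
    have "((\<lambda>n. 1 * of_nat n powr (-s)) has_sum dseries (\<lambda>_. 1) s) UNIV"
      by (rule dseries_has_sum[OF abs_conv_beyond_1 that])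
    then have "(\<lambda>n. of_nat n powr (-s)) sums dseries (\<lambda>_. 1) s"
      using has_sum_imp_sums by fastforce
    then have "(\<lambda>n. of_nat (Suc n) powr (-s)) sums dseries (\<lambda>_. 1) s"
      by (subst sums_Suc_iff) simp
    then have "(\<lambda>n. 1 / of_nat (Suc n) powr s) sums dseries (\<lambda>_. 1) s"
      by (simp only: powr_minus inverse_eq_divide)
    then show ?thesis by (rule sums_unique[symmetric])
  qed
  obtain W where W: "W holomorphic_on UNIV" "W 1 = 1" "\<And>s. 1 < Re s \<Longrightarrow>
      W s = (s - 1) * dseries (\<lambda>_. 1) s"
    using ex_zeta_numerator by blast
  have Wq: "(\<lambda>s. W s / (s - 1)) holomorphic_on - {1}"
    by (intro holomorphic_intros holomorphic_on_subset[OF W(1)]) auto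
  have Wz: "W s / (s - 1) = dseries (\<lambda>_. 1) s" if "1 < Re s" for s
    using W(3)[OF that] that by (cases "s = 1") auto
  have "riemann_zeta holomorphic_on - {1} \<and> (\<forall>s. 1 < Re s \<longrightarrow> riemann_zeta s
      = (\<Sum>n. 1 / of_nat (Suc n) powr s))"
    unfolding riemann_zeta_def
    by (rule someI[of _ "\<lambda>s. W s / (s - 1)"]) (use Wq Wz ser in simp)
  then show hol: "riemann_zeta holomorphic_on - {1}"
    and eq: "Re s > 1 \<Longrightarrow> riemann_zeta s = dseries (\<lambda>_. 1) s" for s
    using ser by auto
  have "riemann_zeta s = W s / (s - 1)" if "s \<noteq> 1" for s
  proof (rule analytic_continuation_open[where s = "{s. 1 < Re s}" and s' = "- {1}" and f
      = riemann_zeta and g = "\<lambda>s. W s / (s - 1)"])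
    show "{s. 1 < Re s} \<noteq> {}" using complex.sel(1)[of 2 0]
        by (metis (mono_tags) empty_Collect_eq one_less_numeral_iff semiring_norm(76))
    show "connected (- {1 :: complex})" by (rule connected_punctured_universe) simp
    show "open {s. 1 < Re s}" by (rule open_halfspace_Re_gt)
    show "riemann_zeta z = W z / (z - 1)" if "z \<in> {s. 1 < Re s}" for z
      using eq[of z] Wz[of z] that by simp
  qed (use hol Wq that in auto)
  then show "\<exists>W. W holomorphic_on UNIV \<and> W 1 = 1 \<and>
      (\<forall>s. s \<noteq> 1 \<longrightarrow> riemann_zeta s = W s / (s - 1))"
    using W by blast
qed

lemma is_pole_riemann_zeta: "is_pole riemann_zeta 1"
proof -
  obtain W where W: "W holomorphic_on UNIV" "W 1 = 1" "\<And>s. s \<noteq> 1 \<Longrightarrow>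
      riemann_zeta s = W s / (s - 1)"
    using riemann_zeta_numerator by blast
  have "is_pole (\<lambda>s. W s / (s - 1) ^ 1) 1"
    by (rule is_pole_basic[OF W(1)]) (auto simp: W)
  also have "?this \<longleftrightarrow> ?thesis"
    by (rule is_pole_cong) (auto simp: W(3) eventually_at_filter)
  finally show ?thesis .
qed

section \<open>The Moebius function and the von Mangoldt series\<close>

definition moebius_mu :: "nat \<Rightarrow> int" where
  "moebius_mu n = (if squarefree n then (-1) ^ card (prime_factors n) else 0)"

text \<open>
Multiplication by a new prime changes the sign; this drives the cancellation in the divisor sum.
\<close>
lemma moebius_prime_mult:
  assumes "prime p" "\<not> p dvd d" "d > 0"
  shows "moebius_mu (p * d) = - moebius_mu d"
proof -
  have "coprime p d" using assms by (simp add: prime_imp_coprime)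
  then have "squarefree (p * d) \<longleftrightarrow> squarefree d"
    using assms by (auto intro: squarefree_mult_coprime squarefree_prime dest: squarefree_multD)
  moreover have "prime_factors (p * d) = insert p (prime_factors d)"
    using assms by (auto simp: prime_factors_product prime_prime_factors)
  moreover have "p \<notin> prime_factors d" using assms by auto
  ultimately show ?thesis by (simp add: moebius_mu_def)
qed

text \<open>
Fix a prime \<open>p\<close> that divides \<open>n\<close>. Then \<open>d \<mapsto> p * d\<close> pairs the squarefree divisors not divisible by
\<open>p\<close> with those divisible by \<open>p\<close>, and the two terms of each pair cancel.
\<close>
lemma sum_moebius_divisors:
  assumes "n > 0"
  shows "(\<Sum>d | d dvd n. moebius_mu d) = (if n = 1 then 1 else 0)"
proof (cases "n = 1")
  case True
  then show ?thesis by (simp add: moebius_mu_def)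
next
  case False
  then obtain p where p: "prime p" "p dvd n" using prime_factor_nat by blast
  define A where "A = {d. d dvd n \<and> squarefree d \<and> \<not> p dvd d}"
  define B where "B = {d. d dvd n \<and> squarefree d \<and> p dvd d}"
  have fin: "finite {d. d dvd n}" using assms by simp
  have "(\<Sum>d | d dvd n. moebius_mu d) = (\<Sum>d \<in> A \<union> B. moebius_mu d)"
    using fin by (intro sum.mono_neutral_right) (auto simp: A_def B_def moebius_mu_def)
  also have "\<dots> = (\<Sum>d\<in>A. moebius_mu d) + (\<Sum>d\<in>B. moebius_mu d)"
    by (intro sum.union_disjoint finite_subset[OF _ fin]) (auto simp: A_def B_def)
  also have "(\<Sum>d\<in>B. moebius_mu d) = (\<Sum>d\<in>A. - moebius_mu d)"
  proof (rule sum.reindex_bij_witness[of _ "\<lambda>d. p * d" "\<lambda>d. d div p"])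
    fix d assume d: "d \<in> B"
    then obtain e where e: "d = p * e" by (auto simp: B_def)
    have "\<not> p dvd e"
    proof
      assume "p dvd e"
      then have "p\<^sup>2 dvd d" by (auto simp: e power2_eq_square)
      with d p show False by (auto simp: B_def dest: squarefreeD)
    qed
    moreover have "e > 0" using d assms by (auto simp: B_def e intro!: Nat.gr0I)
    ultimately show "- moebius_mu (d div p) = moebius_mu d" "d div p \<in> A" "p * (d div p) = d"
      using d p moebius_prime_mult[of p e]
      by (auto simp: e A_def B_def prime_gt_0_nat dest: squarefree_multD dvd_mult_right)
  next
    fix d assume d: "d \<in> A"
    show "p * d div p = d" using p by (simp add: prime_gt_0_nat)
    have "coprime p d" using d p by (simp add: A_def prime_imp_coprime)
    then show "p * d \<in> B"
      using d p by (auto simp: A_def B_def divides_mult squarefree_prime intro!: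
          squarefree_mult_coprime)
  qed
  finally show ?thesis using False by (simp add: sum_negf)
qed

lemma dseries_delta: "dseries (\<lambda>n. if n = 1 then 1 else 0) s = 1"
proof -
  have "((\<lambda>n. (if n = 1 then 1 else 0) * of_nat n powr (-s)) has_sum (1::complex)) {1::nat}"
    by (rule has_sum_finiteI) auto
  also have "?this \<longleftrightarrow> ((\<lambda>n. (if n = 1 then 1 else 0) * of_nat n powr (-s))
      has_sum (1::complex)) UNIV"
    by (rule has_sum_cong_neutral) auto
  finally show ?thesis unfolding dseries_def by (rule infsumI)
qed

lemma dseries_cong: "(\<And>n. n > 0 \<Longrightarrow> a n = b n) \<Longrightarrow>
    dseries a s = dseries b s"
  unfolding dseries_def by (rule infsum_cong) (metis bot_nat_0.not_eq_extremum mult_zero_right of_nat_0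
      powr_0)

lemma norm_moebius_mu: "norm (of_int (moebius_mu n) :: complex) \<le> 1"
  by (simp add: moebius_mu_def norm_power)

text \<open>
The series with coefficients \<open>\<mu>(n)\<close> is an inverse of the zeta function on the half-plane of absolute
convergence.
\<close>
lemma riemann_zeta_nonzero_right:
  assumes "Re s > 1" shows "riemann_zeta s \<noteq> 0"
proof -
  have m: "abs_conv_beyond (\<lambda>n. of_int (moebius_mu n)) 1"
    by (rule abs_conv_beyond_mono[OF abs_conv_beyond_1]) (use norm_moebius_mu in auto)
  have "dseries (\<lambda>n. of_int (moebius_mu n)) s * dseries (\<lambda>_. 1) s
      = dseries (\<lambda>n. \<Sum>d | d dvd n. of_int (moebius_mu d) * 1) s"
    by (intro dseries_mult abs_conv_beyondD[OF m] abs_conv_beyondD[OF abs_conv_beyond_1] assms)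
  also have "\<dots> = dseries (\<lambda>n. if n = 1 then 1 else 0) s"
  proof (rule dseries_cong)
    fix n :: nat assume "n > 0"
    then show "(\<Sum>d | d dvd n. of_int (moebius_mu d) * 1) = (if n = 1 then 1 else 0 :: complex)"
      using sum_moebius_divisors[of n] by (simp flip: of_int_sum)
  qed
  finally show ?thesis
    using riemann_zeta_eq_dseries[OF assms] unfolding dseries_delta by auto
qed

lemma abs_conv_beyond_mangoldt: "abs_conv_beyond mangoldt 1"
proof (rule abs_conv_beyond_mono[OF abs_conv_beyond_ln[OF abs_conv_beyond_1] order.refl])
  fix n show "norm (mangoldt n :: complex) \<le> norm (complex_of_real (ln (real n)) * 1)"
    using mangoldt_le[of n] mangoldt_nonneg[of n] by (cases "n = 0") auto
qed

text \<open>
The convolution of the von Mangoldt function with the constant 1 is \<open>ln\<close>, and \<open>ln\<close> gives the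
coefficients of \<open>-\<zeta>'\<close>.
\<close>
lemma zeta_log_deriv:
  assumes "Re s > 1"
  shows "deriv riemann_zeta s / riemann_zeta s = - dseries mangoldt s"
proof -
  have "dseries mangoldt s * dseries (\<lambda>_. 1) s = dseries (\<lambda>n. \<Sum>d | d dvd n.
      mangoldt d * 1) s"
    by (intro dseries_mult abs_conv_beyondD[OF abs_conv_beyond_mangoldt] abs_conv_beyondD[OF
        abs_conv_beyond_1] assms)
  also have "\<dots> = dseries (\<lambda>n. of_real (ln (real n)) * 1) s"
    by (rule dseries_cong) (simp add: mangoldt_sum)
  finally have *: "dseries (\<lambda>n. of_real (ln (real n)) * 1) s
      = dseries mangoldt s * riemann_zeta s"
    by (simp add: riemann_zeta_eq_dseries assms)
  have "(riemann_zeta has_field_derivative - dseries (\<lambda>n. of_real (ln (real n)) * 1) s) (at s)"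
  proof (rule has_field_derivative_transform_within_open)
    show "(dseries (\<lambda>_. 1) has_field_derivative - dseries (\<lambda>n. of_real (ln (real n))
        * 1) s) (at s)"
      by (rule dseries_deriv[OF abs_conv_beyond_1 assms])
    show "open {s. 1 < Re s}" by (rule open_halfspace_Re_gt)
  qed (use assms riemann_zeta_eq_dseries in auto)
  then have "deriv riemann_zeta s = - (dseries mangoldt s * riemann_zeta s)"
    unfolding * by (rule DERIV_imp_deriv)
  then show ?thesis using riemann_zeta_nonzero_right[OF assms] by simp
qed

section \<open>Zeros of zeta on the line of real part 1\<close>

text \<open>
The residue of a logarithmic derivative is the order of the zero, \<open>m\<close>.
\<close>
lemma tendsto_log_deriv:
  assumes f: "f holomorphic_on S" "open S" "connected S" "z \<in> S" "\<exists>w\<in>S. f w \<noteq> 0"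
  shows "\<exists>m::nat. (f z = 0 \<longrightarrow> m > 0) \<and>
      ((\<lambda>s. (s - z) * (deriv f s / f s)) \<longlongrightarrow> of_nat m) (at z)"
proof -
  define n where "n = nat (zorder f z)"
  define g where "g = zor_poly f z"
  note Z = zorder_exist_zero[OF f, folded g_def n_def]
  obtain r where r: "r > 0" "g holomorphic_on cball z r"
     "\<forall>w\<in>cball z r. f w = g w * (w - z) ^ n \<and> g w \<noteq> 0"
    using Z[THEN conjunct2] by blast
  have n: "f z = 0 \<longrightarrow> n > 0"
    using Z[THEN conjunct1] by (simp add: n_def)
  have gb: "g holomorphic_on ball z r" using r(2) by (rule holomorphic_on_subset) auto
  have ev: "eventually (\<lambda>s. (s - z) * (deriv g s / g s) + of_nat n
      = (s - z) * (deriv f s / f s)) (at z)"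
  proof -
    have "eventually (\<lambda>s. s \<in> ball z r - {z}) (at z)"
      using r(1) by (intro eventually_at_in_open) auto
    then show ?thesis
    proof eventually_elim
      case (elim s)
      then have s: "s \<in> ball z r" "s \<noteq> z" by auto
      have "(g has_field_derivative deriv g s) (at s)"
        using holomorphic_derivI[OF gb open_ball s(1)] .
      then have "((\<lambda>w. g w * (w - z) ^ n) has_field_derivative
          deriv g s * (s - z) ^ n + g s * (of_nat n * (s - z) ^ (n - 1))) (at s)"
        by (auto intro!: derivative_eq_intros)
      moreover have "eventually (\<lambda>w. w \<in> ball z r) (nhds s)"
        using s by (intro eventually_nhds_in_open) auto
      then have "eventually (\<lambda>w. g w * (w - z) ^ n = f w) (nhds s)"
        by eventually_elim (use r(3) in auto)
      ultimately have "(f has_field_derivative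
          deriv g s * (s - z) ^ n + g s * (of_nat n * (s - z) ^ (n - 1))) (at s)"
        by (subst (asm) DERIV_cong_ev[OF refl _ refl]) auto
      then have "deriv f s = deriv g s * (s - z) ^ n + g s * (of_nat n * (s - z) ^ (n - 1))"
        by (rule DERIV_imp_deriv)
      moreover have "f s = g s * (s - z) ^ n" "g s \<noteq> 0" using r(3) s by auto
      moreover have "of_nat n * (s - z) ^ n = (s - z) * (of_nat n * (s - z) ^ (n - 1))"
        by (cases n) auto
      moreover have "u * (D / G) + c = u * ((D * A + G * B) / (G * A))"
        if "G \<noteq> 0" "A \<noteq> 0" "c * A = u * B" for u D G c A B :: complex
      proof -
        have "u * (D * A + G * B) = u * D * A + G * (u * B)" by (simp add: algebra_simps)
        also have "\<dots> = (u * D + G * c) * A" unfolding that(3)[symmetric]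
            by (simp add: algebra_simps)
        finally have "u * (D * A + G * B) = (u * D + G * c) * A" .
        then have "u * ((D * A + G * B) / (G * A)) = ((u * D + G * c) * A) / (G * A)"
          by (metis times_divide_eq_right)
        then show ?thesis using that(1,2) by (simp add: add_divide_distrib)
      qed
      ultimately show ?case using s by simp
    qed
  qed
  have "continuous_on (ball z r) (\<lambda>s. deriv g s / g s)"
    using r(3) gb by (intro continuous_intros holomorphic_on_imp_continuous_on holomorphic_deriv) auto
  then have "isCont (\<lambda>s. deriv g s / g s) z"
    using r(1) by (simp add: continuous_on_eq_continuous_at)
  then have "((\<lambda>s. (s - z) * (deriv g s / g s) + of_nat n)
      \<longlongrightarrow> (z - z) * (deriv g z / g z) + of_nat n) (at z)"
    by (intro tendsto_add tendsto_mult tendsto_diff tendsto_ident_at tendsto_const) (simp add: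
        isCont_def)
  then have "((\<lambda>s. (s - z) * (deriv f s / f s)) \<longlongrightarrow> of_nat n) (at z)"
    using Lim_transform_eventually[OF _ ev] by simp
  then show ?thesis using n by blast
qed

text \<open>
Near 1 the numerator \<open>W\<close> of zeta has no zeros, and the logarithmic derivative of \<open>W s / (s - 1)\<close> is
\<open>W'/W - 1/(s - 1)\<close>.
\<close>
lemma zeta_log_deriv_near_1:
  "\<exists>e>0. \<exists>h. h holomorphic_on ball 1 e \<and>
     (\<forall>s\<in>ball 1 e - {1}. deriv riemann_zeta s / riemann_zeta s = h s - 1 / (s - 1))"
proof -
  obtain W where W: "W holomorphic_on UNIV" "W 1 = 1" "\<And>s. s \<noteq> 1 \<Longrightarrow>
      riemann_zeta s = W s / (s - 1)"
    using riemann_zeta_numerator by blast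
  have "isCont W 1"
    using holomorphic_on_imp_continuous_on[OF W(1)] by (simp add: continuous_on_eq_continuous_at)
  then obtain e where e: "e > 0" "\<And>s. dist 1 s < e \<Longrightarrow> W s \<noteq> 0"
    using continuous_at_avoid[of 1 W 0] W(2) by auto
  have "deriv riemann_zeta s / riemann_zeta s = deriv W s / W s - 1 / (s - 1)" if s: "s \<in> ball 1 e"
      "s \<noteq> 1" for s
  proof -
    have "(W has_field_derivative deriv W s) (at s)"
      by (rule holomorphic_derivI[OF W(1)]) auto
    then have "((\<lambda>s. W s / (s - 1)) has_field_derivative (deriv W s * (s - 1) - W s
        * 1) / ((s - 1) * (s - 1))) (at s)"
      using s by (auto intro!: derivative_eq_intros)
    then have "(riemann_zeta has_field_derivative (deriv W s * (s - 1) - W s * 1) / ((s - 1)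
        * (s - 1))) (at s)"
      by (rule has_field_derivative_transform_within_open[of _ _ _ "- {1}"]) (use s W(3) in auto)
    then have "deriv riemann_zeta s = (deriv W s * (s - 1) - W s * 1) / ((s - 1) * (s - 1))"
      by (rule DERIV_imp_deriv)
    moreover have "riemann_zeta s = W s / (s - 1)" using W(3) s by simp
    moreover have "((D * u - w * 1) / (u * u)) / (w / u) = D / w - 1 / u"
        if "u \<noteq> 0" "w \<noteq> 0" for D u w :: complex
      using that by (simp add: field_simps)
    ultimately show ?thesis using s e(2)[of s] by simp
  qed
  moreover have "(\<lambda>s. deriv W s / W s) holomorphic_on ball 1 e"
    using e by (intro holomorphic_intros holomorphic_deriv holomorphic_on_subset[OF W(1)]) auto
  ultimately show ?thesis using e(1) by (intro exI[of _ e] conjI exI[of _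
      "\<lambda>s. deriv W s / W s"]) auto
qed

text \<open>
The classical inequality \<open>3 + 4 cos \<theta> + cos (2\<theta>) = 2 (1 + cos \<theta>)\<^sup>2 \<ge> 0\<close>, applied term by term with
\<open>\<theta> = t ln n\<close>.
\<close>
lemma mangoldt_3_4_1:
  assumes "\<sigma> > 1"
  shows "Re (3 * dseries mangoldt (of_real \<sigma>) + 4 * dseries mangoldt (Complex \<sigma> t)
      + dseries mangoldt (Complex \<sigma> (2 * t))) \<ge> 0"
proof -
  have hs: "((\<lambda>n. mangoldt n * of_nat n powr (-s)) has_sum dseries mangoldt s) UNIV"
      if "Re s > 1" for s
    by (rule dseries_has_sum[OF abs_conv_beyond_mangoldt that])
  have "((\<lambda>n. 3 * (mangoldt n * of_nat n powr (- of_real \<sigma>))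
      + 4 * (mangoldt n * of_nat n powr (- Complex \<sigma> t))
        + mangoldt n * of_nat n powr (- Complex \<sigma> (2 * t))) has_sum
     (3 * dseries mangoldt (of_real \<sigma>) + 4 * dseries mangoldt (Complex \<sigma> t)
         + dseries mangoldt (Complex \<sigma> (2 * t)))) UNIV"
    using assms by (intro has_sum_add has_sum_cmult_right hs) auto
  then have "((\<lambda>n. Re (3 * (mangoldt n * of_nat n powr (- of_real \<sigma>))
      + 4 * (mangoldt n * of_nat n powr (- Complex \<sigma> t))
        + mangoldt n * of_nat n powr (- Complex \<sigma> (2 * t)))) has_sum
     Re (3 * dseries mangoldt (of_real \<sigma>) + 4 * dseries mangoldt (Complex \<sigma> t)
         + dseries mangoldt (Complex \<sigma> (2 * t)))) UNIV"
    by (rule has_sum_Re)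
  then show ?thesis
  proof (rule has_sum_nonneg)
    fix n :: nat
    have P: "Re (mangoldt n * of_nat n powr (- Complex \<sigma> y))
        = mangoldt n * real n powr (-\<sigma>) * cos (y * ln (real n))" for y
    proof (cases "n = 0")
      case False
      then have "of_nat n powr (- Complex \<sigma> y) = exp (- Complex \<sigma> y
          * of_real (ln (real n)))"
        by (simp add: powr_def Ln_of_nat)
      then have "Re (of_nat n powr (- Complex \<sigma> y))
          = exp (- \<sigma> * ln (real n)) * cos (y * ln (real n))"
        by (simp add: Re_exp)
      also have "exp (- \<sigma> * ln (real n)) = real n powr (-\<sigma>)" using False
          by (simp add: powr_def)
      finally have r: "Re (of_nat n powr (- Complex \<sigma> y))
          = real n powr (-\<sigma>) * cos (y * ln (real n))" .
      have "(mangoldt n :: complex) = of_real (mangoldt n)" by simp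
      then show ?thesis using r by (simp del: of_real_mangoldt)
    qed simp
    have "cos (2 * t * ln (real n)) = 2 * (cos (t * ln (real n)))\<^sup>2 - 1"
      by (simp add: cos_double_cos mult.assoc)
    then have "Re (3 * (mangoldt n * of_nat n powr (- of_real \<sigma>))
        + 4 * (mangoldt n * of_nat n powr (- Complex \<sigma> t))
        + mangoldt n * of_nat n powr (- Complex \<sigma> (2 * t))) =
       mangoldt n * real n powr (-\<sigma>) * (2 * (1 + cos (t * ln (real n)))\<^sup>2)"
    proof -
      have r: "Re (3 * x + 4 * y + z) = 3 * Re x + 4 * Re y + Re z" for x y z by simp
      have "of_real \<sigma> = Complex \<sigma> 0" by (simp add: complex_of_real_def)
      then show ?thesis
        using \<open>cos (2 * t * ln (real n)) = _\<close>
        unfolding r by (simp only: P) (simp add: power2_eq_square algebra_simps)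
    qed
    then show "0 \<le> Re (3 * (mangoldt n * of_nat n powr (- of_real \<sigma>))
        + 4 * (mangoldt n * of_nat n powr (- Complex \<sigma> t))
        + mangoldt n * of_nat n powr (- Complex \<sigma> (2 * t)))"
      using mangoldt_nonneg by simp
  qed
qed

text \<open>
A zero of order \<open>m\<close> at \<open>1 + it\<close>, together with the simple pole at 1 and a zero of order \<open>m' \<ge> 0\<close> at
\<open>1 + 2it\<close>, would turn the preceding inequality, multiplied by \<open>\<epsilon>\<close> and taken at \<open>\<sigma> = 1 + \<epsilon>\<close> with
\<open>\<epsilon> \<rightarrow> 0\<close>, into \<open>3 - 4m - m' \<ge> 0\<close>. This forces \<open>m = 0\<close>.
\<close>
lemma riemann_zeta_nonzero:
  assumes "Re s \<ge> 1" "s \<noteq> 1" shows "riemann_zeta s \<noteq> 0"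
proof (cases "Re s > 1")
  case False
  then have "Re s = 1" using assms by simp
  define t where "t = Im s"
  have s: "s = Complex 1 t" using \<open>Re s = 1\<close> by (simp add: t_def complex_eq_iff)
  have t: "t \<noteq> 0" using assms(2) by (auto simp: s complex_eq_iff)
  have ne: "\<exists>w\<in>-{1}. riemann_zeta w \<noteq> 0"
    using riemann_zeta_nonzero_right[of 2] by (intro bexI[of _ 2]) auto
  have lim: "\<exists>m::nat. (riemann_zeta z = 0 \<longrightarrow> m > 0) \<and>
      ((\<lambda>s. (s - z) * (deriv riemann_zeta s / riemann_zeta s))
          \<longlongrightarrow> of_nat m) (at z)" if "z \<noteq> 1" for z
    using that connected_punctured_universe[of "1::complex"]
    by (intro tendsto_log_deriv[OF riemann_zeta_holomorphic _ _ _ ne]) auto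
  define M where "M = dseries mangoldt"
  have approach: "filterlim (\<lambda>\<epsilon>. z + of_real \<epsilon>) (at z) (at_right (0::real))"
      for z :: complex
    by (auto simp: filterlim_at eventually_at_filter intro!: tendsto_eq_intros)
  \<comment> \<open>To the right of the line the logarithmic derivative is minus the von Mangoldt
     series, hence the sign.\<close>
  have toM: "((\<lambda>\<epsilon>. of_real \<epsilon> * M (Complex (1 + \<epsilon>) y))
      \<longlongrightarrow> -l) (at_right 0)"
    if "((\<lambda>s. (s - Complex 1 y) * (deriv riemann_zeta s / riemann_zeta s))
        \<longlongrightarrow> l) (at (Complex 1 y))" for y l
  proof -
    have "((\<lambda>\<epsilon>. - (((Complex 1 y + of_real \<epsilon>) - Complex 1 y)
        * (deriv riemann_zeta (Complex 1 y + of_real \<epsilon>) / riemann_zeta (Complex 1 y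
        + of_real \<epsilon>)))) \<longlongrightarrow> -l) (at_right 0)"
      by (intro tendsto_minus filterlim_compose[OF that approach])
    moreover have "eventually (\<lambda>\<epsilon>::real. - (((Complex 1 y
        + of_real \<epsilon>) - Complex 1 y) * (deriv riemann_zeta (Complex 1 y
        + of_real \<epsilon>) / riemann_zeta (Complex 1 y + of_real \<epsilon>)))
        = of_real \<epsilon> * M (Complex (1 + \<epsilon>) y)) (at_right 0)"
      using eventually_at_right_less[of 0]
    proof eventually_elim
      case (elim \<epsilon>)
      then have *: "Re (Complex 1 y + of_real \<epsilon>) > 1" by simp
      have "Complex 1 y + of_real \<epsilon> = Complex (1 + \<epsilon>) y" by (simp add: complex_eq_iff)
      moreover have "Complex 1 y + of_real \<epsilon> - Complex 1 y = of_real \<epsilon>" by simp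
      ultimately show ?case using zeta_log_deriv[OF *] unfolding M_def by (simp only:) simp
    qed
    ultimately show ?thesis by (rule Lim_transform_eventually)
  qed
  obtain m where m: "riemann_zeta s = 0 \<longrightarrow> m > 0"
    "((\<lambda>s'. (s' - s) * (deriv riemann_zeta s' / riemann_zeta s'))
        \<longlongrightarrow> of_nat m) (at s)"
    using lim[OF assms(2)] by blast
  obtain m' where m': "((\<lambda>s'. (s' - Complex 1 (2*t))
      * (deriv riemann_zeta s' / riemann_zeta s')) \<longlongrightarrow> of_nat m') (at (Complex 1
      (2*t)))"
    using lim[of "Complex 1 (2*t)"] t by (auto simp: complex_eq_iff)
  have one: "((\<lambda>s. (s - Complex 1 0) * (deriv riemann_zeta s / riemann_zeta s))
      \<longlongrightarrow> -1) (at (Complex 1 0))"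
  proof -
    obtain e h where eh: "e > 0" "h holomorphic_on ball 1 e"
       "\<And>s. s\<in>ball 1 e - {1} \<Longrightarrow> deriv riemann_zeta s / riemann_zeta s
           = h s - 1 / (s - 1)"
      using zeta_log_deriv_near_1 by blast
    have "isCont h 1"
      using holomorphic_on_imp_continuous_on[OF eh(2)] eh(1)
          by (simp add: continuous_on_eq_continuous_at)
    then have "((\<lambda>s. (s - 1) * h s - 1) \<longlongrightarrow> (1 - 1) * h 1 - 1) (at 1)"
      by (intro tendsto_intros) (simp add: isCont_def)
    moreover have "eventually (\<lambda>s. s \<in> ball 1 e - {1}) (at (1::complex))"
      using eh(1) by (intro eventually_at_in_open) auto
    then have "eventually (\<lambda>s. (s - 1) * h s - 1 = (s - 1)
        * (deriv riemann_zeta s / riemann_zeta s)) (at 1)"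
      by eventually_elim (subst eh(3), auto simp: field_simps)
    ultimately have "((\<lambda>s. (s - 1) * (deriv riemann_zeta s / riemann_zeta s))
        \<longlongrightarrow> -1) (at 1)"
      using Lim_transform_eventually by fastforce
    moreover have "Complex 1 0 = 1" by (simp add: complex_eq_iff)
    ultimately show ?thesis by simp
  qed
  have "((\<lambda>\<epsilon>. Re (3 * (of_real \<epsilon> * M (Complex (1 + \<epsilon>) 0))
      + 4 * (of_real \<epsilon> * M (Complex (1 + \<epsilon>) t)) + of_real \<epsilon> * M (Complex (1
      + \<epsilon>) (2*t))))
       \<longlongrightarrow> Re (3 * - (-1) + 4 * - of_nat m + - of_nat m')) (at_right 0)"
    using toM[OF one] toM[OF m(2)[unfolded s]] toM[OF m'] by (intro tendsto_intros)
  then have "0 \<le> Re (3 * - (-1) + 4 * - of_nat m + - of_nat m' :: complex)"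
  proof (rule tendsto_lowerbound)
    show "eventually (\<lambda>\<epsilon>. 0 \<le> Re (3 * (of_real \<epsilon> * M (Complex (1
        + \<epsilon>) 0)) + 4 * (of_real \<epsilon> * M (Complex (1 + \<epsilon>) t))
        + of_real \<epsilon> * M (Complex (1 + \<epsilon>) (2*t)))) (at_right 0)"
      using eventually_at_right_less[of 0]
    proof eventually_elim
      case (elim \<epsilon>)
      have "0 \<le> \<epsilon> * Re (3 * M (of_real (1 + \<epsilon>)) + 4 * M (Complex (1
          + \<epsilon>) t) + M (Complex (1 + \<epsilon>) (2*t)))"
        using mangoldt_3_4_1[of "1 + \<epsilon>" t] elim unfolding M_def
            by (intro mult_nonneg_nonneg) auto
      then show ?case by (simp add: complex_of_real_def algebra_simps)
    qed
  qed auto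
  then have "m = 0" by simp
  with m(1) show ?thesis by auto
qed (rule riemann_zeta_nonzero_right)

section \<open>Moebius inversion of the logarithmic derivative of zeta\<close>

text \<open>
Without a constant term a Dirichlet series decays like \<open>2^(-Re s)\<close> to the right; this makes sums
over the multiples \<open>k w\<close> converge geometrically.
\<close>
lemma dseries_norm_bound:
  assumes a: "abs_conv_beyond a c" "a 1 = 0" "c < \<tau>" "\<tau> \<le> Re s"
  shows "norm (dseries a s) \<le> 2 powr (\<tau> - Re s) * (\<Sum>\<^sub>\<infinity>n. norm (a n)
      * real n powr (-\<tau>))"
proof -
  have sm: "(\<lambda>n. norm (a n) * real n powr (-\<tau>)) summable_on UNIV"
    using a by (simp add: abs_conv_beyond_def)
  have 1: "norm (a n * of_nat n powr (-s)) \<le> 2 powr (\<tau> - Re s) * (norm (a n)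
      * real n powr (-\<tau>))" for n
  proof -
    consider "n = 0" | "n = 1" | "n \<ge> 2" by linarith
    then show ?thesis
    proof cases
      case 3
      have "real n powr (- Re s) = real n powr (\<tau> - Re s) * real n powr (-\<tau>)"
        by (simp flip: powr_add)
      also have "\<dots> \<le> 2 powr (\<tau> - Re s) * real n powr (-\<tau>)"
        using 3 a(4) by (intro mult_right_mono powr_mono2') auto
      finally have "norm (a n) * real n powr (- Re s) \<le> norm (a n) * (2 powr (\<tau> - Re s)
          * real n powr (-\<tau>))"
        by (intro mult_left_mono) auto
      then show ?thesis by (simp add: norm_mult norm_of_nat_powr mult_ac)
    qed (use a(2) in auto)
  qed
  have "((\<lambda>n. a n * of_nat n powr (-s)) has_sum dseries a s) UNIV"
    unfolding dseries_def using a by (intro has_sum_infsum abs_conv_beyondD(2)[OF a(1)]) auto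
  moreover have "((\<lambda>n. 2 powr (\<tau> - Re s) * (norm (a n) * real n powr (-\<tau>))) has_sum
      2 powr (\<tau> - Re s) * (\<Sum>\<^sub>\<infinity>n. norm (a n) * real n powr (-\<tau>))) UNIV"
    by (intro has_sum_cmult_right has_sum_infsum sm)
  ultimately show ?thesis using 1 by (rule norm_infsum_le)
qed

text \<open>
Moebius inversion over multiples: if \<open>F k\<close> is the sum of \<open>q\<close> over the multiples of \<open>k\<close>, then
weighting \<open>F k\<close> with \<open>\<mu>(k)\<close> counts \<open>q m\<close> with the weight \<open>\<Sum>\<^bsub>k dvd m\<^esub> \<mu>(k)\<close>, which is 1 for \<open>m = 1\<close>
and 0 otherwise. The geometric decay of \<open>q\<close> beats the number of divisors, so the double sum
converges absolutely.
\<close>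
lemma moebius_inversion_multiples:
  fixes q :: "nat \<Rightarrow> complex"
  assumes r: "0 \<le> r" "r < 1" and q: "\<And>m. m > 0 \<Longrightarrow> norm (q m) \<le> C * r ^ m"
    and F: "\<And>k. k > 0 \<Longrightarrow> ((\<lambda>j. q (k * j)) has_sum F k) {1..}"
  shows "((\<lambda>k. of_int (moebius_mu k) * F k) has_sum q 1) {1..}"
proof -
  define P where "P = {1::nat..}"
  define T where "T = (SIGMA m:P. {k. k dvd m})"
  have fin: "finite {k. k dvd m}" "card {k. k dvd m} \<le> m" if "m \<in> P" for m
  proof -
    have "{k. k dvd m} \<subseteq> {1..m}" using that by (auto simp: P_def dest: dvd_imp_le intro:
        Nat.gr0I)
    from finite_subset[OF this] card_mono[OF _ this]
    show "finite {k. k dvd m}" "card {k. k dvd m} \<le> m" by simp_all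
  qed
  have C: "C * r ^ m \<ge> 0" if "m \<in> P" for m
    using order_trans[OF norm_ge_zero q[of m]] that by (simp add: P_def)
  have "(\<lambda>x. case x of (m, k) \<Rightarrow> C * r ^ m) summable_on T"
    unfolding T_def
  proof (rule summable_on_SigmaI)
    show "((\<lambda>k. case (m, k) of (m, k) \<Rightarrow> C * r ^ m)
        has_sum real (card {k. k dvd m}) * (C * r ^ m)) {k. k dvd m}" if "m \<in> P" for m
      using has_sum_finite[OF fin(1)[OF that], of "\<lambda>_. C * r ^ m"] by simp
    have "summable (\<lambda>m. real (Suc m) * r ^ m)"
      using geometric_deriv_sums[of r] r by (simp add: sums_iff)
    then have "(\<lambda>m. real (Suc m) * r ^ m) summable_on UNIV"
      using r by (subst summable_on_UNIV_nonneg_real_iff) auto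
    then have "(\<lambda>m. C * (real (Suc m) * r ^ m)) summable_on P"
      by (intro summable_on_cmult_right) (auto intro: summable_on_subset_banach)
    then show "(\<lambda>m. real (card {k. k dvd m}) * (C * r ^ m)) summable_on P"
    proof (rule summable_on_comparison_test)
      show "real (card {k. k dvd m}) * (C * r ^ m) \<le> C * (real (Suc m) * r ^ m)"
          if "m \<in> P" for m
        using mult_right_mono[OF _ C[OF that], of "real (card {k. k dvd m})"
            "real (Suc m)"] fin(2)[OF that] by (simp add: mult_ac del: of_nat_Suc)
    qed (use C in auto)
  qed (use C in auto)
  then have "(\<lambda>x. norm (case x of (m, k) \<Rightarrow> of_int (moebius_mu k)
      * q m)) summable_on T"
  proof (rule Infinite_Sum.abs_summable_on_comparison_test')
    fix x assume "x \<in> T"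
    then obtain m k where x: "x = (m, k)" "m > 0" by (auto simp: T_def P_def)
    have "norm (of_int (moebius_mu k) * q m) \<le> 1 * (C * r ^ m)"
      unfolding norm_mult using q[OF x(2)] by (intro mult_mono norm_moebius_mu) auto
    then show "norm (case x of (m, k) \<Rightarrow> of_int (moebius_mu k) * q m)
        \<le> (case x of (m, k) \<Rightarrow> C * r ^ m)"
      by (simp add: x)
  qed
  then have sm: "(\<lambda>x. (case x of (m, k) \<Rightarrow> of_int (moebius_mu k)
      * q m)) summable_on T"
    by (rule abs_summable_summable)
  have "((\<lambda>(m,k). of_int (moebius_mu k) * q m) has_sum q 1) T"
    unfolding T_def
  proof (rule has_sum_SigmaI)
    show "((\<lambda>k. case (m, k) of (m, k) \<Rightarrow> of_int (moebius_mu k) * q m)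
        has_sum (if m = 1 then q 1 else 0)) {k. k dvd m}"
      if "m \<in> P" for m
    proof -
      have "(\<Sum>k | k dvd m. of_int (moebius_mu k) * q m)
          = of_int (\<Sum>k | k dvd m. moebius_mu k) * q m"
        by (simp add: sum_distrib_right)
      also have "\<dots> = (if m = 1 then q 1 else 0)"
        using that by (subst sum_moebius_divisors) (auto simp: P_def)
      finally show ?thesis
        using has_sum_finite[OF fin(1)[OF that], of "\<lambda>k. of_int (moebius_mu k) * q m"] by simp
    qed
    have "((\<lambda>m. if m = 1 then q 1 else 0) has_sum q 1) {1::nat}"
      by (rule has_sum_finiteI) auto
    also have "?this \<longleftrightarrow> ((\<lambda>m. if m = 1 then q 1 else 0) has_sum q 1) P"
      by (rule has_sum_cong_neutral) (auto simp: P_def)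
    finally show "((\<lambda>m. if m = 1 then q 1 else 0) has_sum q 1) P" .
  qed (use sm in \<open>simp add: T_def\<close>)
  also have "?this \<longleftrightarrow> ((\<lambda>(k,j). of_int (moebius_mu k) * q (k * j))
      has_sum q 1) (P \<times> P)"
    unfolding T_def
    by (rule has_sum_reindex_bij_witness[where i = "\<lambda>(k,j). (k*j, k)" and j
        = "\<lambda>(m,k). (k, m div k)"])
       (auto simp: P_def div_greater_zero_iff Suc_le_eq dest: dvd_imp_le intro: Nat.gr0I)
  finally show ?thesis
    unfolding P_def
  proof (rule has_sum_SigmaD)
    fix k :: nat assume "k \<in> {1..}"
    then show "((\<lambda>j. case (k, j) of (k, j) \<Rightarrow> of_int (moebius_mu k) * q (k * j))
        has_sum of_int (moebius_mu k) * F k) {1..}"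
      using has_sum_cmult_right[OF F[of k]] by simp
  qed
qed

definition prime_ind :: "nat \<Rightarrow> complex" where
  "prime_ind n = (if prime n then 1 else 0)"

definition prime_log :: "nat \<Rightarrow> complex" where
  "prime_log n = of_real (ln (real n)) * prime_ind n"

lemma abs_conv_beyond_prime_ind: "abs_conv_beyond prime_ind 1"
  by (rule abs_conv_beyond_mono[OF abs_conv_beyond_1]) (auto simp: prime_ind_def)

lemma abs_conv_beyond_prime_log: "abs_conv_beyond prime_log 1"
  unfolding prime_log_def[abs_def] by (rule abs_conv_beyond_ln[OF abs_conv_beyond_prime_ind])

lemma of_nat_power_powr: 
  assumes "p > 0" shows "of_nat (p ^ j) powr (s::complex) = of_nat p powr (of_nat j * s)"
proof -
  have "Ln (of_nat (p ^ j)) = of_real (ln (real (p ^ j)))"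
    using assms by (intro Ln_of_nat) simp
  also have "ln (real (p ^ j)) = real j * ln (real p)"
    using assms by (simp add: ln_realpow)
  finally show ?thesis
    using assms by (simp add: powr_def Ln_of_nat mult_ac del: of_nat_power)
qed

text \<open>
The von Mangoldt function is \<open>ln p\<close> at each power of the prime \<open>p\<close>, so its series splits according
to the exponent \<open>j\<close>.
\<close>
lemma mangoldt_series_eq_prime_log_series:
  assumes s: "Re s > 1"
  shows "((\<lambda>j. dseries prime_log (of_nat j * s)) has_sum dseries mangoldt s) {1..}"
proof -
  have "((\<lambda>n. mangoldt n * of_nat n powr (-s)) has_sum dseries mangoldt s) UNIV"
    by (rule dseries_has_sum[OF abs_conv_beyond_mangoldt s])
  also have "?this \<longleftrightarrow> ((\<lambda>n. mangoldt n * of_nat n powr (-s))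
      has_sum dseries mangoldt s) (Collect primepow)"
    by (rule has_sum_cong_neutral) (auto simp: mangoldt_def)
  also have "\<dots> \<longleftrightarrow> ((\<lambda>x. mangoldt ((\<lambda>(p,k). p ^ Suc k) x)
      * of_nat ((\<lambda>(p,k). p ^ Suc k) x) powr (-s)) has_sum dseries mangoldt s) (Collect prime
      \<times> UNIV)"
    by (rule has_sum_reindex_bij_betw[OF bij_betw_primepows, symmetric])
  also have "\<dots> \<longleftrightarrow> ((\<lambda>(p,k). prime_log p
      * of_nat p powr (- (of_nat (Suc k) * s))) has_sum dseries mangoldt s) (Collect prime \<times>
      UNIV)"
  proof (rule has_sum_cong)
    fix x :: "nat \<times> nat" assume "x \<in> Collect prime \<times> UNIV"
    then obtain p k where x: "x = (p, k)" "prime p" by auto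
    have "mangoldt (p ^ Suc k) * of_nat (p ^ Suc k) powr (-s)
        = prime_log p * of_nat p powr (of_nat (Suc k) * - s)"
      unfolding of_nat_power_powr[OF prime_gt_0_nat[OF x(2)]] mangoldt_primepow'[OF x(2) zero_less_Suc]
      using x(2) by (simp add: prime_log_def prime_ind_def)
    then show "mangoldt ((\<lambda>(p,k). p ^ Suc k) x) * of_nat ((\<lambda>(p,k). p ^ Suc k) x) powr
        (-s) =
       (case x of (p, k) \<Rightarrow> prime_log p * of_nat p powr (- (of_nat (Suc k) * s)))"
      by (simp only: x(1) prod.case mult_minus_right)
  qed
  also have "\<dots> \<longleftrightarrow> ((\<lambda>(k,p). prime_log p
      * of_nat p powr (- (of_nat (Suc k) * s))) has_sum dseries mangoldt s) (UNIV \<times> Collect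
      prime)"
    by (subst has_sum_swap) (simp add: case_prod_unfold)
  finally have "((\<lambda>k. dseries prime_log (of_nat (Suc k) * s)) has_sum dseries mangoldt s) UNIV"
  proof (rule has_sum_SigmaD)
    fix k :: nat
    have "Re (of_nat (Suc k) * s) > 1"
    proof -
      have "1 * Re s \<le> real (Suc k) * Re s" using s by (intro mult_right_mono) auto
      moreover have "Re (of_nat m * s) = real m * Re s" for m by simp
      ultimately show ?thesis using s by (simp only:)
    qed
    then have "((\<lambda>p. prime_log p * of_nat p powr (- (of_nat (Suc k) * s)))
        has_sum dseries prime_log (of_nat (Suc k) * s)) UNIV"
      unfolding dseries_def by (intro has_sum_infsum abs_conv_beyondD(2)[OF abs_conv_beyond_prime_log])
    also have "?this \<longleftrightarrow> ((\<lambda>p. prime_log p * of_nat p powr (- (of_nat (Suc k)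
        * s))) has_sum dseries prime_log (of_nat (Suc k) * s)) (Collect prime)"
      by (rule has_sum_cong_neutral) (auto simp: prime_log_def prime_ind_def)
    finally show "((\<lambda>p. case (k, p) of (k, p) \<Rightarrow> prime_log p
        * of_nat p powr (- (of_nat (Suc k) * s))) has_sum
         dseries prime_log (of_nat (Suc k) * s)) (Collect prime)" by simp
  qed
  also have "?this \<longleftrightarrow> ?thesis"
    by (rule has_sum_reindex_bij_witness[of _ "\<lambda>j. j - 1" Suc]) auto
  finally show ?thesis .
qed

text \<open>
The derivative of the prime zeta function, in the form that makes sense for every \<open>w\<close> with positive
real part at which no \<open>k * w\<close> with \<open>k\<close> squarefree is a zero or the pole of zeta.
\<close>
definition prime_zeta_deriv :: "complex \<Rightarrow> complex" where
  "prime_zeta_deriv w = (\<Sum>\<^sub>\<infinity>k\<in>{1..}. of_int (moebius_mu k) *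
      (deriv riemann_zeta (of_nat k * w) / riemann_zeta (of_nat k * w)))"

lemma prime_zeta_deriv_eq:
  assumes w: "Re w > 1"
  shows "prime_zeta_deriv w = - dseries prime_log w"
proof -
  define \<tau> where "\<tau> = (1 + Re w) / 2"
  have \<tau>: "1 < \<tau>" "\<tau> < Re w" using w by (auto simp: \<tau>_def)
  define S where "S = (\<Sum>\<^sub>\<infinity>n. norm (prime_log n) * real n powr (-\<tau>))"
  define r where "r = 2 powr (- Re w)"
  have Re_gt: "Re (of_nat m * w) > 1" if "m > 0" for m
  proof -
    have "1 * Re w \<le> real m * Re w" using w that by (intro mult_right_mono) auto
    moreover have "Re (of_nat m * w) = real m * Re w" by simp
    ultimately show ?thesis using w by linarith
  qed
  have "((\<lambda>k. of_int (moebius_mu k) * dseries mangoldt (of_nat k * w))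
      has_sum dseries prime_log (of_nat 1 * w)) {1..}"
  proof (rule moebius_inversion_multiples[where q = "\<lambda>m. dseries prime_log (of_nat m * w)" and r
      = r and C = "2 powr \<tau> * S"])
    show "0 \<le> r" "r < 1" using w powr_less_mono[of "- Re w" 0 2] by (auto simp: r_def)
    fix m :: nat assume m: "m > 0"
    have "\<tau> \<le> Re (of_nat m * w)" using m \<tau> mult_mono[of 1 "real m" \<tau> "Re w"] by simp
    then have "norm (dseries prime_log (of_nat m * w)) \<le> 2 powr (\<tau> - Re (of_nat m * w)) * S"
      unfolding S_def using \<tau> by (intro dseries_norm_bound[OF abs_conv_beyond_prime_log]) (auto
          simp: prime_log_def)
    also have "2 powr (\<tau> - Re (of_nat m * w)) = 2 powr \<tau> * r ^ m"
    proof -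
      have "r ^ m = 2 powr (- Re w * real m)"
        by (simp add: r_def powr_powr flip: powr_realpow)
      then show ?thesis by (simp flip: powr_add) (simp add: mult.commute)
    qed
    finally show "norm (dseries prime_log (of_nat m * w)) \<le> 2 powr \<tau> * S * r ^ m"
        by (simp add: mult_ac)
  next
    fix k :: nat assume k: "k > 0"
    from mangoldt_series_eq_prime_log_series[OF Re_gt[OF this]]
    show "((\<lambda>j. dseries prime_log (of_nat (k * j) * w))
        has_sum dseries mangoldt (of_nat k * w)) {1..}"
      by (simp add: mult_ac)
  qed
  then have "((\<lambda>k. - (of_int (moebius_mu k) * dseries mangoldt (of_nat k * w)))
      has_sum - dseries prime_log w) {1..}"
    by (simp add: has_sum_uminus)
  also have "?this \<longleftrightarrow> ((\<lambda>k. of_int (moebius_mu k) *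
      (deriv riemann_zeta (of_nat k * w) / riemann_zeta (of_nat k * w)))
          has_sum - dseries prime_log w) {1..}"
    by (rule has_sum_cong) (simp add: zeta_log_deriv[OF Re_gt])
  finally show ?thesis unfolding prime_zeta_deriv_def by (rule infsumI)
qed

section \<open>Continuation of the derivative of the prime zeta function\<close>

definition zeta_regular :: "complex set" where
  "zeta_regular = {s. s \<noteq> 1 \<and> riemann_zeta s \<noteq> 0}"

definition prime_zeta_domain :: "complex set" where
  "prime_zeta_domain = {w. 0 < Re w \<and> (\<forall>k. squarefree k \<longrightarrow> of_nat k
      * w \<in> zeta_regular)}"

lemma open_zeta_regular: "open zeta_regular"
proof -
  have "open (- {1} \<inter> riemann_zeta -` (- {0}))"
    by (intro continuous_open_preimage holomorphic_on_imp_continuous_on riemann_zeta_holomorphic) auto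
  also have "- {1} \<inter> riemann_zeta -` (- {0}) = zeta_regular"
    by (auto simp: zeta_regular_def)
  finally show ?thesis .
qed

lemma zeta_regularI: "Re s \<ge> 1 \<Longrightarrow> s \<noteq> 1 \<Longrightarrow>
    s \<in> zeta_regular"
  using riemann_zeta_nonzero by (auto simp: zeta_regular_def)

text \<open>
Stated for a composition because it is applied to the multiples \<open>k * w\<close>.
\<close>
lemma zeta_log_deriv_holomorphic:
  assumes "f holomorphic_on S" "f ` S \<subseteq> zeta_regular"
  shows "(\<lambda>w. deriv riemann_zeta (f w) / riemann_zeta (f w)) holomorphic_on S"
proof -
  have z: "riemann_zeta holomorphic_on zeta_regular"
    by (rule holomorphic_on_subset[OF riemann_zeta_holomorphic]) (auto simp: zeta_regular_def)
  have "(\<lambda>s. deriv riemann_zeta s / riemann_zeta s) holomorphic_on zeta_regular"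
    by (intro holomorphic_intros holomorphic_deriv z open_zeta_regular) (auto simp: zeta_regular_def)
  from holomorphic_on_compose_gen[OF assms(1) this assms(2)] show ?thesis by (simp add: o_def)
qed

text \<open>
If \<open>Re w > 1/K\<close>, then \<open>k * w\<close> lies in the half-plane of absolute convergence for every \<open>k \<ge> K\<close>. So
only the first few terms can be singular, and the tail of the series is dominated by a geometric
series.
\<close>
lemma prime_zeta_deriv_tail:
  assumes K: "K > 0"
  defines "L \<equiv> \<lambda>k w. of_int (moebius_mu k) * (deriv riemann_zeta (of_nat k
      * w) / riemann_zeta (of_nat k * w))"
  shows "(\<lambda>w. \<Sum>\<^sub>\<infinity>k\<in>{K..}. L k w) holomorphic_on {w. 1 / real K < Re w}"
    and "1 / real K < Re w \<Longrightarrow> prime_zeta_deriv w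
        = (\<Sum>k=1..<K. L k w) + (\<Sum>\<^sub>\<infinity>k\<in>{K..}. L k w)"
proof -
  have big: "Re (of_nat k * w) > 1" if "k \<ge> K" "1 / real K < Re w" for k w
  proof -
    have "1 < real K * Re w" using that(2) K by (simp add: field_simps)
    also have "\<dots> \<le> real k * Re w" 
      using that K order.strict_trans[of 0 "1 / real K" "Re w"] by (intro mult_right_mono) auto
    also have "\<dots> = Re (of_nat k * w)" by simp
    finally show ?thesis .
  qed
  have bd: "\<exists>d>0. \<exists>M. M summable_on {K..} \<and>
      (\<forall>k\<in>{K..}. \<forall>w\<in>ball z d \<inter> {w. 1 / real K < Re w}. norm (L k w)
      \<le> M k)"
    if z: "z \<in> {w. 1 / real K < Re w}" for z
  proof -
    define d where "d = (Re z - 1 / real K) / 2"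
    define \<sigma> where "\<sigma> = (Re z + 1 / real K) / 2"
    define \<tau> where "\<tau> = real K * \<sigma>"
    define S where "S = (\<Sum>\<^sub>\<infinity>n. norm (mangoldt n :: complex)
        * real n powr (-\<tau>))"
    have d: "d > 0" "\<sigma> > 1 / real K" using z by (auto simp: d_def \<sigma>_def)
    then have \<tau>: "\<tau> > 1" and \<sigma>: "\<sigma> > 0"
        using K order.strict_trans[of 0 "1 / real K" \<sigma>]
      by (auto simp: \<tau>_def field_simps)
    have S: "S \<ge> 0" unfolding S_def by (intro infsum_nonneg mult_nonneg_nonneg norm_ge_zero
        powr_ge_zero)
    have "norm (L k w) \<le> 2 powr \<tau> * S * (2 powr (-\<sigma>)) ^ k" if k: "k \<ge> K" and w:
        "w \<in> ball z d" "1 / real K < Re w" for k w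
    proof -
      have "\<bar>Re (z - w)\<bar> < d"
        using w abs_Re_le_cmod[of "z - w"] by (simp add: dist_norm)
      then have "\<sigma> \<le> Re w" by (auto simp: d_def \<sigma>_def field_simps abs_if split:
          if_splits)
      then have "real k * \<sigma> \<le> Re (of_nat k * w)" by (simp add: mult_left_mono)
      moreover have "\<tau> \<le> real k * \<sigma>" using k \<sigma> by (simp add: \<tau>_def)
      ultimately have le: "\<tau> \<le> Re (of_nat k * w)" "\<tau> - Re (of_nat k * w)
          \<le> \<tau> - real k * \<sigma>" by linarith+
      have "norm (L k w) \<le> 1 * norm (dseries mangoldt (of_nat k * w))"
        unfolding L_def norm_mult zeta_log_deriv[OF big[OF k w(2)]] norm_minus_cancel
        by (intro mult_right_mono norm_moebius_mu) auto
      also have "norm (dseries mangoldt (of_nat k * w)) \<le> 2 powr (\<tau> - Re (of_nat k * w)) * S"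
        unfolding S_def using \<tau> le by (intro dseries_norm_bound[OF abs_conv_beyond_mangoldt]) auto
      also have "\<dots> \<le> 2 powr (\<tau> - real k * \<sigma>) * S"
        using le S by (intro mult_right_mono powr_mono) auto
      also have "2 powr (\<tau> - real k * \<sigma>) = 2 powr \<tau> * (2 powr (-\<sigma>)) ^ k"
      proof -
        have "(2 powr (-\<sigma>)) ^ k = 2 powr (- \<sigma> * real k)"
            by (simp add: powr_powr flip: powr_realpow)
        then show ?thesis by (simp flip: powr_add) (simp add: mult.commute)
      qed
      finally show ?thesis by (simp add: mult_ac)
    qed
    moreover have "(\<lambda>k. 2 powr \<tau> * S * (2 powr (-\<sigma>)) ^ k) summable_on {K..}"
    proof (intro summable_on_cmult_right)
      have "2 powr (-\<sigma>) < 1" using powr_less_mono[of "-\<sigma>" 0 2] \<sigma> by simp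
      then have "(\<lambda>k. (2 powr (-\<sigma>)) ^ k) summable_on UNIV"
        by (subst summable_on_UNIV_nonneg_real_iff) (auto intro!: summable_geometric)
      then show "(\<lambda>k. (2 powr (-\<sigma>)) ^ k) summable_on {K..}"
        by (rule summable_on_subset_banach) auto
    qed
    ultimately show ?thesis using d(1)
      by (intro exI[of _ d] conjI exI[of _ "\<lambda>k. 2 powr \<tau> * S
          * (2 powr (-\<sigma>)) ^ k"]) auto
  qed
  have hol: "L k holomorphic_on {w. 1 / real K < Re w}" if k: "k \<in> {K..}" for k
    unfolding L_def
  proof (intro holomorphic_on_mult holomorphic_on_const holomorphic_on_ident zeta_log_deriv_holomorphic)
    show "(*) (of_nat k) ` {w. 1 / real K < Re w} \<subseteq> zeta_regular"
    proof clarify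
      fix w assume w: "1 / real K < Re w"
      from big[OF _ w] k have "Re (of_nat k * w) > 1" by simp
      moreover from this have "of_nat k * w \<noteq> 1" by (metis less_irrefl one_complex.sel(1))
      ultimately show "of_nat k * w \<in> zeta_regular" by (intro zeta_regularI) auto
    qed
  qed
  show "(\<lambda>w. \<Sum>\<^sub>\<infinity>k\<in>{K..}. L k w) holomorphic_on {w. 1 / real K < Re w}"
    by (rule holomorphic_infsum(1)[OF open_halfspace_Re_gt hol bd])
  show "prime_zeta_deriv w = (\<Sum>k=1..<K. L k w) + (\<Sum>\<^sub>\<infinity>k\<in>{K..}. L k w)" if
      w: "1 / real K < Re w"
  proof -
    obtain d M where dM: "d > 0" "M summable_on {K..}"
      "\<forall>k\<in>{K..}. \<forall>w\<in>ball w d \<inter> {w. 1 / real K < Re w}. norm (L k w)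
          \<le> M k"
      using bd[of w] w by auto
    have "(\<lambda>k. norm (L k w)) summable_on {K..}"
      by (rule Infinite_Sum.abs_summable_on_comparison_test'[OF dM(2)]) (use dM(1,3) w in auto)
    then have sm: "(\<lambda>k. L k w) summable_on {K..}" by (rule abs_summable_summable)
    have "{1..} = {1..<K} \<union> {K..}" using K by auto
    then have "prime_zeta_deriv w = (\<Sum>\<^sub>\<infinity>k\<in>{1..<K} \<union> {K..}. L k w)"
      by (simp add: prime_zeta_deriv_def L_def)
    also have "\<dots> = (\<Sum>\<^sub>\<infinity>k\<in>{1..<K}. L k w)
        + (\<Sum>\<^sub>\<infinity>k\<in>{K..}. L k w)"
      using sm by (intro infsum_Un_disjoint) auto
    finally show ?thesis by simp
  qed
qed

text \<open>
Near a point \<open>w\<close> only the finitely many \<open>k < K\<close> with \<open>1/K < Re w\<close> impose a condition. This one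
neighbourhood shows both that the domain is open, so that the branch points do not accumulate inside
it, and that the derivative is holomorphic.
\<close>
lemma prime_zeta_domain_local:
  assumes "w \<in> prime_zeta_domain"
  shows "\<exists>U. open U \<and> w \<in> U \<and> U \<subseteq> prime_zeta_domain \<and>
      prime_zeta_deriv holomorphic_on U"
proof -
  have w: "0 < Re w" "\<And>k. squarefree k \<Longrightarrow> of_nat k * w \<in> zeta_regular"
    using assms by (auto simp: prime_zeta_domain_def)
  obtain K :: nat where K: "K > 0" "1 / real K < Re w"
    using reals_Archimedean[OF w(1)] by (metis inverse_eq_divide zero_less_Suc)
  define A where "A = {k\<in>{1..<K}. squarefree k}"
  define U where "U = {w. 1 / real K < Re w} \<inter> (\<Inter>k\<in>A. (*) (of_nat k) -` zeta_regular)"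
  have "open U" unfolding U_def A_def
    by (intro open_Int open_INT open_halfspace_Re_gt open_vimage open_zeta_regular ballI
        continuous_intros) auto
  moreover have "w \<in> U" using w K by (auto simp: U_def A_def)
  moreover have "U \<subseteq> prime_zeta_domain"
    unfolding prime_zeta_domain_def
  proof (intro subsetI CollectI conjI allI impI)
    fix v and k :: nat assume v: "v \<in> U"
    then have v': "1 / real K < Re v" by (simp add: U_def)
    then show "0 < Re v" using K(1) order.strict_trans[of 0 "1 / real K" "Re v"] by simp
    assume k: "squarefree k"
    show "of_nat k * v \<in> zeta_regular"
    proof (cases "k < K")
      case True
      have "k \<noteq> 0" using k by (metis not_squarefree_0)
      then have "k \<in> A" using True k by (auto simp: A_def)
      then show ?thesis using v by (auto simp: U_def)
    next
      case False
      have "1 < real K * Re v" using v' K(1) by (simp add: field_simps)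
      also have "\<dots> \<le> real k * Re v" using False \<open>0 < Re v\<close> by (intro mult_right_mono) auto
      finally have "1 < Re (of_nat k * v)" by simp
      moreover from this have "of_nat k * v \<noteq> 1" by (metis less_irrefl one_complex.sel(1))
      ultimately show ?thesis by (intro zeta_regularI) auto
    qed
  qed
  moreover have "prime_zeta_deriv holomorphic_on U"
  proof -
    let ?L = "\<lambda>k w. of_int (moebius_mu k) * (deriv riemann_zeta (of_nat k
        * w) / riemann_zeta (of_nat k * w))"
    have "?L k holomorphic_on U" for k
    proof (cases "k \<in> {1..<K} \<and> squarefree k")
      case True
      then show ?thesis
        by (intro holomorphic_on_mult holomorphic_on_const holomorphic_on_ident
            zeta_log_deriv_holomorphic) (auto simp: U_def A_def)
    next
      case False
      show ?thesis
      proof (cases "squarefree k")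
        case True
        with False have "k \<ge> K" by (cases "k = 0") auto
        then show ?thesis
          using \<open>U \<subseteq> prime_zeta_domain\<close> True
          by (intro holomorphic_on_mult holomorphic_on_const holomorphic_on_ident
              zeta_log_deriv_holomorphic) (auto simp: prime_zeta_domain_def)
      qed (simp add: moebius_mu_def)
    qed
    then have "(\<lambda>w. (\<Sum>k=1..<K. ?L k w) + (\<Sum>\<^sub>\<infinity>k\<in>{K..}. ?L k w))
        holomorphic_on U"
      by (intro holomorphic_on_add holomorphic_on_sum holomorphic_on_subset[OF
          prime_zeta_deriv_tail(1)[OF K(1)]])
         (auto simp: U_def)
    also have "?this \<longleftrightarrow> ?thesis"
      by (rule holomorphic_cong) (auto simp: prime_zeta_deriv_tail(2)[OF K(1)] U_def)
    finally show ?thesis .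
  qed
  ultimately show ?thesis by blast
qed

lemma open_prime_zeta_domain: "open prime_zeta_domain"
  using prime_zeta_domain_local open_subopen by (metis (full_types))

lemma prime_zeta_deriv_holomorphic: "prime_zeta_deriv holomorphic_on prime_zeta_domain"
proof -
  have "prime_zeta_deriv field_differentiable at w" if "w \<in> prime_zeta_domain" for w
    using prime_zeta_domain_local[OF that] holomorphic_on_imp_differentiable_at by blast
  then show ?thesis
    unfolding holomorphic_on_def using field_differentiable_at_within by blast
qed

text \<open>
A zero or pole \<open>k * w\<close> of zeta has real part at most 1, and real part 1 only at the pole.
\<close>
lemma prime_zeta_domainI:
  assumes "Re w \<ge> 1" "w \<noteq> 1" shows "w \<in> prime_zeta_domain"
  unfolding prime_zeta_domain_def
proof (intro CollectI conjI allI impI)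
  fix k :: nat assume "squarefree k"
  then have k: "k \<ge> 1" by (cases "k = 0") auto
  have "of_nat k * w \<noteq> 1"
  proof
    assume *: "of_nat k * w = 1"
    then have "real k * Re w = 1" by (metis Re_complex_of_real complex_Re_of_nat Im_complex_of_real
        mult_zero_left diff_zero of_real_of_nat_eq one_complex.sel(1) times_complex.sel(1))
    moreover have "real k * 1 \<le> real k * Re w" using assms by (intro mult_left_mono) auto
    ultimately have "k = 1" using k by simp
    with * assms(2) show False by simp
  qed
  moreover have "1 * 1 \<le> real k * Re w" using assms k by (intro mult_mono) auto
  ultimately show "of_nat k * w \<in> zeta_regular" by (intro zeta_regularI) auto
qed (use assms in auto)

text \<open>
Only the term \<open>k = 1\<close> is singular at 1, with the pole of \<open>\<zeta>'/\<zeta>\<close>.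
\<close>
lemma prime_zeta_deriv_near_1:
  "\<exists>e>0. \<exists>h. h holomorphic_on ball 1 e \<and>
     (\<forall>w\<in>ball 1 e - {1}. prime_zeta_deriv w = h w - 1 / (w - 1))"
proof -
  obtain e h where eh: "e > 0" "h holomorphic_on ball 1 e"
    "\<And>s. s\<in>ball 1 e - {1} \<Longrightarrow> deriv riemann_zeta s / riemann_zeta s
        = h s - 1 / (s - 1)"
    using zeta_log_deriv_near_1 by blast
  define d where "d = min e (1/2)"
  define T where "T = (\<lambda>w. \<Sum>\<^sub>\<infinity>k\<in>{2..}. of_int (moebius_mu k)
      * (deriv riemann_zeta (of_nat k * w) / riemann_zeta (of_nat k * w)))"
  have half: "1 / real 2 < Re w" if "w \<in> ball 1 d" for w
    using that abs_Re_le_cmod[of "1 - w"] by (auto simp: d_def dist_norm)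
  have "(\<lambda>w. h w + T w) holomorphic_on ball 1 d"
    unfolding T_def using half
    by (intro holomorphic_on_add holomorphic_on_subset[OF eh(2)] holomorphic_on_subset[OF
        prime_zeta_deriv_tail(1)]) (auto simp: d_def)
  moreover have "prime_zeta_deriv w = (h w + T w) - 1 / (w - 1)" if "w \<in> ball 1 d - {1}" for w
  proof -
    have "{1..<2} = {1::nat}" by auto
    then have "prime_zeta_deriv w = deriv riemann_zeta w / riemann_zeta w + T w"
      using prime_zeta_deriv_tail(2)[of 2 w] half[of w] that by (simp add: T_def moebius_mu_def)
    then show ?thesis using eh(3)[of w] that by (simp add: d_def)
  qed
  moreover have "d > 0" using eh(1) by (simp add: d_def)
  ultimately show ?thesis by blast
qed

section \<open>Counting the compositions\<close>

abbreviation flag_types :: "nat \<Rightarrow> nat \<Rightarrow> nat list set" where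
  "flag_types n N \<equiv> {l :: nat list. length l = N \<and> (\<forall>x\<in>set l. 0 < x) \<and>
      sum_list l = n \<and>
                          min (l ! 0) (l ! 1) < p1 (l ! 0 + l ! 1)}"

lemma finite_flag_types: "finite (flag_types n N)"
proof (rule finite_subset)
  show "flag_types n N \<subseteq> {l. set l \<subseteq> {..n} \<and> length l = N}"
    using member_le_sum_list by fastforce
  show "finite {l. set l \<subseteq> {..n} \<and> length l = N}" by (rule finite_lists_length_eq) simp
qed

text \<open>
Dropping the last part of a composition leaves its first two parts unchanged as long as at least two
parts remain.
\<close>
lemma flag_count_Suc_Suc:
  assumes "N \<ge> 2"
  shows "flag_count (Suc n) (Suc N) = (\<Sum>k\<le>n. flag_count k N)"
proof -
  have "bij_betw (\<lambda>(k, l). l @ [Suc n - k]) (SIGMA k:{..n}. flag_types k N) (flag_types (Suc n)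
      (Suc N))"
  proof (rule bij_betwI[where g = "\<lambda>l. (sum_list (butlast l), butlast l)"])
    show "(\<lambda>(k, l). l @ [Suc n - k]) \<in> (SIGMA k:{..n}. flag_types k N) \<rightarrow>
        flag_types (Suc n) (Suc N)"
      using assms by (auto simp: nth_append)
    show "(\<lambda>l. (sum_list (butlast l), butlast l)) \<in> flag_types (Suc n) (Suc N) \<rightarrow>
        (SIGMA k:{..n}. flag_types k N)"
    proof (rule funcsetI)
      fix l assume l: "l \<in> flag_types (Suc n) (Suc N)"
      then obtain l' x where lx: "l = l' @ [x]" by (cases l rule: rev_cases) auto
      show "(sum_list (butlast l), butlast l) \<in> (SIGMA k:{..n}. flag_types k N)"
      proof -
        have "length l' \<ge> 2" using l assms by (simp add: lx)
        then have "(l' @ [x]) ! 0 = l' ! 0" "(l' @ [x]) ! 1 = l' ! 1" by (auto simp: nth_append)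
        then show ?thesis using l by (auto simp: lx)
      qed
    qed
  next
    fix l assume l: "l \<in> flag_types (Suc n) (Suc N)"
    then obtain l' x where lx: "l = l' @ [x]" by (cases l rule: rev_cases) auto
    show "(case (sum_list (butlast l), butlast l) of (k, l) \<Rightarrow> l @ [Suc n - k]) = l"
      using l by (auto simp: lx)
  qed auto
  then have "flag_count (Suc n) (Suc N) = card (SIGMA k:{..n}. flag_types k N)"
    unfolding flag_count_def by (simp add: bij_betw_same_card)
  also have "\<dots> = (\<Sum>k\<le>n. flag_count k N)"
    unfolding flag_count_def using finite_flag_types by (subst card_SigmaI) auto
  finally show ?thesis .
qed

lemma flag_count_eq_0:
  assumes "n < N" shows "flag_count n N = 0"
proof -
  have "length l \<le> sum_list l" if "\<forall>x\<in>set l. 0 < x" for l :: "nat list"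
    using that by (induction l) auto
  then have "flag_types n N = {}" using assms by fastforce
  then show ?thesis unfolding flag_count_def by (metis card.empty)
qed

lemma flag_count_2: "flag_count n 2 = card {a\<in>{1..<n}. min a (n - a) < p1 n}"
proof -
  have "bij_betw (\<lambda>a. [a, n - a]) {a\<in>{1..<n}. min a (n - a) < p1 n} (flag_types n 2)"
  proof (rule bij_betwI[where g = "\<lambda>l. l ! 0"])
    show "(\<lambda>l. l ! 0) \<in> flag_types n 2 \<rightarrow> {a\<in>{1..<n}. min a (n - a) < p1 n}"
      by (auto simp: length_Suc_conv numeral_2_eq_2)
    show "[l ! 0, n - l ! 0] = l" if "l \<in> flag_types n 2" for l
      using that by (auto simp: length_Suc_conv numeral_2_eq_2)
  qed auto
  then show ?thesis unfolding flag_count_def by (simp add: bij_betw_same_card)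
qed

lemma flag_count_2_le: "flag_count n 2 \<le> n"
proof -
  have "card {a\<in>{1..<n}. min a (n - a) < p1 n} \<le> card {1..<n}"
    by (rule card_mono) auto
  then show ?thesis by (simp add: flag_count_2)
qed

lemma p1_properties:
  assumes "n > 1"
  shows "prime (p1 n)" "p1 n dvd n" "prime q \<Longrightarrow> q dvd n \<Longrightarrow> p1 n \<le> q"
proof -
  obtain r where "prime r" "r dvd n" using assms prime_factor_nat by (metis nat_neq_iff)
  then have "prime (p1 n) \<and> p1 n dvd n"
    unfolding p1_def by (intro LeastI[of "\<lambda>p. prime p \<and> p dvd n"]) simp
  then show "prime (p1 n)" "p1 n dvd n" by auto
  show "prime q \<Longrightarrow> q dvd n \<Longrightarrow> p1 n \<le> q"
    unfolding p1_def by (rule Least_le) simp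
qed

lemma flag_count_2_prime:
  assumes "prime n" shows "flag_count n 2 = n - 1"
proof -
  have "n > 1" using assms by (rule prime_gt_1_nat)
  have "p1 n = n"
    using p1_properties[OF \<open>n > 1\<close>] assms by (metis prime_nat_iff not_prime_1)
  then have "{a\<in>{1..<n}. min a (n - a) < p1 n} = {1..<n}" by auto
  then show ?thesis by (simp add: flag_count_2)
qed

lemma flag_count_2_pos: "n > 1 \<Longrightarrow> flag_count n 2 > 0"
proof -
  assume n: "n > 1"
  have "1 \<in> {a\<in>{1..<n}. min a (n - a) < p1 n}"
    using p1_properties(1)[OF n] prime_gt_1_nat[of "p1 n"] n by auto
  then show ?thesis unfolding flag_count_2 by (subst card_gt_0_iff) auto
qed

text \<open>
The smaller part is below the least prime divisor \<open>p\<close>, which leaves at most \<open>2p\<close> choices, and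
\<open>p\<^sup>2 \<le> n\<close> for composite \<open>n\<close>.
\<close>
lemma flag_count_2_composite:
  assumes "n > 1" "\<not> prime n" shows "real (flag_count n 2) \<le> 2 * sqrt (real n)"
proof -
  define p where "p = p1 n"
  have p: "prime p" "p dvd n" using p1_properties[OF assms(1)] by (auto simp: p_def)
  then obtain m where m: "n = p * m" by auto
  have "m > 1"
  proof (rule ccontr)
    assume "\<not> m > 1"
    then have "m = 0 \<or> m = 1" by linarith
    with m assms p(1) show False by auto
  qed
  then have "prime (p1 m)" "p1 m dvd m" using p1_properties by auto
  then have "p \<le> p1 m" unfolding p_def
    by (intro p1_properties(3)[OF assms(1)]) (auto simp: m)
  also have "p1 m \<le> m" using \<open>p1 m dvd m\<close> \<open>m > 1\<close> by (intro dvd_imp_le) auto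
  finally have "p * p \<le> n" by (simp add: m)
  then have "p\<^sup>2 \<le> n" by (simp add: power2_eq_square)
  then have "real p ^ 2 \<le> real n" by (metis of_nat_le_iff of_nat_power)
  then have sq: "real p \<le> sqrt (real n)" by (rule real_le_rsqrt)
  have "{a\<in>{1..<n}. min a (n - a) < p} \<subseteq> {..<p} \<union> (\<lambda>a. n - a) ` {..<p}"
  proof
    fix a assume a: "a \<in> {a\<in>{1..<n}. min a (n - a) < p}"
    show "a \<in> {..<p} \<union> (\<lambda>a. n - a) ` {..<p}"
    proof (cases "a < p")
      case False
      then have "n - a \<in> {..<p}" "a = n - (n - a)" using a by auto
      then show ?thesis by blast
    qed auto
  qed
  then have "flag_count n 2 \<le> card ({..<p} \<union> (\<lambda>a. n - a) ` {..<p})"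
    unfolding flag_count_2 p_def[symmetric] by (intro card_mono) auto
  also have "\<dots> \<le> card {..<p} + card ((\<lambda>a. n - a) ` {..<p})" by (rule card_Un_le)
  also have "\<dots> \<le> p + p" using card_image_le[of "{..<p}" "\<lambda>a. n - a"] by simp
  finally show ?thesis using sq by linarith
qed

lemma flag_count_le:
  assumes "N \<ge> 2" shows "flag_count n N \<le> n ^ (N - 1)"
  using assms
proof (induction N arbitrary: n rule: dec_induct)
  case base
  then show ?case by (simp add: flag_count_2_le)
next
  case (step N)
  show ?case
  proof (cases n)
    case 0
    then show ?thesis by (simp add: flag_count_eq_0)
  next
    case (Suc m)
    have "flag_count (Suc m) (Suc N) = (\<Sum>k\<le>m. flag_count k N)"
      using step by (intro flag_count_Suc_Suc) auto
    also have "\<dots> \<le> (\<Sum>k\<le>m. Suc m ^ (N - 1))"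
      by (intro sum_mono order_trans[OF step.IH] power_mono) auto
    also have "\<dots> = Suc m ^ Suc (N - 1)" by simp
    finally show ?thesis using Suc step.hyps by simp
  qed
qed

definition flag_coeff :: "nat \<Rightarrow> nat \<Rightarrow> complex" where
  "flag_coeff N n = of_nat (flag_count n N)"

lemma abs_conv_beyond_flag_coeff:
  assumes "N \<ge> 2" shows "abs_conv_beyond (flag_coeff N) (real N)"
proof -
  have "abs_conv_beyond (flag_coeff N) (real (N - 1) + 1)"
  proof (rule abs_conv_beyond_poly)
    fix n :: nat assume "n > 0"
    have "real (flag_count n N) \<le> real (n ^ (N - 1))" using flag_count_le[OF assms] of_nat_le_iff
        by blast
    then show "norm (flag_coeff N n) \<le> 1 * real n powr real (N - 1)"
      using \<open>n > 0\<close> by (simp add: flag_coeff_def powr_realpow)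
  qed
  then show ?thesis using assms by (simp add: of_nat_diff)
qed

lemma dirichlet_flag_eq_dseries: "dirichlet_flag N s = dseries (flag_coeff N) s"
  unfolding dirichlet_flag_def dseries_def flag_coeff_def
  by (rule infsum_cong_neutral) (auto simp: flag_count_eq_0)

definition composite_sum :: "nat \<Rightarrow> nat" where
  "composite_sum n = (\<Sum>k | k \<le> n \<and> 1 < k \<and> \<not> prime k. flag_count k 2)"

text \<open>
The source of the bound \<open>3/2\<close> for \<open>sigma_bar\<close>: at most \<open>n\<close> terms of size at most \<open>2\<surd>n\<close>.
\<close>
lemma composite_sum_upper: "real (composite_sum n) \<le> 2 * real n * sqrt (real n)"
proof -
  have "real (composite_sum n) \<le> (\<Sum>k | k \<le> n \<and> 1 < k \<and>
      \<not> prime k. 2 * sqrt (real n))"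
    unfolding composite_sum_def of_nat_sum
  proof (rule sum_mono)
    fix k assume "k \<in> {k. k \<le> n \<and> 1 < k \<and> \<not> prime k}"
    then have "real (flag_count k 2) \<le> 2 * sqrt (real k)" "k \<le> n"
        by (auto intro: flag_count_2_composite)
    then show "real (flag_count k 2) \<le> 2 * sqrt (real n)"
      by (meson mult_left_mono of_nat_mono order_trans real_sqrt_le_mono zero_le_numeral)
  qed
  also have "\<dots> = real (card {k. k \<le> n \<and> 1 < k \<and>
      \<not> prime k}) * (2 * sqrt (real n))" by simp
  also have "\<dots> \<le> real n * (2 * sqrt (real n))"
  proof (intro mult_right_mono)
    have "card {k. k \<le> n \<and> 1 < k \<and> \<not> prime k} \<le> card {1..n}"
        by (rule card_mono) auto
    then show "real (card {k. k \<le> n \<and> 1 < k \<and> \<not> prime k}) \<le> real n" by simp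
  qed auto
  finally show ?thesis by (simp add: mult_ac)
qed

text \<open>
The source of the bound 1 for \<open>sigma_bar\<close>: every even number from 4 on is composite and contributes
at least 1.
\<close>
lemma composite_sum_lower: "n div 2 - 1 \<le> composite_sum n"
proof -
  have "n div 2 - 1 = card ((\<lambda>j. 2 * j) ` {2..n div 2})"
    by (subst card_image) (auto simp: inj_on_def)
  also have "\<dots> \<le> card {k. k \<le> n \<and> 1 < k \<and> \<not> prime k}"
  proof (rule card_mono)
    show "(\<lambda>j. 2 * j) ` {2..n div 2} \<subseteq> {k. k \<le> n \<and> 1 < k \<and>
        \<not> prime k}"
    proof
      fix k assume "k \<in> (\<lambda>j. 2 * j) ` {2..n div 2}"
      then obtain j where j: "k = 2 * j" "2 \<le> j" "j \<le> n div 2" by auto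
      then have "\<not> prime k" using prime_product[of 2 j] by auto
      then show "k \<in> {k. k \<le> n \<and> 1 < k \<and> \<not> prime k}" using j by auto
    qed
  qed auto
  also have "\<dots> = (\<Sum>k | k \<le> n \<and> 1 < k \<and> \<not> prime k. 1)" by simp
  also have "\<dots> \<le> composite_sum n"
    unfolding composite_sum_def by (rule sum_mono) (simp add: Suc_le_eq flag_count_2_pos)
  finally show ?thesis .
qed

text \<open>
Both bounds matter. The lower one keeps the domain of the theorem inside \<open>Re s > N - 1\<close>, where all
correction terms are holomorphic; the upper one, through \<open>3/2 < 2\<close>, puts the line \<open>Re s = N\<close> inside
that domain.
\<close>
lemma sigma_bar_bounds: "\<exists>\<sigma>. sigma_bar = ereal \<sigma> \<and> 1 \<le> \<sigma> \<and>
    \<sigma> \<le> 3 / 2"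
proof -
  have bounds: "real n / 4 \<le> real (composite_sum n)" "real (composite_sum n)
      \<le> 2 * real n powr (3/2)" if "n \<ge> 6" for n
  proof -
    have "real n / 4 \<le> real (n div 2 - 1)" using that by linarith
    also have "\<dots> \<le> real (composite_sum n)" using composite_sum_lower of_nat_le_iff by blast
    finally show "real n / 4 \<le> real (composite_sum n)" .
    have "real n powr (3/2) = real n powr (1 + 1/2)" by simp
    also have "\<dots> = real n * sqrt (real n)" using that unfolding powr_add
        by (simp add: powr_half_sqrt)
    finally show "real (composite_sum n) \<le> 2 * real n powr (3/2)" using composite_sum_upper[of n]
        by (simp add: mult_ac)
  qed
  have "(\<lambda>n. ereal (1 / ln (real n) * ln (real n / 4))) \<longlonglongrightarrow> ereal 1"
    by (intro tendsto_ereal) real_asymp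
  then have "ereal 1 = limsup (\<lambda>n. ereal (1 / ln (real n) * ln (real n / 4)))"
    by (rule lim_imp_Limsup[OF sequentially_bot, symmetric])
  also have "\<dots> \<le> sigma_bar"
    unfolding sigma_bar_def composite_sum_def[symmetric]
  proof (rule Limsup_mono, rule eventually_sequentiallyI[of 6])
    fix n :: nat assume n: "6 \<le> n"
    show "ereal (1 / ln (real n) * ln (real n / 4)) \<le> ereal (1 / ln (real n)
        * ln (real (composite_sum n)))"
      using bounds[OF n] n by (auto intro!: mult_left_mono ln_mono divide_right_mono)
  qed
  finally have 1: "ereal 1 \<le> sigma_bar" .
  have "sigma_bar \<le> limsup (\<lambda>n. ereal (1 / ln (real n) * ln (2 * real n powr (3/2))))"
    unfolding sigma_bar_def composite_sum_def[symmetric]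
  proof (rule Limsup_mono, rule eventually_sequentiallyI[of 6])
    fix n :: nat assume n: "6 \<le> n"
    then have "0 < real (composite_sum n)" using bounds(1)[OF n] by linarith
    then show "ereal (1 / ln (real n) * ln (real (composite_sum n)))
        \<le> ereal (1 / ln (real n) * ln (2 * real n powr (3/2)))"
      using bounds[OF n] n by (auto intro!: mult_left_mono ln_mono divide_right_mono)
  qed
  also have "(\<lambda>n. ereal (1 / ln (real n) * ln (2 * real n powr (3/2))))
      \<longlonglongrightarrow> ereal (3/2)"
    by (intro tendsto_ereal) real_asymp
  then have "limsup (\<lambda>n. ereal (1 / ln (real n) * ln (2 * real n powr (3/2)))) = ereal (3/2)"
    by (rule lim_imp_Limsup[OF sequentially_bot])
  finally have 2: "sigma_bar \<le> ereal (3/2)" .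
  have "\<exists>\<sigma>. x = ereal \<sigma> \<and> 1 \<le> \<sigma> \<and> \<sigma> \<le> 3 / 2"
      if "ereal 1 \<le> x" "x \<le> ereal (3/2)" for x
    using that by (cases x) auto
  from this[OF 1 2] show ?thesis .
qed

section \<open>Reduction of the flag series to the prime zeta function\<close>

text \<open>
Summation by parts: with the partial sums \<open>A n\<close> of the absolute values, the sum of \<open>norm (a k)\<close>
times \<open>k^(-\<sigma>)\<close> becomes a sum of \<open>A k\<close> times \<open>k^(-\<sigma>) - (k+1)^(-\<sigma>)\<close>. The difference is at most
\<open>\<sigma> k^(-\<sigma>-1)\<close>, so a bound \<open>A k \<le> k^\<tau>\<close> with \<open>\<tau> < \<sigma>\<close> gives convergence.
\<close>
lemma abs_conv_beyond_partial_sums: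
  assumes c: "0 \<le> c" and S: "\<And>\<tau>. \<tau> > c \<Longrightarrow>
      eventually (\<lambda>n. (\<Sum>k\<le>n. norm (a k)) \<le> real n powr \<tau>) sequentially"
  shows "abs_conv_beyond a c"
  unfolding abs_conv_beyond_def
proof (intro allI impI)
  fix \<sigma> assume \<sigma>: "\<sigma> > c"
  define \<tau> where "\<tau> = (c + \<sigma>) / 2"
  have \<tau>: "c < \<tau>" "\<tau> < \<sigma>" "0 < \<tau>" "0 < \<sigma>" using \<sigma> c
      by (auto simp: \<tau>_def)
  define A where "A = (\<lambda>n. \<Sum>k\<le>n. norm (a k))"
  define u where "u = (\<lambda>n::nat. real n powr (-\<sigma>))"
  have A0: "A n \<ge> 0" for n unfolding A_def by (intro sum_nonneg) auto
  obtain n0 where n0: "\<And>n. n \<ge> n0 \<Longrightarrow> A n \<le> real n powr \<tau>"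
    using S[OF \<tau>(1)] unfolding A_def eventually_sequentially by blast
  \<comment> \<open>Enlarging the constant extends the eventual bound to all \<open>n > 0\<close>.\<close>
  define C where "C = A n0 + 1"
  have C: "A n \<le> C * real n powr \<tau>" if n: "n > 0" for n
  proof -
    have n1: "real n powr \<tau> \<ge> 1" using n \<tau> by (intro ge_one_powr_ge_zero) auto
    show ?thesis
    proof (cases "n \<ge> n0")
      case True
      have "A n \<le> 1 * real n powr \<tau>" using n0[OF True] by simp
      also have "\<dots> \<le> C * real n powr \<tau>" using A0[of n0]
          by (intro mult_right_mono) (auto simp: C_def)
      finally show ?thesis .
    next
      case False
      have "A n \<le> A n0" unfolding A_def using False by (intro sum_mono2) auto
      also have "\<dots> \<le> C * 1" by (simp add: C_def)
      also have "\<dots> \<le> C * real n powr \<tau>" using n1 A0[of n0]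
          by (intro mult_left_mono) (auto simp: C_def)
      finally show ?thesis .
    qed
  qed
  have C0: "C > 0" using A0[of n0] by (simp add: C_def)
  have du: "u n - u (Suc n) \<le> \<sigma> * real n powr (-\<sigma> - 1)" "u n \<ge> u (Suc n)" if n:
      "n > 0" for n
  proof -
    have "\<exists>z. real n < z \<and> z < real (Suc n) \<and>
        real (Suc n) powr (-\<sigma>) - real n powr (-\<sigma>)
        = (real (Suc n) - real n) * (-\<sigma> * z powr (-\<sigma> - 1))"
    proof (rule MVT2)
      fix x assume "real n \<le> x"
      then show "((\<lambda>x. x powr (-\<sigma>)) has_real_derivative (-\<sigma>
          * x powr (-\<sigma> - 1))) (at x)"
        using n by (auto intro!: derivative_eq_intros)
    qed auto
    then obtain z where z: "real n < z" "u n - u (Suc n) = \<sigma> * z powr (-\<sigma> - 1)"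
      unfolding u_def by auto
    show "u n - u (Suc n) \<le> \<sigma> * real n powr (-\<sigma> - 1)"
      unfolding z(2) using z(1) n \<tau> by (intro mult_left_mono powr_mono2') auto
    have "0 \<le> \<sigma> * z powr (-\<sigma> - 1)" using \<tau> by simp
    then show "u n \<ge> u (Suc n)" using z(2) by linarith
  qed
  have parts: "(\<Sum>k\<le>n. norm (a k) * u k) = A n * u (Suc n)
      + (\<Sum>k\<le>n. A k * (u k - u (Suc k)))" for n
    by (induction n) (auto simp: A_def algebra_simps)
  have sm: "(\<lambda>k. C * \<sigma> * real k powr (-(\<sigma> + 1 - \<tau>))) summable_on UNIV"
    using \<tau> by (intro summable_on_cmult_right summable_on_powr) auto
  define M where "M = (\<Sum>\<^sub>\<infinity>k. C * \<sigma> * real k powr (-(\<sigma>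
      + 1 - \<tau>)))"
  have bound: "(\<Sum>k\<le>n. norm (a k) * u k) \<le> C + M" for n
  proof -
    have "A n * u (Suc n) \<le> C"
    proof (cases "n = 0")
      case True
      have "A 0 \<le> A n0" unfolding A_def by (intro sum_mono2) auto
      then show ?thesis using True by (simp add: u_def C_def)
    next
      case False
      then have "A n * u (Suc n) \<le> (C * real n powr \<tau>) * real n powr (-\<tau>)"
      proof (intro mult_mono)
        have "u (Suc n) \<le> u n" using du False by simp
        also have "\<dots> \<le> real n powr (-\<tau>)" unfolding u_def using \<tau>
            by (intro powr_neg_mono) auto
        finally show "u (Suc n) \<le> real n powr (-\<tau>)" .
      qed (use C C0 in \<open>auto simp: u_def\<close>)
      also have "\<dots> = C" using False by (simp add: mult.assoc flip: powr_add)
      finally show ?thesis .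
    qed
    moreover have "(\<Sum>k\<le>n. A k * (u k - u (Suc k)))
        \<le> (\<Sum>k\<le>n. C * \<sigma> * real k powr (-(\<sigma> + 1 - \<tau>)))"
    proof (rule sum_mono)
      fix k assume "k \<in> {..n}"
      show "A k * (u k - u (Suc k)) \<le> C * \<sigma> * real k powr (-(\<sigma> + 1 - \<tau>))"
      proof (cases "k = 0")
        case True
        then show ?thesis using A0[of 0] by (simp add: u_def mult_nonneg_nonpos)
      next
        case False
        then have "A k * (u k - u (Suc k)) \<le> (C * real k powr \<tau>) * (\<sigma>
            * real k powr (-\<sigma> - 1))"
          using C du C0 by (intro mult_mono) auto
        also have "\<dots> = C * \<sigma> * real k powr (-(\<sigma> + 1 - \<tau>))"
        proof -
          have "real k powr \<tau> * real k powr (-\<sigma> - 1)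
              = real k powr (-(\<sigma> + 1 - \<tau>))"
            by (simp add: algebra_simps flip: powr_add)
          then show ?thesis by (simp only: mult_ac)
        qed
        finally show ?thesis .
      qed
    qed
    moreover have "(\<Sum>k\<le>n. C * \<sigma> * real k powr (-(\<sigma> + 1 - \<tau>))) \<le> M"
      unfolding M_def using C0 \<tau> by (intro finite_sum_le_infsum sm) auto
    ultimately show ?thesis unfolding parts by linarith
  qed
  have "summable (\<lambda>k. norm (a k) * u k)"
    by (rule bounded_imp_summable[where B = "C + M"]) (use bound in \<open>auto simp: u_def\<close>)
  then show "(\<lambda>n. norm (a n) * real n powr (-\<sigma>)) summable_on UNIV"
    unfolding u_def by (subst summable_on_UNIV_nonneg_real_iff) auto
qed

definition composite_coeff :: "nat \<Rightarrow> complex" where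
  "composite_coeff n = (if prime n then 0 else of_nat (flag_count n 2))"

text \<open>
The \<open>limsup\<close> that defines \<open>sigma_bar\<close> bounds the partial sums by \<open>n powr \<tau>\<close> for every \<open>\<tau>\<close> above it.
\<close>
lemma abs_conv_beyond_composite_coeff:
  assumes "sigma_bar = ereal \<sigma>"
  shows "abs_conv_beyond composite_coeff \<sigma>"
proof (rule abs_conv_beyond_partial_sums)
  obtain \<sigma>' where "sigma_bar = ereal \<sigma>'" "1 \<le> \<sigma>'" using sigma_bar_bounds
      by blast
  then have "\<sigma>' = \<sigma>" using assms by (metis ereal.inject)
  then show "0 \<le> \<sigma>" using \<open>1 \<le> \<sigma>'\<close> by simp
  fix \<tau> assume "\<tau> > \<sigma>"
  then have "limsup (\<lambda>n. ereal (1 / ln (real n) * ln (real (composite_sum n)))) < ereal \<tau>"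
    using assms by (simp add: sigma_bar_def composite_sum_def)
  then have "eventually (\<lambda>n. ereal (1 / ln (real n)
      * ln (real (composite_sum n))) < ereal \<tau>) sequentially"
    by (rule Limsup_lessD)
  then show "eventually (\<lambda>n. (\<Sum>k\<le>n. norm (composite_coeff k))
      \<le> real n powr \<tau>) sequentially"
    using eventually_gt_at_top[of 1]
  proof eventually_elim
    case (elim n)
    have "(\<Sum>k\<le>n. norm (composite_coeff k)) = (\<Sum>k | k \<le> n \<and> 1 < k \<and>
        \<not> prime k. real (flag_count k 2))"
    proof (rule sum.mono_neutral_cong_right)
      show "\<forall>k\<in>{..n} - {k. k \<le> n \<and> 1 < k \<and>
          \<not> prime k}. norm (composite_coeff k) = 0"
        by (auto simp: composite_coeff_def flag_count_eq_0)
    qed (auto simp: composite_coeff_def)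
    also have "\<dots> = real (composite_sum n)" by (simp add: composite_sum_def)
    also have "\<dots> \<le> real n powr \<tau>"
    proof (cases "composite_sum n = 0")
      case False
      have "ln (real (composite_sum n)) \<le> \<tau> * ln (real n)"
        using elim by (simp add: field_simps)
      then have "exp (ln (real (composite_sum n))) \<le> exp (\<tau> * ln (real n))" by simp
      then show ?thesis using False elim(2) by (simp add: powr_def)
    qed auto
    finally show ?case .
  qed
qed

text \<open>
For a prime \<open>n\<close> the coefficient is \<open>n - 1\<close>, and the factor \<open>n\<close> shifts the argument by one.
\<close>
lemma flag_series_two_steps:
  assumes \<sigma>: "sigma_bar = ereal \<sigma>" and s: "Re s > 2"
  shows "dirichlet_flag 2 s = dseries prime_ind (s - 1) - dseries prime_ind s
      + dseries composite_coeff s"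
proof -
  obtain \<sigma>' where "sigma_bar = ereal \<sigma>'" "\<sigma>' \<le> 3 / 2" using sigma_bar_bounds
      by blast
  then have "\<sigma>' = \<sigma>" using \<sigma> by (metis ereal.inject)
  then have le: "\<sigma> \<le> 3 / 2" using \<open>\<sigma>' \<le> 3 / 2\<close> by simp
  have "((\<lambda>n. prime_ind n * of_nat n powr (- (s - 1)) + (- (prime_ind n * of_nat n powr (- s)))
      + composite_coeff n * of_nat n powr (- s))
     has_sum dseries prime_ind (s - 1) + (- dseries prime_ind s) + dseries composite_coeff s) UNIV"
  proof (intro has_sum_add)
    have "((\<lambda>n. prime_ind n * of_nat n powr (- s)) has_sum dseries prime_ind s) UNIV"
      using s by (intro dseries_has_sum[OF abs_conv_beyond_prime_ind]) simp
    then show "((\<lambda>n. - (prime_ind n * of_nat n powr (- s))) has_sum - dseries prime_ind s) UNIV"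
      by (simp add: has_sum_uminus)
    show "((\<lambda>n. prime_ind n * of_nat n powr (- (s - 1)))
        has_sum dseries prime_ind (s - 1)) UNIV"
      using s by (intro dseries_has_sum[OF abs_conv_beyond_prime_ind]) simp
    show "((\<lambda>n. composite_coeff n * of_nat n powr (- s))
        has_sum dseries composite_coeff s) UNIV"
      using s le by (intro dseries_has_sum[OF abs_conv_beyond_composite_coeff[OF \<sigma>]]) simp
  qed
  also have "(\<lambda>n. prime_ind n * of_nat n powr (- (s - 1))
      + (- (prime_ind n * of_nat n powr (- s))) + composite_coeff n * of_nat n powr (- s))
     = (\<lambda>n. flag_coeff 2 n * of_nat n powr (- s))"
  proof
    fix n
    show "prime_ind n * of_nat n powr (- (s - 1)) + (- (prime_ind n * of_nat n powr (- s)))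
        + composite_coeff n * of_nat n powr (- s)
       = flag_coeff 2 n * of_nat n powr (- s)"
    proof (cases "prime n")
      case True
      then have "n > 0" by (rule prime_gt_0_nat)
      have "of_nat n powr (- (s - 1)) = of_nat n powr (1 + (- s))" by simp
      also have "\<dots> = of_nat n * of_nat n powr (- s)" using \<open>n > 0\<close> by (simp only: powr_add) simp
      finally show ?thesis using True \<open>n > 0\<close>
        by (simp add: prime_ind_def composite_coeff_def flag_coeff_def flag_count_2_prime of_nat_diff
            algebra_simps)
    qed (simp add: prime_ind_def composite_coeff_def flag_coeff_def)
  qed
  finally show ?thesis unfolding dirichlet_flag_eq_dseries dseries_def[of "flag_coeff 2"]
    by (simp add: infsumI)
qed

text \<open>
With \<open>B n = A(n+1, N+1)\<close>, the sum of \<open>A(k,N)\<close> over \<open>k \<le> n\<close>, exchanging the order of summation gives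
\<open>D\<^sub>N(s - 1) = \<Sum>\<^sub>n B n (n^(1-s) - (n+1)^(1-s))\<close>. Replacing the difference by \<open>(s - 1)(n+1)^(-s)\<close>
produces \<open>(s - 1) D\<^bsub>N+1\<^esub>(s)\<close>, and the error \<open>T n s\<close> is smaller by a factor \<open>n\<close>, which is why \<open>R\<close> is
holomorphic one unit further to the left.
\<close>
lemma flag_series_recursion:
  assumes N: "N \<ge> 2"
  shows "\<exists>R. R holomorphic_on {s. real N < Re s} \<and>
     (\<forall>s. real (Suc N) < Re s \<longrightarrow> (s - 1) * dirichlet_flag (Suc N) s
         = dirichlet_flag N (s - 1) - R s)"
proof -
  define B where "B = (\<lambda>n. of_nat (flag_count (Suc n) (Suc N)) :: complex)"
  \<comment> \<open>The first remainder expands at \<open>n\<close>; the second moves the linear term from \<open>n\<close> to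
     \<open>n + 1\<close>.\<close>
  define T where "T = (\<lambda>n s. powr_taylor_rest 1 n s + (s - 1) * powr_taylor_rest 0 n (s + 1))"
  have T: "T n s = of_nat n powr (1 - s) - of_nat (Suc n) powr (1 - s)
      - (s - 1) * of_nat (Suc n) powr (- s)" for n s
    by (simp add: T_def powr_taylor_rest_def algebra_simps)
  have nB: "norm (B n) \<le> 2 ^ N * real n powr real N" if "n > 0" for n
  proof -
    have "flag_count (Suc n) (Suc N) \<le> Suc n ^ N" using flag_count_le[of "Suc N" "Suc n"] N by simp
    also have "\<dots> \<le> (2 * n) ^ N" using that by (intro power_mono) auto
    finally have "real (flag_count (Suc n) (Suc N)) \<le> real ((2 * n) ^ N)" using of_nat_le_iff
        by blast
    then show ?thesis using that by (simp add: B_def power_mult_distrib powr_realpow)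
  qed
  have convB: "abs_conv_beyond B (real N + 1)" by (rule abs_conv_beyond_poly[OF nB])
  \<comment> \<open>Moving a factor \<open>n\<close> from the coefficients to the kernel exploits the extra decay
     of \<open>T\<close>.\<close>
  define B' where "B' = (\<lambda>n. B n / of_nat n)"
  have convB': "abs_conv_beyond B' (real N)"
  proof -
    have "abs_conv_beyond B' ((real N - 1) + 1)"
    proof (rule abs_conv_beyond_poly)
      fix n :: nat assume n: "n > 0"
      have "norm (B' n) = norm (B n) / real n" by (simp add: B'_def norm_divide)
      also have "\<dots> \<le> (2 ^ N * real n powr real N) / real n" using nB[OF n]
          by (rule divide_right_mono) simp
      also have "\<dots> = 2 ^ N * real n powr (real N - 1)" using n by (simp add: powr_diff)
      finally show "norm (B' n) \<le> 2 ^ N * real n powr (real N - 1)" .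
    qed
    then show ?thesis by simp
  qed
  define u where "u = (\<lambda>n s. of_nat n * T n s)"
  have hol_u: "u n holomorphic_on {s. real N < Re s}" for n
  proof (cases "n = 0")
    case False
    have "((powr_taylor_rest 0 n) \<circ> (\<lambda>s. s + 1)) holomorphic_on {s. real N < Re s}"
      using False by (intro holomorphic_on_compose powr_taylor_rest_holomorphic holomorphic_intros) auto
    then show ?thesis unfolding u_def T_def
      using False by (intro holomorphic_intros powr_taylor_rest_holomorphic[unfolded eta_contract_eq])
          (auto simp: o_def intro: powr_taylor_rest_holomorphic)
  qed (simp add: u_def)
  have bd_u: "\<exists>C. \<forall>n s. real N < Re s \<longrightarrow> norm s
      \<le> R \<longrightarrow> norm (u n s) \<le> C * real n powr (- Re s)" for R
  proof -
    obtain C1 where C1: "\<And>n s. n > 0 \<Longrightarrow> - real 1 < Re s \<Longrightarrow>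
        norm s \<le> R \<Longrightarrow>
      norm (powr_taylor_rest 1 n s) \<le> C1 * real n powr (- Re s - real 1)"
      using powr_taylor_rest_bound by blast
    obtain C0 where C0: "\<And>n s. n > 0 \<Longrightarrow> - real 0 < Re s \<Longrightarrow>
        norm s \<le> R + 1 \<Longrightarrow>
      norm (powr_taylor_rest 0 n s) \<le> C0 * real n powr (- Re s - real 0)"
      using powr_taylor_rest_bound by blast
    have "norm (u n s) \<le> (C1 + (R + 1) * C0) * real n powr (- Re s)" if s: "real N < Re s" "norm s
        \<le> R" for n s
    proof (cases "n = 0")
      case False
      have s1: "norm (s - 1) \<le> R + 1" "norm (s + 1) \<le> R + 1"
        using s(2) norm_triangle_ineq4[of s 1] norm_triangle_ineq[of s 1] by auto
      have "norm (T n s) \<le> norm (powr_taylor_rest 1 n s)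
          + norm (s - 1) * norm (powr_taylor_rest 0 n (s + 1))"
        unfolding T_def by (metis norm_mult norm_triangle_ineq)
      also have "\<dots> \<le> C1 * real n powr (- Re s - 1) + (R
          + 1) * (C0 * real n powr (- Re s - 1))"
      proof (intro add_mono mult_mono s1)
        show "norm (powr_taylor_rest 1 n s) \<le> C1 * real n powr (- Re s - 1)"
          using C1[of n s] False s by simp
        have "- Re (s + 1) - real 0 = - Re s - 1" by simp
        moreover have "norm (powr_taylor_rest 0 n (s + 1))
            \<le> C0 * real n powr (- Re (s + 1) - real 0)"
          using False s by (intro C0 s1(2)) auto
        ultimately show "norm (powr_taylor_rest 0 n (s + 1)) \<le> C0 * real n powr (- Re s - 1)"
          by (simp only:)
        show "0 \<le> R + 1" using norm_ge_zero[of s] s(2) by linarith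
      qed auto
      finally have "real n * norm (T n s) \<le> real n * ((C1 + (R
          + 1) * C0) * real n powr (- Re s - 1))"
        by (intro mult_left_mono) (auto simp: algebra_simps)
      also have "\<dots> = (C1 + (R + 1) * C0) * (real n powr 1 * real n powr (- Re s - 1))" using False
          by simp
      also have "real n powr 1 * real n powr (- Re s - 1) = real n powr (- Re s)"
          by (simp only: powr_add [symmetric]) simp
      finally show ?thesis by (simp add: u_def norm_mult)
    qed (simp add: u_def)
    then show ?thesis by blast
  qed
  note ker = kernel_series_holomorphic[OF convB' hol_u bd_u]
  define R where "R = (\<lambda>s. \<Sum>\<^sub>\<infinity>n. B' n * u n s)"
  have Bu: "B' n * u n s = (if n = 0 then 0 else B n * T n s)" for n s by (simp add: B'_def u_def)
  have "(s - 1) * dirichlet_flag (Suc N) s = dirichlet_flag N (s - 1) - R s" if s: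
      "real (Suc N) < Re s" for s
  proof -
    define v where "v = (\<lambda>n. of_nat n powr (1 - s) - of_nat (Suc n) powr (1 - s))"
    have "real N < Re s" using s by simp
    have hR: "((\<lambda>n. B n * T n s) has_sum R s) {1..}"
    proof -
      have "((\<lambda>n. B' n * u n s) has_sum R s) UNIV"
        unfolding R_def by (intro has_sum_infsum abs_summable_summable[OF ker(2)[OF \<open>real N < Re s\<close>]])
      also have "?this \<longleftrightarrow> ?thesis" by (rule has_sum_cong_neutral) (auto simp: Bu)
      finally show ?thesis .
    qed
    have hD: "((\<lambda>n. B n * of_nat (Suc n) powr (- s)) has_sum dirichlet_flag (Suc N) s) {1..}"
    proof -
      have "((\<lambda>n. flag_coeff (Suc N) n * of_nat n powr (- s))
          has_sum dirichlet_flag (Suc N) s) UNIV"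
        unfolding dirichlet_flag_eq_dseries dseries_def
        using N s by (intro has_sum_infsum abs_conv_beyondD(2)[OF abs_conv_beyond_flag_coeff]) auto
      also have "?this \<longleftrightarrow> ((\<lambda>n. flag_coeff (Suc N) n * of_nat n powr (- s))
          has_sum dirichlet_flag (Suc N) s) {2..}"
        using N by (intro has_sum_cong_neutral) (auto simp: flag_coeff_def flag_count_eq_0)
      also have "\<dots> \<longleftrightarrow> ?thesis"
        by (rule has_sum_reindex_bij_witness[of _ Suc "\<lambda>n. n - 1"]) (auto simp: B_def
            flag_coeff_def)
      finally show ?thesis .
    qed
    have "((\<lambda>n. B n * T n s + (s - 1) * (B n * of_nat (Suc n) powr (- s)))
        has_sum R s + (s - 1) * dirichlet_flag (Suc N) s) {1..}"
      by (intro has_sum_add hR has_sum_cmult_right hD)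
    also have "(\<lambda>n. B n * T n s + (s - 1) * (B n * of_nat (Suc n) powr (- s)))
        = (\<lambda>n. B n * v n)"
      unfolding T v_def by (simp add: algebra_simps fun_eq_iff)
    finally have hv: "((\<lambda>n. B n * v n) has_sum R s
        + (s - 1) * dirichlet_flag (Suc N) s) {1..}" .
    have Bsum: "B n = (\<Sum>k\<in>{1..n}. flag_coeff N k)" for n
    proof -
      have "B n = (\<Sum>k\<le>n. flag_coeff N k)" using flag_count_Suc_Suc[OF N, of n]
          by (simp add: B_def flag_coeff_def)
      also have "\<dots> = (\<Sum>k\<in>{1..n}. flag_coeff N k)"
        using N by (intro sum.mono_neutral_right) (auto simp: flag_coeff_def flag_count_eq_0 not_le)
      finally show ?thesis .
    qed
    have sm: "(\<lambda>(n,k). flag_coeff N k * v n) summable_on (SIGMA n:{1..}. {1..n})"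
    proof -
      obtain C where C: "\<And>n s'. n > 0 \<Longrightarrow> - real 0 < Re s' \<Longrightarrow>
          norm s' \<le> norm s \<Longrightarrow>
        norm (powr_taylor_rest 0 n s') \<le> C * real n powr (- Re s' - real 0)"
        using powr_taylor_rest_bound by blast
      have nv: "norm (v n) \<le> C * real n powr (- Re s)" if "n \<ge> 1" for n
        using C[of n s] s that by (simp add: v_def powr_taylor_rest_def)
      have "(\<lambda>x. norm (case x of (n,k) \<Rightarrow> flag_coeff N k
          * v n)) summable_on (SIGMA n:{1..}. {1..n})"
      proof (rule summable_on_SigmaI)
        fix n :: nat
        have "norm (B n) = (\<Sum>k\<in>{1..n}. norm (flag_coeff N k))"
          unfolding Bsum by (simp add: flag_coeff_def flip: of_nat_sum)
        then have "norm (B n) * norm (v n) = (\<Sum>k\<in>{1..n}. norm (flag_coeff N k * v n))"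
          by (simp add: norm_mult sum_distrib_right)
        then show "((\<lambda>k. norm (case (n, k) of (n,k) \<Rightarrow> flag_coeff N k * v n))
            has_sum norm (B n) * norm (v n)) {1..n}"
          by (intro has_sum_finiteI) auto
        have "(\<lambda>n. norm (B n) * real n powr (- Re s)) summable_on UNIV"
          using convB s by (simp add: abs_conv_beyond_def)
        then have "(\<lambda>n. C * (norm (B n) * real n powr (- Re s))) summable_on {1..}"
          by (intro summable_on_cmult_right) (rule summable_on_subset_banach, auto)
        then show "(\<lambda>n. norm (B n) * norm (v n)) summable_on {1..}"
        proof (rule summable_on_comparison_test)
          show "norm (B n) * norm (v n) \<le> C * (norm (B n) * real n powr (- Re s))"
              if "n \<in> {1..}" for n
            using mult_left_mono[OF nv[of n], of "norm (B n)"] that by (simp add: mult_ac)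
        qed auto
      qed auto
      then have "(\<lambda>x. (case x of (n,k) \<Rightarrow> flag_coeff N k
          * v n)) summable_on (SIGMA n:{1..}. {1..n})"
        by (rule abs_summable_summable)
      then show ?thesis .
    qed
    have "((\<lambda>(n,k). flag_coeff N k * v n) has_sum R s
        + (s - 1) * dirichlet_flag (Suc N) s) (SIGMA n:{1..}. {1..n})"
    proof (rule has_sum_SigmaI[OF _ hv sm])
      fix n
      show "((\<lambda>k. case (n, k) of (n,k) \<Rightarrow> flag_coeff N k * v n)
          has_sum B n * v n) {1..n}"
        by (rule has_sum_finiteI) (auto simp: Bsum sum_distrib_right)
    qed
    also have "?this \<longleftrightarrow> ((\<lambda>(k,n). flag_coeff N k * v n)
        has_sum R s + (s - 1) * dirichlet_flag (Suc N) s) (SIGMA k:{1..}. {k..})"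
      by (rule has_sum_reindex_bij_witness[of _ "\<lambda>(k,n). (n,k)" "\<lambda>(n,k). (k,n)"]) auto
    finally have "((\<lambda>k. flag_coeff N k * of_nat k powr (1 - s))
        has_sum R s + (s - 1) * dirichlet_flag (Suc N) s) {1..}"
    proof (rule has_sum_SigmaD)
      fix k :: nat assume k: "k \<in> {1..}"
      have "v summable_on {1..}"
        using powr_taylor_rest_summable[of 0 s] s N by (simp add: v_def[abs_def]
            powr_taylor_rest_def[abs_def])
      then have "v summable_on {k..}" by (rule summable_on_subset_banach) (use k in auto)
      then have "(\<lambda>n. v (n + k)) summable_on UNIV"
        using summable_on_reindex_bij_witness[of UNIV "\<lambda>n. n - k" "\<lambda>n. n
            + k" "{k..}" v "\<lambda>n. v (n + k)"] by auto
      then have "((\<lambda>n. v (n + k)) has_sum (\<Sum>\<^sub>\<infinity>n. v (n + k))) UNIV" by simp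
      moreover have "(\<lambda>n. v (n + k)) sums (of_nat k powr (1 - s))"
      proof -
        have "(\<lambda>n. of_nat n powr (1 - s) :: complex) \<longlonglongrightarrow> 0"
          using s N by (intro tendsto_neg_powr_complex_of_nat) auto
        then have "(\<lambda>n. of_nat (n + k) powr (1 - s) :: complex) \<longlonglongrightarrow> 0"
          by (rule LIMSEQ_ignore_initial_segment)
        from telescope_sums'[OF this] show ?thesis by (simp add: v_def)
      qed
      ultimately have "((\<lambda>n. v (n + k)) has_sum of_nat k powr (1 - s)) UNIV"
        using has_sum_imp_sums sums_unique2 by metis
      also have "?this \<longleftrightarrow> (v has_sum of_nat k powr (1 - s)) {k..}"
        by (rule has_sum_reindex_bij_witness[of _ "\<lambda>n. n - k" "\<lambda>n. n + k"]) auto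
      finally show "((\<lambda>n. case (k, n) of (k, n) \<Rightarrow> flag_coeff N k * v n)
          has_sum flag_coeff N k * of_nat k powr (1 - s)) {k..}"
        by (simp add: has_sum_cmult_right)
    qed
    also have "?this \<longleftrightarrow> ((\<lambda>k. flag_coeff N k * of_nat k powr (- (s - 1)))
        has_sum R s + (s - 1) * dirichlet_flag (Suc N) s) UNIV"
      by (rule has_sum_cong_neutral) auto
    finally have "dirichlet_flag N (s - 1) = R s + (s - 1) * dirichlet_flag (Suc N) s"
      unfolding dirichlet_flag_eq_dseries[of N] dseries_def by (rule infsumI)
    then show ?thesis by simp
  qed
  moreover have "R holomorphic_on {s. real N < Re s}" unfolding R_def by (rule ker(1))
  ultimately show ?thesis by blast
qed

text \<open>
Each step of the recursion shifts the argument by one and divides by \<open>s - 1\<close>. At \<open>s = N\<close> the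
divisors are \<open>N - 1, N - 2, ..., 2\<close>, whence the factorial.
\<close>
lemma flag_series_reduction:
  assumes "N \<ge> 2"
  shows "\<exists>c h. c holomorphic_on {s. real N - 1 < Re s} \<and>
      h holomorphic_on {s. real N - 1 < Re s} \<and>
     c (of_nat N) = 1 / fact (N - 1) \<and>
     (\<forall>s. real N < Re s \<longrightarrow> dirichlet_flag N s
         = c s * dirichlet_flag 2 (s - of_nat N + 2) + h s)"
  using assms
proof (induction N rule: dec_induct)
  case base
  show ?case by (intro exI[of _ "\<lambda>_. 1"] exI[of _ "\<lambda>_. 0"]) simp
next
  case (step N)
  then obtain c h where ch: "c holomorphic_on {s. real N - 1 < Re s}"
      "h holomorphic_on {s. real N - 1 < Re s}"
    "c (of_nat N) = 1 / fact (N - 1)"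
    "\<And>s. real N < Re s \<Longrightarrow> dirichlet_flag N s
        = c s * dirichlet_flag 2 (s - of_nat N + 2) + h s"
    by blast
  obtain R where R: "R holomorphic_on {s. real N < Re s}"
    "\<And>s. real (Suc N) < Re s \<Longrightarrow> (s - 1) * dirichlet_flag (Suc N) s
        = dirichlet_flag N (s - 1) - R s"
    using flag_series_recursion[OF step.hyps(1)] by blast
  have shift: "(\<lambda>s. f (s - 1)) holomorphic_on {s. real N < Re s}"
      if "f holomorphic_on {s. real N - 1 < Re s}" for f
  proof -
    have "(f \<circ> (\<lambda>s. s - 1)) holomorphic_on {s. real N < Re s}"
      by (intro holomorphic_on_compose holomorphic_intros holomorphic_on_subset[OF that]) auto
    then show ?thesis by (simp add: o_def)
  qed
  have ne1: "s \<noteq> 1" if "real N < Re s" for s using that step.hyps(1) by auto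
  show ?case
  proof (rule exI[of _ "\<lambda>s. c (s - 1) / (s - 1)"], rule exI[of _
      "\<lambda>s. (h (s - 1) - R s) / (s - 1)"], intro conjI allI impI)
    show "(\<lambda>s. c (s - 1) / (s - 1)) holomorphic_on {s. real (Suc N) - 1 < Re s}"
      "(\<lambda>s. (h (s - 1) - R s) / (s - 1)) holomorphic_on {s. real (Suc N) - 1 < Re s}"
      using ne1 R(1) shift[OF ch(1)] shift[OF ch(2)] by (auto intro!: holomorphic_on_divide
          holomorphic_on_diff holomorphic_on_ident holomorphic_on_const)
    show "c (of_nat (Suc N) - 1) / (of_nat (Suc N) - 1) = 1 / fact (Suc N - 1)"
      using ch(3) step.hyps(1) fact_reduce[of N, where ?'a = complex] by (simp add: mult.commute)
    fix s assume s: "real (Suc N) < Re s"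
    then have "real N < Re (s - 1)" by simp
    then have "(s - 1) * dirichlet_flag (Suc N) s = c (s - 1) * dirichlet_flag 2 (s - 1 - of_nat N + 2)
        + h (s - 1) - R s"
      using R(2)[OF s] ch(4) by simp
    moreover have "s - 1 - of_nat N + 2 = s - of_nat (Suc N) + 2" by simp
    moreover have "s - 1 \<noteq> 0" using ne1[of s] s by simp
    ultimately show "dirichlet_flag (Suc N) s = c (s - 1) / (s - 1)
        * dirichlet_flag 2 (s - of_nat (Suc N) + 2) + (h (s - 1) - R s) / (s - 1)"
      by (simp add: divide_simps) (simp add: algebra_simps)
  qed
qed

text \<open>
The terms \<open>P(s - N + 2)\<close> and \<open>E(s - N + 2)\<close> of the two-step series join the holomorphic part,
because \<open>Re s > \<sigma> + N - 2\<close> means that their argument has real part above \<open>\<sigma> \<ge> 1\<close>.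
\<close>
lemma flag_series_decomposition:
  assumes N: "N \<ge> 2" and \<sigma>: "sigma_bar = ereal \<sigma>"
  shows "\<exists>c h. c holomorphic_on {s. \<sigma> + real N - 2 < Re s} \<and>
      h holomorphic_on {s. \<sigma> + real N - 2 < Re s} \<and>
     c (of_nat N) = 1 / fact (N - 1) \<and>
     (\<forall>s. real N < Re s \<longrightarrow> dirichlet_flag N s
         = c s * dseries prime_ind (s - of_nat N + 1) + h s)"
proof -
  obtain \<sigma>' where "sigma_bar = ereal \<sigma>'" "1 \<le> \<sigma>'" "\<sigma>' \<le> 3 / 2"
      using sigma_bar_bounds by blast
  moreover from this have "\<sigma>' = \<sigma>" using \<sigma> by (metis ereal.inject)
  ultimately have b: "1 \<le> \<sigma>" "\<sigma> \<le> 3 / 2" by auto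
  obtain c h where ch: "c holomorphic_on {s. real N - 1 < Re s}"
      "h holomorphic_on {s. real N - 1 < Re s}"
    "c (of_nat N) = 1 / fact (N - 1)"
    "\<And>s. real N < Re s \<Longrightarrow> dirichlet_flag N s
        = c s * dirichlet_flag 2 (s - of_nat N + 2) + h s"
    using flag_series_reduction[OF N] by blast
  have shift: "(\<lambda>s. dseries a (s - of_nat N + 2)) holomorphic_on {s. \<sigma>
      + real N - 2 < Re s}"
    if "abs_conv_beyond a d" "d \<le> \<sigma>" for a d
  proof -
    have "(dseries a \<circ> (\<lambda>s. s - of_nat N + 2)) holomorphic_on {s. \<sigma>
        + real N - 2 < Re s}"
      using that(2) by (intro holomorphic_on_compose holomorphic_intros holomorphic_on_subset[OF
          dseries_holomorphic[OF that(1)]]) auto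
    then show ?thesis by (simp add: o_def)
  qed
  have c': "c holomorphic_on {s. \<sigma> + real N - 2 < Re s}" and h': "h holomorphic_on {s. \<sigma>
      + real N - 2 < Re s}"
    by (rule holomorphic_on_subset[OF ch(1)] holomorphic_on_subset[OF ch(2)]; use b in force)+
  show ?thesis
  proof (rule exI[of _ c], rule exI[of _ "\<lambda>s. c s * (dseries composite_coeff (s - of_nat N
      + 2) - dseries prime_ind (s - of_nat N + 2)) + h s"], intro conjI allI impI)
    show "(\<lambda>s. c s * (dseries composite_coeff (s - of_nat N
        + 2) - dseries prime_ind (s - of_nat N + 2)) + h s)
        holomorphic_on {s. \<sigma> + real N - 2 < Re s}"
      by (intro holomorphic_on_add holomorphic_on_mult holomorphic_on_diff c' h'
           shift[OF abs_conv_beyond_prime_ind b(1)] shift[OF abs_conv_beyond_composite_coeff[OF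
               \<sigma>]]) simp
    fix s assume s: "real N < Re s"
    have "dirichlet_flag 2 (s - of_nat N + 2) = dseries prime_ind (s - of_nat N
        + 2 - 1) - dseries prime_ind (s - of_nat N + 2)
        + dseries composite_coeff (s - of_nat N + 2)"
      using s by (intro flag_series_two_steps[OF \<sigma>]) simp
    moreover have "s - of_nat N + 2 - 1 = s - of_nat N + 1" by simp
    ultimately show "dirichlet_flag N s = c s * dseries prime_ind (s - of_nat N + 1) +
       (c s * (dseries composite_coeff (s - of_nat N + 2) - dseries prime_ind (s - of_nat N + 2))
           + h s)"
      unfolding ch(4)[OF s] by (simp only:) (simp add: algebra_simps)
  qed (use c' ch in auto)
qed

section \<open>Functions on the universal cover\<close>

lemma mem_path_class_self: "path g \<Longrightarrow> path_image g \<subseteq> X \<Longrightarrow>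
    g \<in> path_class X g"
  by (simp add: path_class_def homotopic_paths_refl)

text \<open>
Contour integrals need piecewise smooth paths, while the cover consists of classes of arbitrary
paths. In an open set a polynomial path close to a given one is homotopic to it.
\<close>
lemma valid_path_in_path_class:
  assumes "open X" "path g" "path_image g \<subseteq> X"
  shows "\<exists>q. q \<in> path_class X g \<and> valid_path q"
proof -
  obtain e where e: "e > 0" "\<And>h. path h \<and> pathstart h = pathstart g \<and>
      pathfinish h = pathfinish g \<and>
       (\<forall>t \<in> {0..1}. norm(h t - g t) < e) \<Longrightarrow> homotopic_paths X g h"
    using homotopic_nearby_paths[OF assms(2,1,3)] by blast
  obtain q where q: "polynomial_function q" "pathstart q = pathstart g" "pathfinish q = pathfinish g"
     "\<And>t. t \<in> {0..1} \<Longrightarrow> norm (q t - g t) < e"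
    using path_approx_polynomial_function[OF assms(2) e(1)] by blast
  have "valid_path q" using q(1) by (rule valid_path_polynomial_function)
  moreover have "homotopic_paths X g q"
    using q e(2)[of q] \<open>valid_path q\<close> valid_path_imp_path by blast
  ultimately show ?thesis by (auto simp: path_class_def)
qed

text \<open>
The continuation integrates the single-valued derivative \<open>g\<close> along a piecewise smooth representative
of the class. By the theorem of Cauchy the integral is the same for all representatives. On a sheet
over a disc the integral changes by a local primitive of \<open>g\<close>, which makes it holomorphic there.
\<close>
lemma extends_to_universal_coverI:
  assumes X: "open X" and H: "convex H" "H \<subseteq> X"
    and g: "g holomorphic_on X" and p: "\<And>z. z \<in> H \<Longrightarrow>
        (p has_field_derivative g z) (at z)"
    and ch: "c holomorphic_on X" "h holomorphic_on X"
    and f: "\<And>s. s \<in> H \<Longrightarrow> f s = c s * p s + h s"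
  shows "extends_to_universal_cover f H X"
  unfolding extends_to_universal_cover_def
proof (intro conjI ballI H)
  fix b assume b: "b \<in> H"
  define F where "F = (\<lambda>C. let q = (SOME q. q \<in> C \<and> valid_path q)
     in c (pathfinish q) * (p b + contour_integral q g) + h (pathfinish q))"
  have F: "F (path_class X \<gamma>) = c (pathfinish q) * (p b + contour_integral q g)
      + h (pathfinish q)"
    if q: "homotopic_paths X \<gamma> q" "valid_path q" for \<gamma> q
  proof -
    define q' where "q' = (SOME q. q \<in> path_class X \<gamma> \<and> valid_path q)"
    have "q' \<in> path_class X \<gamma> \<and> valid_path q'"
      unfolding q'_def by (rule someI[of _ q]) (use q in \<open>simp add: path_class_def\<close>)
    then have q': "homotopic_paths X \<gamma> q'" "valid_path q'" by (auto simp: path_class_def)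
    have hom: "homotopic_paths X q' q"
      using q(1) q'(1) homotopic_paths_sym homotopic_paths_trans by blast
    have "contour_integral q' g = contour_integral q g"
      by (rule Cauchy_theorem_homotopic_paths[OF hom X g q'(2) q(2)])
    moreover have "pathfinish q' = pathfinish q"
      using hom by (rule homotopic_paths_imp_pathfinish)
    ultimately show ?thesis by (simp add: F_def Let_def flip: q'_def)
  qed
  have "holomorphic_on_universal_cover F X b"
    unfolding holomorphic_on_universal_cover_def
  proof (intro allI impI, elim conjE)
    fix \<gamma> r assume cl: "path_class X \<gamma> \<in> universal_cover X b" and ball:
        "ball (pathfinish \<gamma>) r \<subseteq> X"
    obtain \<gamma>' where \<gamma>': "path \<gamma>'" "path_image \<gamma>' \<subseteq> X"
        "path_class X \<gamma> = path_class X \<gamma>'"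
      using cl by (auto simp: universal_cover_def paths_from_def)
    then have "homotopic_paths X \<gamma> \<gamma>'"
      using mem_path_class_self[of \<gamma>' X] by (simp add: path_class_def set_eq_iff)
    then have \<gamma>: "path \<gamma>" "path_image \<gamma> \<subseteq> X"
      using homotopic_paths_imp_path homotopic_paths_imp_subset by blast+
    obtain q where q: "homotopic_paths X \<gamma> q" "valid_path q"
      using valid_path_in_path_class[OF X \<gamma>] by (auto simp: path_class_def)
    have fin: "pathfinish q = pathfinish \<gamma>"
      using homotopic_paths_imp_pathfinish[OF q(1)] by simp
    define a where "a = pathfinish \<gamma>"
    have qX: "path_image q \<subseteq> X" using homotopic_paths_imp_subset[OF q(1)] by simp
    have gb: "g holomorphic_on ball a r" using holomorphic_on_subset[OF g] ball by (simp add: a_def)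
    obtain G where G: "\<And>z. z \<in> ball a r \<Longrightarrow>
        (G has_field_derivative g z) (at z within ball a r)"
      using holomorphic_convex_primitive'[OF convex_ball open_ball gb] by blast
    have Gh: "G holomorphic_on ball a r"
      unfolding holomorphic_on_def field_differentiable_def using G by blast
    have "F (sheet X \<gamma> z) = c z * (p b + contour_integral q g + (G z - G a))
        + h z" if z: "z \<in> ball a r" for z
    proof -
      have a: "a \<in> ball a r" using z zero_le_dist[of a z] by (simp only: mem_ball dist_self)
      have seg: "closed_segment a z \<subseteq> ball a r"
        using a z by (simp add: closed_segment_subset)
      then have segX: "closed_segment a z \<subseteq> X" using ball by (auto simp: a_def)
      have "homotopic_paths X (\<gamma> +++ linepath a z) (q +++ linepath a z)"
        by (rule homotopic_paths_join[OF q(1)]) (use segX in \<open>auto simp: a_def homotopic_paths_refl\<close>)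
      moreover have "valid_path (q +++ linepath a z)"
        using q(2) fin by (intro valid_path_join) (auto simp: a_def)
      ultimately have "F (sheet X \<gamma> z) = c z * (p b + contour_integral (q +++ linepath a z) g)
          + h z"
        using F[of "\<gamma> +++ linepath a z" "q +++ linepath a z"]
            by (simp add: sheet_def flip: a_def)
      also have "contour_integral (q +++ linepath a z) g = contour_integral q g
          + contour_integral (linepath a z) g"
        by (rule contour_integral_join)
           (use q qX segX fin in \<open>auto simp: a_def intro!: contour_integrable_holomorphic_simple[OF g X]\<close>)
      also have "contour_integral (linepath a z) g = G z - G a"
        using contour_integral_primitive[OF G, of "linepath a z"] seg
            by (simp add: contour_integral_unique)
      finally show ?thesis by (simp add: add.assoc)
    qed
    moreover have "(\<lambda>z. c z * (p b + contour_integral q g + (G z - G a))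
        + h z) holomorphic_on ball a r"
      using ball by (intro holomorphic_intros Gh holomorphic_on_subset[OF ch(1)]
          holomorphic_on_subset[OF ch(2)]) (auto simp: a_def)
    ultimately show "(\<lambda>z. F (sheet X \<gamma> z)) holomorphic_on ball (pathfinish \<gamma>) r"
      unfolding a_def[symmetric] by (subst holomorphic_cong[OF refl]) auto
  qed
  moreover have "F (path_class X (linepath b s)) = f s" if s: "s \<in> H" for s
  proof -
    have seg: "closed_segment b s \<subseteq> H" using b s H by (simp add: closed_segment_subset)
    have "F (path_class X (linepath b s)) = c s * (p b + contour_integral (linepath b s) g) + h s"
      using F[of "linepath b s" "linepath b s"] seg H by (auto simp: homotopic_paths_refl)
    also have "contour_integral (linepath b s) g = p s - p b"
      using contour_integral_primitive[of H p g "linepath b s"] p seg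
      by (simp add: contour_integral_unique has_field_derivative_at_within)
    finally show ?thesis using f[OF s] by simp
  qed
  ultimately show "\<exists>F. holomorphic_on_universal_cover F X b \<and>
      (\<forall>s\<in>H. F (path_class X (linepath b s)) = f s)"
    by blast
qed

section \<open>Branch points and the logarithmic singularity\<close>

lemma is_pole_riemann_zeta_iff: "is_pole riemann_zeta z \<longleftrightarrow> z = 1"
proof
  assume "is_pole riemann_zeta z"
  show "z = 1"
  proof (rule ccontr)
    assume "z \<noteq> 1"
    then have "\<not> is_pole riemann_zeta z"
      by (intro not_is_pole_holomorphic[OF _ _ riemann_zeta_holomorphic]) auto
    with \<open>is_pole riemann_zeta z\<close> show False by simp
  qed
qed (use is_pole_riemann_zeta in simp)

text \<open>
Put \<open>w = s - N + 1\<close>. A branch point \<open>s = \<rho>/k + N - 1\<close> is one for which \<open>k * w = \<rho>\<close> is a zero or the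
pole of zeta.
\<close>
lemma punctured_half_plane_eq:
  assumes \<sigma>: "sigma_bar = ereal \<sigma>" "1 \<le> \<sigma>"
  shows "punctured_half_plane N = {s. \<sigma> + real N - 2 < Re s} \<inter> (\<lambda>s. s - of_nat N
      + 1) -` prime_zeta_domain"
proof -
  have "s \<in> branch_points N \<longleftrightarrow> s - of_nat N
      + 1 \<notin> prime_zeta_domain" if s: "\<sigma> + real N - 2 < Re s" for s
  proof -
    define w where "w = s - of_nat N + 1"
    have w: "0 < Re w" using s \<sigma> by (simp add: w_def)
    have eq: "s = \<rho> / of_nat k + of_nat N - 1 \<longleftrightarrow> \<rho> = of_nat k * w"
        if "k > 0" for \<rho> k
    proof -
      have "s = \<rho> / of_nat k + of_nat N - 1 \<longleftrightarrow> w = \<rho> / of_nat k"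
          by (auto simp: w_def algebra_simps)
      then show ?thesis using that by (auto simp: field_simps)
    qed
    have "s \<in> branch_points N \<longleftrightarrow> (\<exists>k. 0 < k \<and> squarefree k \<and>
        of_nat k * w \<notin> zeta_regular)"
    proof
      assume "s \<in> branch_points N"
      then obtain \<rho> k where "s = \<rho> / of_nat k + of_nat N - 1" "\<rho> \<notin> zeta_regular"
          "0 < k" "squarefree k"
        by (auto simp: branch_points_def zeta_regular_def is_pole_riemann_zeta_iff)
      with eq[of k \<rho>] show "\<exists>k. 0 < k \<and> squarefree k \<and>
          of_nat k * w \<notin> zeta_regular" by blast
    next
      assume "\<exists>k. 0 < k \<and> squarefree k \<and> of_nat k * w \<notin> zeta_regular"
      then obtain k where k: "0 < k" "squarefree k" "of_nat k * w \<notin> zeta_regular" by blast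
      have "s = (of_nat k * w) / of_nat k + of_nat N - 1" using eq[OF k(1)] by blast
      moreover have "(of_nat k * w \<noteq> 1 \<and> riemann_zeta (of_nat k * w)
          = 0) \<or> is_pole riemann_zeta (of_nat k * w)"
        using k(3) by (auto simp: zeta_regular_def is_pole_riemann_zeta_iff)
      ultimately show "s \<in> branch_points N"
        unfolding branch_points_def using k(1,2) by blast
    qed
    also have "\<dots> \<longleftrightarrow> (\<exists>k. squarefree k \<and>
        of_nat k * w \<notin> zeta_regular)"
      by (metis not_squarefree_0 bot_nat_0.not_eq_extremum)
    also have "\<dots> \<longleftrightarrow> w \<notin> prime_zeta_domain" using w
        by (auto simp: prime_zeta_domain_def)
    finally show ?thesis by (simp add: w_def)
  qed
  moreover have "sigma_bar + ereal (real N - 2) < ereal (Re s)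
      \<longleftrightarrow> \<sigma> + real N - 2 < Re s" for s
    by (simp add: \<sigma>(1) algebra_simps)
  ultimately show ?thesis unfolding punctured_half_plane_def by auto
qed

text \<open>
A function whose derivative continues to a convex set continues itself: on the convex overlap it
differs from a primitive by a constant.
\<close>
lemma primitive_extension:
  assumes S: "open S" "convex S" and H: "open H" "convex H"
    and g: "g holomorphic_on S" and f: "\<And>z. z \<in> S \<inter> H \<Longrightarrow>
        (f has_field_derivative g z) (at z)"
  shows "\<exists>p. p holomorphic_on S \<and> (\<forall>z\<in>S \<inter> H. p z = f z)"
proof (cases "S \<inter> H = {}")
  case True
  then show ?thesis by (intro exI[of _ "\<lambda>_. 0"]) auto
next
  case False
  then obtain a where a: "a \<in> S \<inter> H" by blast
  obtain p where p: "\<And>z. z \<in> S \<Longrightarrow> (p has_field_derivative g z) (at z within S)"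
    using holomorphic_convex_primitive'[OF S(2,1) g] by blast
  have p': "(p has_field_derivative g z) (at z)" if "z \<in> S" for z
    using p[OF that] unfolding at_within_open[OF that S(1)] .
  have hol: "p holomorphic_on S"
    unfolding holomorphic_on_def field_differentiable_def using p by blast
  have "\<exists>C. \<forall>z\<in>S \<inter> H. f z - p z = C"
  proof (rule has_field_derivative_zero_constant)
    show "convex (S \<inter> H)" using S H by (intro convex_Int)
    fix z assume z: "z \<in> S \<inter> H"
    have "((\<lambda>z. f z - p z) has_field_derivative g z - g z) (at z)"
      using f[OF z] p'[of z] z by (intro DERIV_diff) auto
    then show "((\<lambda>z. f z - p z) has_field_derivative 0) (at z within S \<inter> H)"
      by (simp add: has_field_derivative_at_within)
  qed
  then obtain C where C: "\<And>z. z \<in> S \<inter> H \<Longrightarrow> f z - p z = C" by blast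
  show ?thesis
  proof (intro exI[of _ "\<lambda>z. p z + C"] conjI ballI)
    show "(\<lambda>z. p z + C) holomorphic_on S" using hol by (intro holomorphic_intros)
    show "p z + C = f z" if "z \<in> S \<inter> H" for z using C[OF that] by (simp add: algebra_simps)
  qed
qed

lemma prime_zeta_has_derivative:
  assumes "Re w > 1" shows "(dseries prime_ind has_field_derivative prime_zeta_deriv w) (at w)"
  using dseries_deriv[OF abs_conv_beyond_prime_ind assms] prime_zeta_deriv_eq[OF assms]
  by (simp add: prime_log_def[abs_def])

lemma prime_zeta_continuation_line:
  assumes "Re w = 1" "w \<noteq> 1"
  shows "\<exists>e>0. \<exists>p. p holomorphic_on ball w e \<and>
      (\<forall>z\<in>ball w e. Re z > 1 \<longrightarrow> p z = dseries prime_ind z)"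
proof -
  have "w \<in> prime_zeta_domain" using assms by (intro prime_zeta_domainI) auto
  then obtain e where e: "e > 0" "ball w e \<subseteq> prime_zeta_domain"
    using open_prime_zeta_domain openE by blast
  have "\<exists>p. p holomorphic_on ball w e \<and> (\<forall>z\<in>ball w e \<inter> {z. 1 < Re z}. p
      z = dseries prime_ind z)"
    by (rule primitive_extension[OF open_ball convex_ball open_halfspace_Re_gt convex_halfspace_Re_gt
         holomorphic_on_subset[OF prime_zeta_deriv_holomorphic e(2)]])
       (auto intro: prime_zeta_has_derivative)
  then show ?thesis using e(1) by auto
qed

text \<open>
The derivative of \<open>P(z) + Ln (z - 1)\<close> has no singularity at 1.
\<close>
lemma prime_zeta_near_1:
  "\<exists>e>0. \<exists>p. p holomorphic_on ball 1 e \<and>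
      (\<forall>z\<in>ball 1 e. Re z > 1 \<longrightarrow> dseries prime_ind z = p z - Ln (z - 1))"
proof -
  obtain e h where eh: "e > 0" "h holomorphic_on ball 1 e"
     "\<And>w. w\<in>ball 1 e - {1} \<Longrightarrow> prime_zeta_deriv w = h w - 1 / (w - 1)"
    using prime_zeta_deriv_near_1 by blast
  have "\<exists>p. p holomorphic_on ball 1 e \<and> (\<forall>z\<in>ball 1 e \<inter> {z. 1 < Re z}. p
      z = dseries prime_ind z + Ln (z - 1))"
  proof (rule primitive_extension[OF open_ball convex_ball open_halfspace_Re_gt convex_halfspace_Re_gt
      eh(2)])
    fix z :: complex assume z: "z \<in> ball 1 e \<inter> {z. 1 < Re z}"
    then have nz: "z - 1 \<notin> \<real>\<^sub>\<le>\<^sub>0" by (auto simp: complex_nonpos_Reals_iff)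
    have "((\<lambda>z. dseries prime_ind z + Ln (z - 1)) has_field_derivative prime_zeta_deriv z
        + 1 / (z - 1)) (at z)"
      using z nz by (auto intro!: derivative_eq_intros prime_zeta_has_derivative simp: divide_inverse)
    moreover have "z \<noteq> 1" using z by auto
    then have "prime_zeta_deriv z + 1 / (z - 1) = h z" using eh(3)[of z] z by simp
    ultimately show "((\<lambda>z. dseries prime_ind z + Ln (z - 1)) has_field_derivative h z) (at z)"
        by simp
  qed
  then obtain p where "p holomorphic_on ball 1 e" "\<forall>z\<in>ball 1 e \<inter> {z. 1 < Re z}. p z
      = dseries prime_ind z + Ln (z - 1)"
    by blast
  then show ?thesis using eh(1) by (intro exI[of _ e] conjI exI[of _ p]) auto
qed

text \<open>
The real part of the logarithm is \<open>-ln \<bar>s - z\<bar>\<close>, which tends to infinity, so the bounded functions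
\<open>k\<close> and the variation of \<open>c\<close> are negligible.
\<close>
lemma log_singularity:
  fixes f c k :: "complex \<Rightarrow> complex" and z :: complex
  assumes F: "F = at z within {s. Re z < Re s}"
    and f: "eventually (\<lambda>s. f s = c s * Ln (1 / (s - z)) + k s) F"
    and c: "(c \<longlongrightarrow> a) F" "a \<noteq> 0" and k: "(k \<longlongrightarrow> b) F"
  shows "f \<sim>[F] (\<lambda>s. a * Ln (1 / (s - z)))" and "filterlim f at_infinity F"
proof -
  define L where "L = (\<lambda>s. Ln (1 / (s - z)))"
  have ev: "eventually (\<lambda>s. Re z < Re s) F"
    unfolding F by (auto simp: eventually_at_filter)
  have "((\<lambda>s. norm (s - z)) \<longlongrightarrow> norm (z - z)) F"
    unfolding F by (intro tendsto_intros)
  then have "filterlim (\<lambda>s. norm (s - z)) (at_right 0) F"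
    unfolding filterlim_at using ev by (auto elim!: eventually_mono)
  then have "filterlim (\<lambda>s. - ln (norm (s - z))) at_top F"
    by (intro filterlim_uminus_at_top_at_bot[THEN filterlim_compose] filterlim_compose[OF ln_at_0])
  then have "filterlim (\<lambda>s. norm (L s)) at_top F"
  proof (rule filterlim_at_top_mono)
    show "eventually (\<lambda>s. - ln (norm (s - z)) \<le> norm (L s)) F"
      using ev
    proof eventually_elim
      case (elim s)
      then have "s \<noteq> z" by auto
      then have "Re (L s) = - ln (norm (s - z))"
        by (simp add: L_def norm_divide ln_div)
      then show ?case using complex_Re_le_cmod[of "L s"] by simp
    qed
  qed
  then have L: "filterlim L at_infinity F" by (rule filterlim_norm_at_top_imp_at_infinity)
  then have Lnz: "eventually (\<lambda>s. L s \<noteq> 0) F"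
      by (rule filterlim_at_infinity_imp_eventually_ne)
  have "((\<lambda>s. c s / a + k s / (a * L s)) \<longlongrightarrow> a / a + 0) F"
    by (intro tendsto_add tendsto_divide tendsto_const c tendsto_divide_0[OF k]
        tendsto_mult_filterlim_at_infinity[OF tendsto_const c(2) L])
  moreover have "eventually (\<lambda>s. c s / a + k s / (a * L s) = f s / (a * L s)) F"
    using f Lnz by eventually_elim (use c(2) in \<open>simp add: L_def field_simps\<close>)
  ultimately have "((\<lambda>s. f s / (a * L s)) \<longlongrightarrow> a / a + 0) F"
    by (rule Lim_transform_eventually)
  then have q: "((\<lambda>s. f s / (a * L s)) \<longlongrightarrow> 1) F" using c(2) by simp
  then show "f \<sim>[F] (\<lambda>s. a * Ln (1 / (s - z)))"
    unfolding L_def by (rule asymp_equivI')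
  have "filterlim (\<lambda>s. (f s / (a * L s)) * (a * L s)) at_infinity F"
    by (intro tendsto_mult_filterlim_at_infinity[OF q] tendsto_mult_filterlim_at_infinity[OF
        tendsto_const c(2) L]) simp
  moreover have ev_eq: "eventually (\<lambda>s. (f s / (a * L s)) * (a * L s) = f s) F"
    using Lnz by eventually_elim (use c(2) in simp)
  ultimately show "filterlim f at_infinity F"
    using filterlim_cong[OF refl refl ev_eq] by blast
qed

text \<open>
The decomposition transports the behaviour of the prime zeta function at \<open>w = s - N + 1\<close> to the
point \<open>s\<close>: the line \<open>Re w = 1\<close> becomes \<open>Re s = N\<close>. A holomorphic continuation to \<open>N\<close> would be
bounded near \<open>N\<close>, contrary to the asymptotics.
\<close>
theorem theorem1p3:
  fixes N :: nat
  assumes "N \<ge> 2"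
  shows "(\<forall>z. Re z = real N \<longrightarrow>
            (extends_holomorphically_at (dirichlet_flag N) {s. Re s > real N} z
                \<longleftrightarrow> z \<noteq> of_nat N))
       \<and> (dirichlet_flag N \<sim>[at (of_nat N) within {s. Re s > real N}]
            (\<lambda>s. 1 / fact (N - 1) * Ln (1 / (s - of_nat N))))
       \<and> extends_to_universal_cover (dirichlet_flag N) {s. Re s > real N} (punctured_half_plane N)"
proof -
  obtain \<sigma> where \<sigma>: "sigma_bar = ereal \<sigma>" "1 \<le> \<sigma>" "\<sigma> \<le> 3 / 2"
      using sigma_bar_bounds by blast
  define D where "D = {s. \<sigma> + real N - 2 < Re s}"
  define H where "H = {s. real N < Re s}"
  define F where "F = at (of_nat N :: complex) within H"
  obtain c h where ch: "c holomorphic_on D" "h holomorphic_on D" "c (of_nat N) = 1 / fact (N - 1)"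
    and dec: "\<And>s. s \<in> H \<Longrightarrow> dirichlet_flag N s
        = c s * dseries prime_ind (s - of_nat N + 1) + h s"
    using flag_series_decomposition[OF assms \<sigma>(1)] unfolding D_def H_def by blast
  have opD: "open D" and opH: "open H" and cvH: "convex H"
    by (simp_all add: D_def H_def open_halfspace_Re_gt convex_halfspace_Re_gt)
  \<comment> \<open>The radius 1/2 is what the bound \<open>\<sigma> \<le> 3/2\<close> allows.\<close>
  have near: "ball z (1/2) \<subseteq> D" if "Re z = real N" for z
  proof
    fix s assume "s \<in> ball z (1/2)"
    then have "Re z - Re s < 1/2" using complex_Re_le_cmod[of "z - s"] by (simp add: dist_norm)
    then have "\<sigma> + real N - 2 < Re s" using that \<sigma>(3) by linarith
    then show "s \<in> D" by (simp add: D_def)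
  qed
  have shift: "(\<lambda>s. p (s - of_nat N + 1)) holomorphic_on ball z e"
    if "p holomorphic_on ball (z - of_nat N + 1) e" for p z e
  proof -
    have "(p \<circ> (\<lambda>s. s - of_nat N + 1)) holomorphic_on ball z e"
      by (intro holomorphic_on_compose holomorphic_intros holomorphic_on_subset[OF that])
         (auto simp: dist_norm algebra_simps)
    then show ?thesis by (simp add: o_def)
  qed

  have line: "extends_holomorphically_at (dirichlet_flag N) H z" if z: "Re z
      = real N" "z \<noteq> of_nat N" for z
  proof -
    have "Re (z - of_nat N + 1) = 1" "z - of_nat N + 1 \<noteq> 1" using z by auto
    then obtain e p where e: "e > 0" "p holomorphic_on ball (z - of_nat N + 1) e"
      "\<And>w. w \<in> ball (z - of_nat N + 1) e \<Longrightarrow> Re w > 1 \<Longrightarrow>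
          p w = dseries prime_ind w"
      using prime_zeta_continuation_line by blast
    define U where "U = ball z (min e (1/2))"
    have UD: "U \<subseteq> D" using near[OF z(1)] by (auto simp: U_def)
    have Ue: "U \<subseteq> ball z e" by (auto simp: U_def)
    show ?thesis
      unfolding extends_holomorphically_at_def
    proof (intro exI[of _ U] exI[of _ "\<lambda>s. c s * p (s - of_nat N + 1) + h s"] conjI ballI)
      show "open U" "z \<in> U" using e(1) by (auto simp: U_def)
      show "(\<lambda>s. c s * p (s - of_nat N + 1) + h s) holomorphic_on U"
        by (intro holomorphic_on_add holomorphic_on_mult holomorphic_on_subset[OF ch(1) UD]
             holomorphic_on_subset[OF ch(2) UD] holomorphic_on_subset[OF shift[OF e(2)] Ue])
      fix s assume s: "s \<in> U \<inter> H"
      have "s - of_nat N + 1 \<in> ball (z - of_nat N + 1) e" using s Ue by (auto simp: dist_norm)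
      moreover have "Re (s - of_nat N + 1) > 1" using s by (auto simp: H_def)
      ultimately show "c s * p (s - of_nat N + 1) + h s = dirichlet_flag N s"
        using dec[of s] e(3) s by simp
    qed
  qed

  have sing: "dirichlet_flag N \<sim>[F] (\<lambda>s. 1 / fact (N - 1) * Ln (1 / (s - of_nat N)))"
    "filterlim (dirichlet_flag N) at_infinity F"
  proof -
    obtain e p where e: "e > 0" "p holomorphic_on ball 1 e"
      "\<And>w. w \<in> ball 1 e \<Longrightarrow> Re w > 1 \<Longrightarrow>
          dseries prime_ind w = p w - Ln (w - 1)"
      using prime_zeta_near_1 by blast
    define U where "U = ball (of_nat N :: complex) (min e (1/2))"
    define k where "k = (\<lambda>s. c s * p (s - of_nat N + 1) + h s)"
    have UD: "U \<subseteq> D" using near[of "of_nat N"] by (auto simp: U_def)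
    have Ue: "U \<subseteq> ball (of_nat N) e" by (auto simp: U_def)
    have "(\<lambda>s. p (s - of_nat N + 1)) holomorphic_on ball (of_nat N) e"
      by (rule shift) (use e(2) in simp)
    then have "k holomorphic_on U" unfolding k_def
      by (intro holomorphic_on_add holomorphic_on_mult holomorphic_on_subset[OF ch(1) UD]
           holomorphic_on_subset[OF ch(2) UD]) (rule holomorphic_on_subset[OF _ Ue])
    moreover have "c holomorphic_on U" by (rule holomorphic_on_subset[OF ch(1) UD])
    ultimately have "isCont k (of_nat N)" "isCont c (of_nat N)"
      using e(1) by (auto simp: U_def dest!: holomorphic_on_imp_continuous_on simp:
          continuous_on_eq_continuous_at)
    then have lim: "(k \<longlongrightarrow> k (of_nat N)) F" "(c
        \<longlongrightarrow> 1 / fact (N - 1)) F"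
      unfolding F_def ch(3)[symmetric] by (auto simp: isCont_def intro: tendsto_within_subset)
    have "eventually (\<lambda>s. s \<in> U \<and> s \<in> H) F"
      unfolding F_def eventually_at_topological using e(1) by (intro exI[of _ U]) (auto simp: U_def)
    then have "eventually (\<lambda>s. dirichlet_flag N s = c s * Ln (1 / (s - of_nat N)) + k s) F"
    proof eventually_elim
      case (elim s)
      have "s - of_nat N + 1 \<in> ball 1 e" using elim Ue by (auto simp: dist_norm norm_minus_commute)
      moreover have "Re (s - of_nat N + 1) > 1" using elim by (auto simp: H_def)
      ultimately have "dseries prime_ind (s - of_nat N + 1) = p (s - of_nat N + 1) - Ln (s - of_nat N)"
        using e(3) by simp
      moreover have "Ln (1 / (s - of_nat N)) = - Ln (s - of_nat N)"
        using elim by (simp add: Ln_inverse H_def complex_nonpos_Reals_iff flip: inverse_eq_divide)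
      moreover have "dirichlet_flag N s = c s * dseries prime_ind (s - of_nat N + 1) + h s"
        using dec elim by blast
      ultimately show ?case by (simp only: k_def) (simp add: algebra_simps)
    qed
    from log_singularity[OF _ this lim(2) _ lim(1)]
    show "dirichlet_flag N \<sim>[F] (\<lambda>s. 1 / fact (N - 1) * Ln (1 / (s - of_nat N)))"
      "filterlim (dirichlet_flag N) at_infinity F"
      by (simp_all add: F_def H_def)
  qed

  have not_ext: "\<not> extends_holomorphically_at (dirichlet_flag N) H (of_nat N)"
  proof
    assume "extends_holomorphically_at (dirichlet_flag N) H (of_nat N)"
    then obtain U g where U: "open U" "of_nat N \<in> U" "g holomorphic_on U"
        "\<And>s. s \<in> U \<inter> H \<Longrightarrow> g s = dirichlet_flag N s"
      unfolding extends_holomorphically_at_def by blast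
    have "isCont g (of_nat N)"
      using holomorphic_on_imp_continuous_on[OF U(3)] U(1,2)
          by (simp add: continuous_on_eq_continuous_at)
    then have "(g \<longlongrightarrow> g (of_nat N)) F"
      unfolding F_def by (auto simp: isCont_def intro: tendsto_within_subset)
    moreover have "eventually (\<lambda>s. g s = dirichlet_flag N s) F"
      unfolding F_def eventually_at_topological using U by (intro exI[of _ U]) auto
    ultimately have "(dirichlet_flag N \<longlongrightarrow> g (of_nat N)) F"
      by (rule Lim_transform_eventually)
    moreover have "F \<noteq> bot"
    proof -
      have "\<exists>s\<in>H. s \<noteq> of_nat N \<and> dist s (of_nat N) < e" if "e > 0" for e
        using that by (intro bexI[of _ "of_nat N + of_real (e / 2)"]) (auto simp: H_def dist_norm
            norm_divide)
      then have "(of_nat N) islimpt H" by (simp add: islimpt_approachable)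
      then show ?thesis by (simp add: F_def trivial_limit_within)
    qed
    ultimately show False
      using not_tendsto_and_filterlim_at_infinity sing(2) by blast
  qed

  have "extends_to_universal_cover (dirichlet_flag N) H (punctured_half_plane N)"
  proof (rule extends_to_universal_coverI)
    note X = punctured_half_plane_eq[OF \<sigma>(1,2), of N, folded D_def]
    show "open (punctured_half_plane N)"
      unfolding X by (intro open_Int opD open_vimage open_prime_zeta_domain continuous_intros)
    show "convex H" by (rule cvH)
    show "H \<subseteq> punctured_half_plane N"
    proof
      fix s assume s: "s \<in> H"
      then have "Re (s - of_nat N + 1) > 1" by (simp add: H_def)
      moreover from this have "s - of_nat N + 1 \<noteq> 1" by (metis less_irrefl one_complex.sel(1))
      ultimately have "s - of_nat N + 1 \<in> prime_zeta_domain" by (intro prime_zeta_domainI) auto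
      then show "s \<in> punctured_half_plane N" using s \<sigma> unfolding X by (simp add: H_def D_def)
    qed
    have "(prime_zeta_deriv \<circ> (\<lambda>s. s - of_nat N
        + 1)) holomorphic_on punctured_half_plane N"
      unfolding X by (intro holomorphic_on_compose holomorphic_intros holomorphic_on_subset[OF
          prime_zeta_deriv_holomorphic]) auto
    then show "(\<lambda>s. prime_zeta_deriv (s - of_nat N + 1)) holomorphic_on punctured_half_plane N"
      by (simp add: o_def)
    show "((\<lambda>s. dseries prime_ind (s - of_nat N + 1))
        has_field_derivative prime_zeta_deriv (s - of_nat N + 1)) (at s)"
      if "s \<in> H" for s
    proof -
      have "(dseries prime_ind has_field_derivative prime_zeta_deriv (s - of_nat N
          + 1)) (at (s - of_nat N + 1))"
        using that by (intro prime_zeta_has_derivative) (simp add: H_def)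
      moreover have "((\<lambda>s. s - of_nat N + 1) has_field_derivative 1) (at s)"
        by (auto intro!: derivative_eq_intros)
      ultimately have "((\<lambda>s. dseries prime_ind (s - of_nat N + 1))
          has_field_derivative prime_zeta_deriv (s - of_nat N + 1) * 1) (at s)"
        by (rule DERIV_chain2[where g = "\<lambda>s. s - of_nat N + 1"])
      then show ?thesis by simp
    qed
    show "c holomorphic_on punctured_half_plane N" "h holomorphic_on punctured_half_plane N"
      unfolding X by (rule holomorphic_on_subset[OF ch(1)] holomorphic_on_subset[OF ch(2)]; blast)+
  qed (rule dec)
  with line not_ext sing(1) show ?thesis
    unfolding H_def F_def by (metis (no_types, lifting))
qed

end
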